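(* Consider a sequence of problem instances indexed by $n\to\infty$ (with $m,\mu_0,K$ depending on $n$, and $\sigma\in(0,\infty)$ fixed), where $K\subset\mathbb{R}^n$ is a closed convex set and $\mu_0\in K$. Let $r_n\in(0,\infty)$ be the unique solution of $n^{-1}\mathbb{E}\,\mathrm{err}(\omega_{m/n}(r))=r^2$, let $\omega_n=\omega_{m/n}(r_n)$, and consider the condition $$\text{(C)}\qquad \limsup_n\frac{1}{2n\sigma^2}\big(\mathbb{E}\,\mathrm{lrt}(\omega_n)-\mathbb{E}\,\mathrm{err}(\omega_n)\big)<1.$$ The following hold. (1) (C) is fulfilled if $\liminf_n(m/\delta_{T_K(\mu_0)})>1$. If $m\gg\delta_{T_K(\mu_0)}$, (C) holds with limit $0$ and therefore the residual satisfies $m^{-1}\|Y-X\hat\mu(\sigma)\|^2\to\sigma^2$ in probability. (2) Suppose that $K$ is a closed convex cone. Then (C) is fulfilled provided that $$\sigma^{-2}\cdot\limsup_n\; r_n\cdot\Big(\inf_{\nu\in L(K)}\|\mu_0-\nu\|/\sqrt n\Big)<1,$$ where $L(K)$ denotes the maximal linear subspace contained in $K$. In particular, when $r_n\to0$ and $\inf_{\nu\in L(K)}\|\mu_0-\nu\|/\sqrt n=\mathcal{O}(1)$, (C) holds with limit $0$ and therefore the residual satisfies $m^{-1}\|Y-X\hat\mu(\sigma)\|^2\to\sigma^2$ in probability.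
   Context: Model: $Y=X\mu_0+\xi$, where $X\in\mathbb{R}^{m\times n}$ has i.i.d. $\mathcal{N}(0,1/n)$ entries, and $\xi\in\mathbb{R}^m$ is an error vector independent of $X$ with i.i.d. coordinates of mean $0$ and variance $\sigma^2\in(0,\infty)$. $\hat\mu(\sigma)$ denotes any sequence of near minimizers, i.e. $\hat\mu(\sigma)\in K$ with $m^{-1}\|Y-X\hat\mu(\sigma)\|^2\le\min_{\mu\in K}m^{-1}\|Y-X\mu\|^2+\mathfrak{o}_{\mathbf P}(r_n^2)$. $\|\cdot\|$ is Euclidean, $\Pi_K$ is the metric projection onto $K$, $h\sim\mathcal{N}(0,I_n)$; for $\tau\ge0$, $\hat\mu_K^{\mathrm{seq}}(\tau)=\Pi_K(\mu_0+\tau h)$, $\mathrm{err}(\tau)=\|\hat\mu_K^{\mathrm{seq}}(\tau)-\mu_0\|^2$, $\mathrm{lrt}(\tau)=\|\tau h\|^2-\|\mu_0+\tau h-\hat\mu_K^{\mathrm{seq}}(\tau)\|^2$. $\omega_\delta(r)=\sqrt{(r^2+\sigma^2)/\delta}$. $\delta_K=\lim_{\tau\uparrow\infty}\mathbb{E}\|\Pi_K(\tau h)\|^2/\tau^2$ ($=\mathbb{E}\|\Pi_K(h)\|^2$ for a closed convex cone, in particular for $T_K(\mu_0)$). $T_K(\mu_0)=\mathrm{cl}\{\alpha(\nu-\mu_0):\alpha\ge0,\nu\in K\}$ is the tangent cone. The solution $r_n$ exists (and is then unique) when $m>\delta_K$, which is understood wherever $r_n$ appears. "(C) holds with limit $0$"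 means that the quantity inside the $\limsup$ in (C) tends to $0$. $a_n\gg b_n$ means $a_n/b_n\to\infty$. *)

theory Defs
  imports "HOL-Probability.Probability" "HOL-Library.Function_Algebras"
begin

text \<open>
  The dimension \<open>n\<close> varies along the sequence of problem instances, so \<open>\<real>\<^sup>n\<close> is the carrier of the
  library topology \<^const>\<open>Euclidean_space\<close> \<open>n\<close>, i.e. the functions \<open>nat \<Rightarrow> real\<close> that vanish from index
  \<open>n\<close> on, with Euclidean norm \<open>L2_set x {..<n}\<close>.  The pointwise real vector space structure makes
  the library notions \<^const>\<open>convex\<close>, \<^const>\<open>cone\<close> and \<^const>\<open>subspace\<close> applicable.
\<close>

instantiation "fun" :: (type, real_vector) real_vector
begin

definition scaleR_fun_def: "a *\<^sub>R f = (\<lambda>x. a *\<^sub>R f x)"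

instance
  by standard (simp_all add: scaleR_fun_def plus_fun_def fun_eq_iff algebra_simps)

end

abbreviation enorm :: "nat \<Rightarrow> (nat \<Rightarrow> real) \<Rightarrow> real"
  where "enorm n x \<equiv> L2_set x {..<n}"

definition metric_proj :: "nat \<Rightarrow> (nat \<Rightarrow> real) set \<Rightarrow> (nat \<Rightarrow> real) \<Rightarrow> nat \<Rightarrow> real"
  where "metric_proj n K y = arg_min_on (\<lambda>z. enorm n (y - z)) K"

definition tangent_cone :: "nat \<Rightarrow> (nat \<Rightarrow> real) set \<Rightarrow> (nat \<Rightarrow> real) \<Rightarrow> (nat \<Rightarrow> real) set"
  where "tangent_cone n K \<mu>\<^sub>0 =
    Euclidean_space n closure_of {\<alpha> *\<^sub>R (\<nu> - \<mu>\<^sub>0) | \<alpha> \<nu>. 0 \<le> \<alpha> \<and> \<nu> \<in> K}"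

text \<open>The order on sets is inclusion.  The greatest subspace exists whenever \<open>K\<close> is a convex cone.\<close>

definition lineality_space :: "(nat \<Rightarrow> real) set \<Rightarrow> (nat \<Rightarrow> real) set"
  where "lineality_space K = (GREATEST L. subspace L \<and> L \<subseteq> K)"

lemma lineality_space_convex_cone:
  assumes "convex K" "cone K" "K \<noteq> {}"
  shows "lineality_space K = {x \<in> K. - x \<in> K}"
  unfolding lineality_space_def
proof (rule Greatest_equality)
  have add: "x + y \<in> K" if "x \<in> K" "y \<in> K" for x y
    using assms that convex_cone by blast
  have scale: "c *\<^sub>R x \<in> K" if "x \<in> K" "0 \<le> c" for x c
    using assms that by (simp add: cone_def)
  have zero: "0 \<in> K"
    using assms cone_contains_0 by blast
  have "c *\<^sub>R x \<in> K" if "x \<in> K" "- x \<in> K" for c x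
  proof (cases "0 \<le> c")
    case False
    then have "(- c) *\<^sub>R (- x) \<in> K" using that by (intro scale) auto
    then show ?thesis by simp
  qed (use that scale in auto)
  moreover from this have "- (c *\<^sub>R x) \<in> K" if "x \<in> K" "- x \<in> K" for c x
    using that by (metis scaleR_minus_left)
  moreover have "- (x + y) \<in> K" if "- x \<in> K" "- y \<in> K" for x y
    using add[OF that] by (simp add: add.commute)
  ultimately show "subspace {x \<in> K. - x \<in> K} \<and> {x \<in> K. - x \<in> K} \<subseteq> K"
    using add zero by (auto simp: subspace_def)
next
  fix L assume "subspace L \<and> L \<subseteq> K"
  then show "L \<subseteq> {x \<in> K. - x \<in> K}"
    using subspace_neg by blast
qed

text \<open>The law \<open>N(0, I\<^sub>n)\<close>, transported to functions vanishing from index \<open>n\<close> on.\<close>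

definition std_gaussian :: "nat \<Rightarrow> (nat \<Rightarrow> real) measure"
  where "std_gaussian n =
    distr (\<Pi>\<^sub>M i\<in>{..<n}. std_normal_distribution) borel (\<lambda>g i. if i < n then g i else 0)"

definition mu_seq ::
    "nat \<Rightarrow> (nat \<Rightarrow> real) set \<Rightarrow> (nat \<Rightarrow> real) \<Rightarrow> real \<Rightarrow> (nat \<Rightarrow> real) \<Rightarrow> nat \<Rightarrow> real"
  where "mu_seq n K \<mu>\<^sub>0 \<tau> h = metric_proj n K (\<mu>\<^sub>0 + \<tau> *\<^sub>R h)"

definition err ::
    "nat \<Rightarrow> (nat \<Rightarrow> real) set \<Rightarrow> (nat \<Rightarrow> real) \<Rightarrow> real \<Rightarrow> (nat \<Rightarrow> real) \<Rightarrow> real"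
  where "err n K \<mu>\<^sub>0 \<tau> h = (enorm n (mu_seq n K \<mu>\<^sub>0 \<tau> h - \<mu>\<^sub>0))\<^sup>2"

definition lrt ::
    "nat \<Rightarrow> (nat \<Rightarrow> real) set \<Rightarrow> (nat \<Rightarrow> real) \<Rightarrow> real \<Rightarrow> (nat \<Rightarrow> real) \<Rightarrow> real"
  where "lrt n K \<mu>\<^sub>0 \<tau> h =
    (enorm n (\<tau> *\<^sub>R h))\<^sup>2 - (enorm n (\<mu>\<^sub>0 + \<tau> *\<^sub>R h - mu_seq n K \<mu>\<^sub>0 \<tau> h))\<^sup>2"

definition stat_dim :: "nat \<Rightarrow> (nat \<Rightarrow> real) set \<Rightarrow> real"
  where "stat_dim n K =
    Lim at_top (\<lambda>\<tau>. (\<integral>h. (enorm n (metric_proj n K (\<tau> *\<^sub>R h)))\<^sup>2 \<partial>std_gaussian n) / \<tau>\<^sup>2)"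

definition omega :: "real \<Rightarrow> real \<Rightarrow> real \<Rightarrow> real"
  where "omega \<sigma> \<delta> r = sqrt ((r\<^sup>2 + \<sigma>\<^sup>2) / \<delta>)"

definition fixed_point_sol ::
    "real \<Rightarrow> nat \<Rightarrow> nat \<Rightarrow> (nat \<Rightarrow> real) set \<Rightarrow> (nat \<Rightarrow> real) \<Rightarrow> real \<Rightarrow> bool"
  where "fixed_point_sol \<sigma> n m K \<mu>\<^sub>0 r \<longleftrightarrow>
    0 < r \<and> (\<integral>h. err n K \<mu>\<^sub>0 (omega \<sigma> (real m / real n) r) h \<partial>std_gaussian n) / real n = r\<^sup>2"

text \<open>The quantity inside the limit superior of condition (C).\<close>

definition gap ::
    "real \<Rightarrow> nat \<Rightarrow> nat \<Rightarrow> (nat \<Rightarrow> real) set \<Rightarrow> (nat \<Rightarrow> real) \<Rightarrow> real \<Rightarrow> real"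
  where "gap \<sigma> n m K \<mu>\<^sub>0 r =
    (let \<omega> = omega \<sigma> (real m / real n) r in
     1 / (2 * real n * \<sigma>\<^sup>2) *
       ((\<integral>h. lrt n K \<mu>\<^sub>0 \<omega> h \<partial>std_gaussian n) - (\<integral>h. err n K \<mu>\<^sub>0 \<omega> h \<partial>std_gaussian n)))"

definition mat_vec :: "nat \<Rightarrow> (nat \<Rightarrow> nat \<Rightarrow> real) \<Rightarrow> (nat \<Rightarrow> real) \<Rightarrow> nat \<Rightarrow> real"
  where "mat_vec n A v = (\<lambda>i. \<Sum>j<n. A i j * v j)"

text \<open>
  \<open>D\<close> is the common law of the coordinates of the error vector.  Only the entries with row index
  below \<open>m\<close> and column index below \<open>n\<close> are constrained.  The last clause is the independence of the
  design matrix and the error vector.  They have different types, which rules out \<open>indep_var\<close>, so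
  it is stated for the sigma-algebras they generate.
\<close>

definition design_and_noise ::
    "real measure \<Rightarrow> nat \<Rightarrow> nat \<Rightarrow> 'w measure \<Rightarrow>
     ('w \<Rightarrow> nat \<Rightarrow> nat \<Rightarrow> real) \<Rightarrow> ('w \<Rightarrow> nat \<Rightarrow> real) \<Rightarrow> bool"
  where "design_and_noise D n m M X \<xi> \<longleftrightarrow>
    prob_space M \<and>
    prob_space.indep_vars M (\<lambda>_. borel) (\<lambda>(i, j) w. X w i j) ({..<m} \<times> {..<n}) \<and>
    (\<forall>i<m. \<forall>j<n. distributed M lborel (\<lambda>w. X w i j) (normal_density 0 (sqrt (1 / real n)))) \<and>
    prob_space.indep_vars M (\<lambda>_. borel) (\<lambda>i w. \<xi> w i) {..<m} \<and>
    (\<forall>i<m. distr M borel (\<lambda>w. \<xi> w i) = D) \<and>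
    prob_space.indep_set M
      (sets (vimage_algebra (space M) (\<lambda>w. \<lambda>(i, j)\<in>{..<m} \<times> {..<n}. X w i j)
        (\<Pi>\<^sub>M p\<in>{..<m} \<times> {..<n}. borel)))
      (sets (vimage_algebra (space M) (\<lambda>w. \<lambda>i\<in>{..<m}. \<xi> w i)
        (\<Pi>\<^sub>M i\<in>{..<m}. borel)))"

definition response ::
    "nat \<Rightarrow> (nat \<Rightarrow> nat \<Rightarrow> real) \<Rightarrow> (nat \<Rightarrow> real) \<Rightarrow> (nat \<Rightarrow> real) \<Rightarrow> nat \<Rightarrow> real"
  where "response n A \<mu>\<^sub>0 e = mat_vec n A \<mu>\<^sub>0 + e"

definition residual ::
    "nat \<Rightarrow> nat \<Rightarrow> (nat \<Rightarrow> real) \<Rightarrow> (nat \<Rightarrow> nat \<Rightarrow> real) \<Rightarrow> (nat \<Rightarrow> real) \<Rightarrow> real"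
  where "residual n m y A \<mu> = (enorm m (y - mat_vec n A \<mu>))\<^sup>2 / real m"

definition tendsto_in_prob ::
    "(nat \<Rightarrow> 'w measure) \<Rightarrow> (nat \<Rightarrow> 'w \<Rightarrow> real) \<Rightarrow> real \<Rightarrow> bool"
  where "tendsto_in_prob M Z c \<longleftrightarrow>
    (\<forall>e>0. (\<lambda>n. measure (M n) {w \<in> space (M n). e < \<bar>Z n w - c\<bar>}) \<longlonglongrightarrow> 0)"

definition small_o_prob ::
    "(nat \<Rightarrow> 'w measure) \<Rightarrow> (nat \<Rightarrow> 'w \<Rightarrow> real) \<Rightarrow> (nat \<Rightarrow> real) \<Rightarrow> bool"
  where "small_o_prob M Z a \<longleftrightarrow> tendsto_in_prob M (\<lambda>n w. Z n w / a n) 0"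

text \<open>
  The minimum over \<open>K\<close> need not be attained when the design is not injective, so it is read as an
  infimum.
\<close>

definition near_minimizers ::
    "(nat \<Rightarrow> nat) \<Rightarrow> (nat \<Rightarrow> (nat \<Rightarrow> real) set) \<Rightarrow> (nat \<Rightarrow> real) \<Rightarrow> (nat \<Rightarrow> 'w measure) \<Rightarrow>
     (nat \<Rightarrow> 'w \<Rightarrow> nat \<Rightarrow> real) \<Rightarrow> (nat \<Rightarrow> 'w \<Rightarrow> nat \<Rightarrow> nat \<Rightarrow> real) \<Rightarrow>
     (nat \<Rightarrow> 'w \<Rightarrow> nat \<Rightarrow> real) \<Rightarrow> bool"
  where "near_minimizers m K r M Y X \<mu>h \<longleftrightarrow>
    (\<forall>n\<ge>1. \<mu>h n \<in> M n \<rightarrow>\<^sub>M borel \<and> (AE w in M n. \<mu>h n w \<in> K n)) \<and>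
    (\<exists>\<epsilon>. (\<forall>n\<ge>1. \<epsilon> n \<in> borel_measurable (M n)) \<and>
         small_o_prob M \<epsilon> (\<lambda>n. (r n)\<^sup>2) \<and>
         (\<forall>n\<ge>1. AE w in M n.
            residual n (m n) (Y n w) (X n w) (\<mu>h n w)
              \<le> (INF \<mu>\<in>K n. residual n (m n) (Y n w) (X n w) \<mu>) + \<epsilon> n w))"

end

theory Submission
  imports Defs
begin

text \<open>
  Write \<open>V = K - \<mu>\<^sub>0\<close> and \<open>\<omega>\<close> for the noise level at the fixed point.  Since \<open>lrt\<close> is the supremum
  over \<open>v \<in> V\<close> of \<open>2 \<omega> \<langle>h, v\<rangle> - \<parallel>v\<parallel>\<^sup>2\<close>, it is bounded by its analogue for the tangent cone, and for a cone
  \<open>lrt - err = 2 \<langle>\<mu>h - \<mu>\<^sub>0, \<mu>\<^sub>0 - \<nu>\<rangle> - 2 \<omega> \<langle>h, \<mu>\<^sub>0 - \<nu>\<rangle>\<close> for every \<open>\<nu>\<close> in the lineality space, where \<open>\<mu>h\<close> is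
  the projection of \<open>\<mu>\<^sub>0 + \<omega> h\<close>.  Together with the fixed point equation this bounds the gap.

  Whenever the residual is claimed to converge, both \<open>r\<close> and the gap tend to \<open>0\<close>, so the mean of
  \<open>lrt\<close> is \<open>o(n)\<close>.  This is a bound on the localized Gaussian width of \<open>V\<close>, and it suffices
  for a direct lower bound on the residual that needs no Gaussian min-max theorem.  With \<open>G\<close> the design
  rescaled to unit variance, an exchange argument compares \<open>\<Sum>\<^sub>i (\<parallel>v\<parallel> / 2 - \<bar>\<langle>G\<^sub>i, v\<rangle>\<bar>)\<close> with
  \<open>2 \<Sum>\<^sub>i \<langle>G\<^sub>i, v\<rangle>\<close>, so \<open>\<parallel>G v\<parallel>\<close> is at least of order \<open>sqrt m \<parallel>v\<parallel>\<close> uniformly over the large \<open>v \<in> V\<close>, while the cross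
  term \<open>\<langle>\<xi>, G v\<rangle>\<close> has, given \<open>\<xi>\<close>, the law of \<open>\<parallel>\<xi>\<parallel> \<langle>h, v\<rangle>\<close> and is negligible.  Hence the residual over \<open>K\<close> cannot
  fall noticeably below \<open>\<parallel>\<xi>\<parallel>\<^sup>2 / m\<close>, which is its value at \<open>\<mu>\<^sub>0\<close> and tends to \<open>\<sigma>\<^sup>2\<close>.
\<close>

section \<open>Projections onto closed convex sets\<close>

text \<open>Only the coordinates below \<open>n\<close> enter, so this form and
  \<open>enorm n\<close> are degenerate on all of \<open>nat \<Rightarrow> real\<close>. They
  separate points only among functions that vanish from index \<open>n\<close> on.\<close>

definition einner :: "nat \<Rightarrow> (nat \<Rightarrow> real) \<Rightarrow> (nat \<Rightarrow> real) \<Rightarrow> real"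
  where "einner n x y = (\<Sum>i<n. x i * y i)"

lemma scaleR_fun_apply [simp]: "(a *\<^sub>R f) x = a *\<^sub>R f x"
  by (simp add: scaleR_fun_def)

lemma einner_commute: "einner n x y = einner n y x"
  by (simp add: einner_def mult.commute)

lemma einner_add_left: "einner n (x + y) z = einner n x z + einner n y z"
  by (simp add: einner_def sum.distrib algebra_simps)

lemma einner_add_right: "einner n z (x + y) = einner n z x + einner n z y"
  by (simp add: einner_def sum.distrib algebra_simps)

lemma einner_diff_left: "einner n (x - y) z = einner n x z - einner n y z"
  by (simp add: einner_def sum_subtractf algebra_simps)

lemma einner_diff_right: "einner n z (x - y) = einner n z x - einner n z y"
  by (simp add: einner_def sum_subtractf algebra_simps)

lemma einner_scaleR_left [simp]: "einner n (a *\<^sub>R x) z = a * einner n x z"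
  by (simp add: einner_def sum_distrib_left algebra_simps)

lemma einner_scaleR_right [simp]: "einner n z (a *\<^sub>R x) = a * einner n z x"
  by (simp add: einner_def sum_distrib_left algebra_simps)

lemma einner_minus_left [simp]: "einner n (- x) z = - einner n x z"
  by (simp add: einner_def sum_negf)

lemma einner_minus_right [simp]: "einner n z (- x) = - einner n z x"
  by (simp add: einner_def sum_negf)

lemma einner_zero_left [simp]: "einner n 0 z = 0"
  by (simp add: einner_def)

lemma einner_zero_right [simp]: "einner n z 0 = 0"
  by (simp add: einner_def)

lemmas einner_simps = einner_add_left einner_add_right einner_diff_left einner_diff_right

lemma enorm_sq: "(enorm n x)\<^sup>2 = einner n x x"
  by (simp add: L2_set_def einner_def sum_nonneg power2_eq_square)

lemma einner_self_nonneg: "0 \<le> einner n x x"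
  by (simp flip: enorm_sq)

lemma enorm_eq_sqrt: "enorm n x = sqrt (einner n x x)"
  by (simp flip: enorm_sq)

lemma enorm_scaleR [simp]: "enorm n (a *\<^sub>R x) = \<bar>a\<bar> * enorm n x"
  by (simp add: enorm_eq_sqrt real_sqrt_mult)

lemma enorm_minus_commute: "enorm n (x - y) = enorm n (y - x)"
  by (simp add: enorm_eq_sqrt einner_simps einner_commute)

lemma enorm_zero [simp]: "enorm n 0 = 0"
  by (simp add: enorm_eq_sqrt)

lemma einner_le_enorm: "einner n x y \<le> enorm n x * enorm n y"
proof -
  have "einner n x y \<le> (\<Sum>i<n. \<bar>x i\<bar> * \<bar>y i\<bar>)"
    unfolding einner_def by (intro sum_mono) (metis abs_ge_self abs_mult)
  also have "\<dots> \<le> enorm n x * enorm n y"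
    by (rule L2_set_mult_ineq)
  finally show ?thesis .
qed

lemma abs_component_le_enorm: "i < n \<Longrightarrow> \<bar>x i\<bar> \<le> enorm n x"
proof -
  assume "i < n"
  then have "x i * x i \<le> (\<Sum>i<n. x i * x i)"
    by (intro member_le_sum) auto
  then have "(x i)\<^sup>2 \<le> (enorm n x)\<^sup>2"
    by (simp add: enorm_sq einner_def power2_eq_square[of "x i"])
  then show ?thesis
    by (metis L2_set_nonneg abs_le_square_iff abs_of_nonneg)
qed

section \<open>Continuity and compactness in the product topology\<close>

lemma continuous_on_enorm [continuous_intros]:
  assumes "continuous_on S f"
  shows "continuous_on S (\<lambda>x. enorm n (f x))"
proof -
  have "continuous_on S (\<lambda>x. f x i)" for i
    using assms by (rule continuous_on_product_then_coordinatewise)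
  then show ?thesis
    unfolding L2_set_def by (intro continuous_intros)
qed

lemma continuous_on_einner [continuous_intros]:
  assumes "continuous_on S f" "continuous_on S g"
  shows "continuous_on S (\<lambda>x. einner n (f x) (g x))"
proof -
  have "continuous_on S (\<lambda>x. f x i)" "continuous_on S (\<lambda>x. g x i)" for i
    by (rule continuous_on_product_then_coordinatewise, fact)+
  then show ?thesis
    unfolding einner_def by (intro continuous_intros)
qed

lemma continuous_on_fun_diff [continuous_intros]:
  fixes f g :: "'a :: topological_space \<Rightarrow> nat \<Rightarrow> real"
  assumes "continuous_on S f" "continuous_on S g"
  shows "continuous_on S (\<lambda>x. f x - g x)"
  using assms[THEN continuous_on_product_then_coordinatewise]
  by (intro continuous_on_coordinatewise_then_product) (simp add: continuous_intros)

lemma continuous_on_fun_add [continuous_intros]: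
  fixes f g :: "'a :: topological_space \<Rightarrow> nat \<Rightarrow> real"
  assumes "continuous_on S f" "continuous_on S g"
  shows "continuous_on S (\<lambda>x. f x + g x)"
  using assms[THEN continuous_on_product_then_coordinatewise]
  by (intro continuous_on_coordinatewise_then_product) (simp add: continuous_intros)

lemma continuous_on_fun_scaleR [continuous_intros]:
  fixes g :: "'a :: topological_space \<Rightarrow> nat \<Rightarrow> real"
  assumes "continuous_on S f" "continuous_on S g"
  shows "continuous_on S (\<lambda>x. f x *\<^sub>R g x)"
  using assms(1) assms(2)[THEN continuous_on_product_then_coordinatewise]
  by (intro continuous_on_coordinatewise_then_product) (simp add: continuous_intros)

text \<open>Functions carry the product topology, not one induced by \<open>enorm\<close>. Since the
  seminorm distance to a point is continuous for it, a Lipschitz bound in this seminorm still yields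
  continuity.\<close>

lemma continuous_on_enorm_Lipschitz:
  fixes f :: "(nat \<Rightarrow> real) \<Rightarrow> real"
  assumes "\<And>x y. \<bar>f x - f y\<bar> \<le> enorm n (x - y)"
  shows "continuous_on S f"
proof (rule continuous_at_imp_continuous_on, intro ballI)
  fix x
  have "continuous_on UNIV (\<lambda>y. enorm n (y - x))"
    by (intro continuous_intros)
  then have "((\<lambda>y. enorm n (y - x)) \<longlongrightarrow> enorm n (x - x)) (at x)"
    unfolding continuous_on_eq_continuous_at[OF open_UNIV] isCont_def by blast
  then have "((\<lambda>y. enorm n (y - x)) \<longlongrightarrow> 0) (at x)"
    by simp
  then have "((\<lambda>y. f y - f x) \<longlongrightarrow> 0) (at x)"
    by (rule Lim_null_comparison[rotated]) (simp add: assms)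
  then show "isCont f x"
    by (simp add: isCont_def LIM_zero_iff)
qed

text \<open>The set is a closed part of a product of compact intervals, which degenerate to
  \<open>{0}\<close> from index \<open>n\<close> on, so Tychonoff's theorem applies.\<close>

lemma compact_enorm_ball: "compact {x. (\<forall>i\<ge>n. x i = 0) \<and> enorm n (x - y) \<le> R}"
proof -
  let ?A = "\<lambda>i. if i < n then {y i - R .. y i + R} else {0::real}"
  let ?S = "{x. (\<forall>i\<ge>n. x i = 0) \<and> enorm n (x - y) \<le> R}"
  have "compactin (powertop_real UNIV) (PiE UNIV ?A)"
    by (subst compactin_PiE) auto
  then have c: "compact (PiE UNIV ?A)"
    by (simp add: euclidean_product_topology)
  have "closed {x. \<forall>i\<ge>n. x i = (0::real)}"
    using closedin_Euclidean_space[of n]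
    by (simp add: topspace_Euclidean_space euclidean_product_topology)
  moreover have "closed {x. enorm n (x - y) \<le> R}"
    by (intro closed_Collect_le continuous_intros)
  ultimately have "closed ?S"
    by (simp add: closed_Int Collect_conj_eq)
  moreover have "?S \<subseteq> PiE UNIV ?A"
  proof
    fix x assume x: "x \<in> ?S"
    have "\<bar>x i - y i\<bar> \<le> R" if "i < n" for i
      using abs_component_le_enorm[OF that, of "x - y"] x by simp
    then show "x \<in> PiE UNIV ?A"
      using x by (force simp: PiE_def Pi_def abs_le_iff)
  qed
  then have "PiE UNIV ?A \<inter> ?S = ?S" by blast
  ultimately show ?thesis
    using compact_Int_closed[OF c, of ?S] by simp
qed

section \<open>The nearest point of a closed convex set\<close>

locale closed_convex =
  fixes n :: nat and K :: "(nat \<Rightarrow> real) set"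
  assumes closedin: "closedin (Euclidean_space n) K" and convex: "convex K" and nonempty: "K \<noteq> {}"
begin

lemma closed: "closed K"
  using closedin closedin_Euclidean_space_iff by blast

lemma vanish: "x \<in> K \<Longrightarrow> n \<le> i \<Longrightarrow> x i = 0"
  using closedin closedin_Euclidean_space_iff[of n K] by (auto simp: topspace_Euclidean_space)

lemma segment_in: "\<lbrakk>x \<in> K; y \<in> K; 0 \<le> t; t \<le> 1\<rbrakk> \<Longrightarrow> x + t *\<^sub>R (y - x) \<in> K"
  using convexD[OF convex, of x y "1 - t" t] by (simp add: algebra_simps)

text \<open>Points farther from \<open>y\<close> than some fixed point of \<open>K\<close> cannot
  compete, so the search is confined to a compact set, on which the continuous distance attains its
  infimum.\<close>

lemma ex_nearest: "\<exists>p\<in>K. \<forall>z\<in>K. enorm n (y - p) \<le> enorm n (y - z)"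
proof -
  obtain x0 where x0: "x0 \<in> K" using nonempty by auto
  define S where "S = K \<inter> {x. (\<forall>i\<ge>n. x i = 0) \<and> enorm n (x - y) \<le> enorm n (x0 - y)}"
  have "compact S"
    unfolding S_def using closed compact_enorm_ball by (rule closed_Int_compact)
  moreover have "x0 \<in> S" using x0 vanish[OF x0] by (auto simp: S_def)
  then have "S \<noteq> {}" by auto
  moreover have "continuous_on S (\<lambda>x. enorm n (y - x))"
    by (intro continuous_intros)
  ultimately obtain p where p: "p \<in> S" "\<forall>z\<in>S. enorm n (y - p) \<le> enorm n (y - z)"
    using continuous_attains_inf by blast
  have "enorm n (y - p) \<le> enorm n (y - z)" if "z \<in> K" for z
  proof (cases "z \<in> S")
    case False
    then have "enorm n (x0 - y) < enorm n (z - y)"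
      using that vanish[OF that] by (auto simp: S_def)
    then show ?thesis using p(2) \<open>x0 \<in> S\<close> by (metis enorm_minus_commute less_imp_le order.trans)
  qed (use p in auto)
  then show ?thesis using p by (auto simp: S_def)
qed

text \<open>\<open>metric_proj\<close> is defined by Hilbert choice, so its properties rest on the
  existence of a minimizer.\<close>

lemma proj_in: "metric_proj n K y \<in> K"
  and proj_le: "z \<in> K \<Longrightarrow> enorm n (y - metric_proj n K y) \<le> enorm n (y - z)"
proof -
  obtain p where "p \<in> K" "\<forall>z\<in>K. enorm n (y - p) \<le> enorm n (y - z)"
    using ex_nearest by blast
  then have "is_arg_min (\<lambda>z. enorm n (y - z)) (\<lambda>z. z \<in> K) p"
    by (auto simp: is_arg_min_def not_less)
  then have "is_arg_min (\<lambda>z. enorm n (y - z)) (\<lambda>z. z \<in> K) (metric_proj n K y)"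
    unfolding metric_proj_def arg_min_on_def arg_min_def
    by (rule someI[where P="is_arg_min (\<lambda>z. enorm n (y - z)) (\<lambda>z. z \<in> K)"])
  then show "metric_proj n K y \<in> K" "z \<in> K \<Longrightarrow> enorm n (y - metric_proj n K y) \<le> enorm n (y - z)"
    by (auto simp: is_arg_min_def not_less)
qed

text \<open>A small step from the projection towards \<open>z\<close> stays in \<open>K\<close>. If
  the inner product were positive, this step would bring the point closer to
  \<open>y\<close>.\<close>

lemma proj_variational:
  assumes z: "z \<in> K"
  shows "einner n (y - metric_proj n K y) (z - metric_proj n K y) \<le> 0"
proof (rule ccontr)
  define p where "p = metric_proj n K y"
  define a where "a = einner n (y - p) (z - p)"
  define b where "b = einner n (z - p) (z - p)"
  assume "\<not> ?thesis"
  then have a: "0 < a" by (simp add: a_def p_def)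
  have b: "0 \<le> b" by (simp add: b_def einner_self_nonneg)
  \<comment> \<open>This step length satisfies both \<open>t \<le> 1\<close> and
    \<open>t * b \<le> a\<close>, so the quadratic term cannot outweigh the linear gain
    \<open>2 * t * a\<close>. It also covers \<open>b = 0\<close>.\<close>
  define t where "t = a / (a + b)"
  have t: "0 < t" "t \<le> 1" using a b by (auto simp: t_def field_simps)
  have "p \<in> K" by (simp add: p_def proj_in)
  then have "p + t *\<^sub>R (z - p) \<in> K" using z t by (intro segment_in) auto
  then have "(enorm n (y - p))\<^sup>2 \<le> (enorm n (y - (p + t *\<^sub>R (z - p))))\<^sup>2"
    unfolding p_def by (intro power_mono proj_le) auto
  also have "y - (p + t *\<^sub>R (z - p)) = (y - p) - t *\<^sub>R (z - p)" by simp
  also have "(enorm n \<dots>)\<^sup>2 = (enorm n (y - p))\<^sup>2 - 2 * t * a + t\<^sup>2 * b"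
    unfolding enorm_sq a_def b_def
    by (simp only: einner_diff_left[of _ "y - p"] einner_diff_right[of _ _ "y - p"] einner_scaleR_left
        einner_scaleR_right einner_commute[of n "z - p" "y - p"] power2_eq_square)
      (simp add: algebra_simps)
  finally have "2 * t * a \<le> t\<^sup>2 * b" by linarith
  then have "t * (2 * a) \<le> t * (t * b)" by (simp add: power2_eq_square mult_ac)
  then have "2 * a \<le> t * b" using t by simp
  also have "\<dots> \<le> a"
    using a b by (simp add: t_def field_simps)
  finally show False using a by simp
qed

text \<open>Adding the variational inequalities at \<open>p\<close> and at the projection bounds
  their squared distance by 0. From index \<open>n\<close> on both vanish, as members of
  \<open>K\<close>.\<close>

lemma proj_unique:
  assumes p: "p \<in> K" "\<And>z. z \<in> K \<Longrightarrow> einner n (y - p) (z - p) \<le> 0"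
  shows "metric_proj n K y = p"
proof -
  define q where "q = metric_proj n K y"
  have q: "q \<in> K" by (simp add: q_def proj_in)
  have "einner n (y - q) (p - q) \<le> 0" "einner n (y - p) (q - p) \<le> 0"
    using proj_variational[OF p(1)] p(2)[OF q] by (auto simp: q_def)
  then have "einner n (p - q) (p - q) \<le> 0"
    by (simp add: einner_simps einner_commute)
  then have "enorm n (p - q) = 0"
    by (simp add: enorm_eq_sqrt einner_self_nonneg antisym)
  then have "p i = q i" if "i < n" for i
    using abs_component_le_enorm[OF that, of "p - q"] by simp
  moreover have "p i = q i" if "n \<le> i" for i
    using vanish[OF p(1) that] vanish[OF q that] by simp
  ultimately show ?thesis
    unfolding q_def[symmetric] by (intro ext) (metis not_less)
qed

text \<open>The sum of the two variational inequalities is the firm estimate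
  \<open>einner n (p - q) (p - q) \<le> einner n (x - y) (p - q)\<close>; Cauchy-Schwarz
  finishes.\<close>

lemma proj_nonexpansive: "enorm n (metric_proj n K x - metric_proj n K y) \<le> enorm n (x - y)"
proof -
  define p q where "p = metric_proj n K x" and "q = metric_proj n K y"
  have "einner n (x - p) (q - p) \<le> 0" "einner n (y - q) (p - q) \<le> 0"
    by (auto simp: p_def q_def proj_variational proj_in)
  then have "(enorm n (p - q))\<^sup>2 \<le> einner n (x - y) (p - q)"
    unfolding enorm_sq by (simp add: einner_simps einner_commute)
  also have "\<dots> \<le> enorm n (x - y) * enorm n (p - q)"
    by (rule einner_le_enorm)
  finally have "enorm n (p - q) * enorm n (p - q) \<le> enorm n (x - y) * enorm n (p - q)"
    by (simp add: power2_eq_square)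
  then show ?thesis
    unfolding p_def[symmetric] q_def[symmetric]
    by (cases "enorm n (p - q) = 0") (simp_all add: mult_le_cancel_right less_le)
qed

lemma proj_component_continuous: "continuous_on S (\<lambda>y. metric_proj n K y i)"
proof (rule continuous_on_enorm_Lipschitz)
  fix x y
  show "\<bar>metric_proj n K x i - metric_proj n K y i\<bar> \<le> enorm n (x - y)"
  proof (cases "i < n")
    case True
    have "\<bar>metric_proj n K x i - metric_proj n K y i\<bar> \<le> enorm n (metric_proj n K x - metric_proj n K y)"
      using abs_component_le_enorm[OF True, of "metric_proj n K x - metric_proj n K y"] by simp
    also have "\<dots> \<le> enorm n (x - y)"
      by (rule proj_nonexpansive)
    finally show ?thesis .
  next
    case False
    then have "metric_proj n K x i = 0" "metric_proj n K y i = 0"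
      using vanish[OF proj_in] by auto
    then show ?thesis
      by simp
  qed
qed

lemma proj_continuous: "continuous_on S (metric_proj n K)"
  by (rule continuous_on_coordinatewise_then_product) (rule proj_component_continuous)

end

section \<open>The functionals \<open>err\<close> and \<open>lrt\<close>\<close>

locale convex_instance = closed_convex n K for n K +
  fixes \<mu>\<^sub>0 :: "nat \<Rightarrow> real"
  assumes mu0: "\<mu>\<^sub>0 \<in> K"
begin

lemma mu_seq_in: "mu_seq n K \<mu>\<^sub>0 \<tau> h \<in> K"
  by (simp add: mu_seq_def proj_in)

lemma lrt_eq:
  "lrt n K \<mu>\<^sub>0 \<tau> h = 2 * \<tau> * einner n h (mu_seq n K \<mu>\<^sub>0 \<tau> h - \<mu>\<^sub>0) - err n K \<mu>\<^sub>0 \<tau> h"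
  unfolding lrt_def err_def enorm_sq
  by (simp add: einner_simps einner_commute; (simp add: algebra_simps)?)

text \<open>Completing the square gives the defining difference of \<open>lrt\<close> with \<mu> in
  place of the projection, and the projection has the smallest distance. By \<open>lrt_eq\<close>
  the projection attains equality, so \<open>lrt\<close> is the supremum of these
  expressions.\<close>

lemma lrt_ge:
  assumes "\<mu> \<in> K"
  shows "2 * \<tau> * einner n h (\<mu> - \<mu>\<^sub>0) - (enorm n (\<mu> - \<mu>\<^sub>0))\<^sup>2 \<le> lrt n K \<mu>\<^sub>0 \<tau> h"
proof -
  have "(enorm n (\<mu>\<^sub>0 + \<tau> *\<^sub>R h - mu_seq n K \<mu>\<^sub>0 \<tau> h))\<^sup>2 \<le> (enorm n (\<mu>\<^sub>0 + \<tau> *\<^sub>R h - \<mu>))\<^sup>2"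
    unfolding mu_seq_def using assms by (intro power_mono proj_le) auto
  moreover have "2 * \<tau> * einner n h (\<mu> - \<mu>\<^sub>0) - (enorm n (\<mu> - \<mu>\<^sub>0))\<^sup>2
      = (enorm n (\<tau> *\<^sub>R h))\<^sup>2 - (enorm n (\<mu>\<^sub>0 + \<tau> *\<^sub>R h - \<mu>))\<^sup>2"
    unfolding enorm_sq by (simp add: einner_simps einner_commute; (simp add: algebra_simps)?)
  ultimately show ?thesis unfolding lrt_def by linarith
qed

text \<open>The difference is the pairing of the variational inequality with test point
  \<open>\<mu>\<^sub>0\<close>, so its sign is known.\<close>

lemma lrt_minus_err:
  "lrt n K \<mu>\<^sub>0 \<tau> h - err n K \<mu>\<^sub>0 \<tau> h =
    2 * einner n (\<mu>\<^sub>0 + \<tau> *\<^sub>R h - mu_seq n K \<mu>\<^sub>0 \<tau> h) (mu_seq n K \<mu>\<^sub>0 \<tau> h - \<mu>\<^sub>0)"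
  unfolding lrt_eq err_def enorm_sq
  by (simp add: einner_simps einner_commute; (simp add: algebra_simps)?)

lemma err_nonneg: "0 \<le> err n K \<mu>\<^sub>0 \<tau> h"
  by (simp add: err_def)

lemma err_le_lrt: "err n K \<mu>\<^sub>0 \<tau> h \<le> lrt n K \<mu>\<^sub>0 \<tau> h"
proof -
  have "einner n (\<mu>\<^sub>0 + \<tau> *\<^sub>R h - mu_seq n K \<mu>\<^sub>0 \<tau> h) (\<mu>\<^sub>0 - mu_seq n K \<mu>\<^sub>0 \<tau> h) \<le> 0"
    unfolding mu_seq_def by (rule proj_variational[OF mu0])
  then show ?thesis using lrt_minus_err[of \<tau> h] by (simp add: einner_simps)
qed

lemma lrt_nonneg: "0 \<le> lrt n K \<mu>\<^sub>0 \<tau> h"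
  using err_nonneg err_le_lrt by (rule order.trans)

lemma lrt_le: "lrt n K \<mu>\<^sub>0 \<tau> h \<le> \<tau>\<^sup>2 * (enorm n h)\<^sup>2"
  by (simp add: lrt_def power_mult_distrib)

lemma err_continuous: "continuous_on S (\<lambda>h. err n K \<mu>\<^sub>0 \<tau> h)"
  unfolding err_def mu_seq_def
  by (intro continuous_intros continuous_on_compose2[OF proj_continuous[of UNIV]]) auto

lemma lrt_continuous: "continuous_on S (\<lambda>h. lrt n K \<mu>\<^sub>0 \<tau> h)"
  unfolding lrt_def mu_seq_def
  by (intro continuous_intros continuous_on_compose2[OF proj_continuous[of UNIV]]) auto

lemma lrt_measurable [measurable]: "lrt n K \<mu>\<^sub>0 \<tau> \<in> borel_measurable borel"
  using lrt_continuous[of UNIV \<tau>] by (intro borel_measurable_continuous_onI)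

lemma err_measurable [measurable]: "err n K \<mu>\<^sub>0 \<tau> \<in> borel_measurable borel"
  using err_continuous[of UNIV \<tau>] by (intro borel_measurable_continuous_onI)

end

section \<open>Projections onto closed convex cones\<close>

locale closed_convex_cone = closed_convex n K for n K +
  assumes cone: "cone K"
begin

lemma zero_in: "0 \<in> K"
  using nonempty cone cone_contains_0 by blast

lemma scale_in: "x \<in> K \<Longrightarrow> 0 \<le> c \<Longrightarrow> c *\<^sub>R x \<in> K"
  using cone by (simp add: cone_def)

lemma add_in: "x \<in> K \<Longrightarrow> y \<in> K \<Longrightarrow> x + y \<in> K"
  using convex_cone convex cone by blast

text \<open>Both 0 and twice the projection lie in the cone; as test points they give two opposite
  inequalities.\<close>

lemma proj_orthogonal: "einner n (y - metric_proj n K y) (metric_proj n K y) = 0"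
proof -
  let ?p = "metric_proj n K y"
  have "einner n (y - ?p) (0 - ?p) \<le> 0" "einner n (y - ?p) (2 *\<^sub>R ?p - ?p) \<le> 0"
    by (intro proj_variational zero_in scale_in proj_in; simp)+
  then show ?thesis by (simp add: einner_simps)
qed

lemma proj_polar: "z \<in> K \<Longrightarrow> einner n (y - metric_proj n K y) z \<le> 0"
  using proj_variational[of z y] proj_orthogonal[of y] by (simp add: einner_simps)

lemma proj_scaleR:
  assumes "0 \<le> t"
  shows "metric_proj n K (t *\<^sub>R y) = t *\<^sub>R metric_proj n K y"
proof (rule proj_unique)
  let ?p = "metric_proj n K y"
  show "t *\<^sub>R ?p \<in> K" using assms proj_in scale_in by blast
  fix z assume "z \<in> K"
  then have "t * einner n (y - ?p) z \<le> 0"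
    using proj_polar[of z y] assms by (simp add: mult_nonneg_nonpos)
  moreover have "einner n (t *\<^sub>R y - t *\<^sub>R ?p) (z - t *\<^sub>R ?p) =
      t * einner n (y - ?p) z - t * t * einner n (y - ?p) ?p"
    by (simp add: einner_simps) (simp add: algebra_simps)
  ultimately show "einner n (t *\<^sub>R y - t *\<^sub>R ?p) (z - t *\<^sub>R ?p) \<le> 0"
    by (simp add: proj_orthogonal)
qed

sublocale at_zero: convex_instance n K 0
  by unfold_locales (rule zero_in)

lemma lrt_zero: "0 \<le> \<tau> \<Longrightarrow> lrt n K 0 \<tau> h = \<tau>\<^sup>2 * (enorm n (metric_proj n K h))\<^sup>2"
proof -
  assume "0 \<le> \<tau>"
  have "lrt n K 0 \<tau> h = err n K 0 \<tau> h"
    using at_zero.lrt_minus_err[of \<tau> h] proj_orthogonal[of "\<tau> *\<^sub>R h"] by (simp add: mu_seq_def)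
  with \<open>0 \<le> \<tau>\<close> show ?thesis
    by (simp add: mu_seq_def err_def proj_scaleR power_mult_distrib)
qed

text \<open>The projection onto a cone is positively homogeneous, so the quotient under the limit is
  constant for positive \<tau>.\<close>

lemma stat_dim_eq: "stat_dim n K = (\<integral>h. lrt n K 0 1 h \<partial>std_gaussian n)"
proof -
  let ?E = "\<lambda>\<tau>. (\<integral>h. (enorm n (metric_proj n K (\<tau> *\<^sub>R h)))\<^sup>2 \<partial>std_gaussian n) / \<tau>\<^sup>2"
  have "eventually (\<lambda>\<tau>. ?E \<tau> = (\<integral>h. lrt n K 0 1 h \<partial>std_gaussian n)) at_top"
    using eventually_gt_at_top[of "0::real"]
    by eventually_elim (simp add: lrt_zero proj_scaleR power_mult_distrib)
  then have "(?E \<longlongrightarrow> (\<integral>h. lrt n K 0 1 h \<partial>std_gaussian n)) at_top"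
    by (rule tendsto_eventually)
  then show ?thesis
    unfolding stat_dim_def by (intro tendsto_Lim) auto
qed

end

section \<open>The tangent cone\<close>

context convex_instance
begin

abbreviation "T \<equiv> tangent_cone n K \<mu>\<^sub>0"

text \<open>The carrier of \<open>Euclidean_space n\<close> is closed and contains the generated
  cone, so the relative closure agrees with the closure in the full function space.\<close>

lemma tangent_cone_eq_closure: "T = closure {\<alpha> *\<^sub>R (\<nu> - \<mu>\<^sub>0) | \<alpha> \<nu>. 0 \<le> \<alpha> \<and> \<nu> \<in> K}" (is "_ = closure ?C")
proof -
  let ?S = "topspace (Euclidean_space n)"
  have sub: "?C \<subseteq> ?S"
    using vanish[OF mu0] by (auto simp: topspace_Euclidean_space dest!: vanish)
  have "closed ?S"
    using closedin_Euclidean_space_iff closedin_topspace by blast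
  then have "closure ?C \<subseteq> ?S" using sub by (simp add: closure_minimal)
  moreover have "T = ?S \<inter> closure (?S \<inter> ?C)"
    unfolding tangent_cone_def
    by (subst Euclidean_space_def)
      (simp add: closure_of_subtopology topspace_Euclidean_space euclidean_product_topology)
  ultimately show ?thesis using sub by (simp add: Int_absorb1)
qed

text \<open>The generated cone is closed under nonnegative combinations because \<open>K\<close> is
  convex, and continuity of these combinations carries this over to the closure.\<close>

lemma tangent_cone_closed_convex_cone: "closed_convex_cone n T"
proof -
  define C where "C = {\<alpha> *\<^sub>R (\<nu> - \<mu>\<^sub>0) | \<alpha> \<nu>. 0 \<le> \<alpha> \<and> \<nu> \<in> K}"
  have T: "T = closure C"
    unfolding C_def by (rule tangent_cone_eq_closure)
  have C_intro: "\<alpha> *\<^sub>R (\<nu> - \<mu>\<^sub>0) \<in> C" if "0 \<le> \<alpha>" "\<nu> \<in> K" for \<alpha> \<nu>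
    using that unfolding C_def by blast
  have scale: "c *\<^sub>R x \<in> C" if "x \<in> C" "0 \<le> c" for c x
  proof -
    from that obtain \<alpha> \<nu> where "x = \<alpha> *\<^sub>R (\<nu> - \<mu>\<^sub>0)" "0 \<le> \<alpha>" "\<nu> \<in> K" unfolding C_def by blast
    then show ?thesis using C_intro[of "c * \<alpha>" \<nu>] that by simp
  qed
  have add: "x + y \<in> C" if "x \<in> C" "y \<in> C" for x y
  proof -
    from that obtain \<alpha> \<nu> \<beta> \<nu>' where x: "x = \<alpha> *\<^sub>R (\<nu> - \<mu>\<^sub>0)" "0 \<le> \<alpha>" "\<nu> \<in> K"
      and y: "y = \<beta> *\<^sub>R (\<nu>' - \<mu>\<^sub>0)" "0 \<le> \<beta>" "\<nu>' \<in> K" unfolding C_def by blast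
    show ?thesis
    proof (cases "\<alpha> + \<beta> = 0")
      case True
      then have "\<alpha> = 0" "\<beta> = 0" using x y by auto
      then show ?thesis using x y C_intro[of 0 \<nu>] by simp
    next
      case False
      \<comment> \<open>With the relative weight of \<beta>, the sum of the two scaled differences
        becomes one difference scaled by \<open>\<alpha> + \<beta>\<close>, whose point lies on the
        segment between \<nu> and \<open>\<nu>'\<close>.\<close>
      define t where "t = \<beta> / (\<alpha> + \<beta>)"
      have t: "(\<alpha> + \<beta>) * t = \<beta>" "0 \<le> t" "t \<le> 1" using x y False by (auto simp: t_def field_simps)
      have "x + y = (\<alpha> + \<beta>) *\<^sub>R ((\<nu> + t *\<^sub>R (\<nu>' - \<nu>)) - \<mu>\<^sub>0)"
      proof
        fix i
        have "(\<alpha> + \<beta>) * (t * (\<nu>' i - \<nu> i)) = \<beta> * (\<nu>' i - \<nu> i)" using t(1) by (metis mult.assoc)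
        then show "(x + y) i = ((\<alpha> + \<beta>) *\<^sub>R ((\<nu> + t *\<^sub>R (\<nu>' - \<nu>)) - \<mu>\<^sub>0)) i"
          unfolding x y by (simp add: algebra_simps)
      qed
      moreover have "\<nu> + t *\<^sub>R (\<nu>' - \<nu>) \<in> K" using x y t by (intro segment_in)
      ultimately show ?thesis using x(2) y(2) C_intro by simp
    qed
  qed
  have comb: "a *\<^sub>R x + b *\<^sub>R y \<in> T" if "x \<in> T" "y \<in> T" "0 \<le> a" "0 \<le> b" for a b x y
  proof -
    let ?f = "\<lambda>p::(nat \<Rightarrow> real) \<times> (nat \<Rightarrow> real). a *\<^sub>R fst p + b *\<^sub>R snd p"
    have "?f ` closure (C \<times> C) \<subseteq> closure C"
    proof (rule image_closure_subset)
      show "continuous_on (closure (C \<times> C)) ?f"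
        by (intro continuous_intros)
      show "?f ` (C \<times> C) \<subseteq> closure C"
      proof
        fix z assume "z \<in> ?f ` (C \<times> C)"
        then obtain u v where "u \<in> C" "v \<in> C" "z = a *\<^sub>R u + b *\<^sub>R v"
          by auto
        then have "z \<in> C" using add[OF scale[OF _ that(3)] scale[OF _ that(4)]] by simp
        then show "z \<in> closure C" by (rule subsetD[OF closure_subset])
      qed
    qed simp
    moreover have "(x, y) \<in> closure (C \<times> C)"
      using that by (simp add: closure_Times T)
    ultimately have "?f (x, y) \<in> closure C" by (rule subsetD[OF _ imageI])
    then show ?thesis by (simp add: T)
  qed
  have zero: "0 \<in> T"
    unfolding T using C_intro[OF order.refl mu0] closure_subset by auto
  show ?thesis
  proof
    show "closedin (Euclidean_space n) T"
      unfolding tangent_cone_def by (rule closedin_closure_of)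
    show "convex T" using comb by (simp add: convex_def)
    show "T \<noteq> {}" using zero by auto
    show "cone T" unfolding cone_def using comb[OF _ zero, of _ _ 0] by simp
  qed
qed

lemma diff_in_tangent_cone:
  assumes "\<nu> \<in> K" shows "\<nu> - \<mu>\<^sub>0 \<in> T"
  unfolding tangent_cone_eq_closure using assms
  by (intro subsetD[OF closure_subset] CollectI exI[of _ 1] exI[of _ \<nu>]) auto

text \<open>A supremum over \<open>K - \<mu>\<^sub>0\<close> is at most the one over the tangent
  cone, which contains it.\<close>

lemma lrt_le_tangent_cone: "lrt n K \<mu>\<^sub>0 \<tau> h \<le> lrt n T 0 \<tau> h"
proof -
  interpret T: closed_convex_cone n T by (rule tangent_cone_closed_convex_cone)
  show ?thesis
    using T.at_zero.lrt_ge[OF diff_in_tangent_cone[OF mu_seq_in[of \<tau> h]], of \<tau> h]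
    by (simp add: lrt_eq err_def)
qed

end

section \<open>The standard Gaussian law\<close>

lemma measurable_finite_support_ext [measurable]:
  fixes n :: nat
  assumes [measurable]: "\<And>j. j < n \<Longrightarrow> Z j \<in> borel_measurable M"
  shows "(\<lambda>w j. if j < n then Z j w else (0::real)) \<in> borel_measurable M"
proof (rule measurable_coordinatewise_then_product)
  fix j show "(\<lambda>w. if j < n then Z j w else 0) \<in> borel_measurable M"
    by (cases "j < n") auto
qed

lemma measurable_restrict_ext [measurable]:
  "(\<lambda>g i. if i < n then g i else (0::real)) \<in> borel_measurable (PiM {..<n::nat} (\<lambda>_. borel))"
  by (intro measurable_finite_support_ext measurable_component_singleton) auto

lemma sets_PiM_std_normal:
  "sets (PiM I (\<lambda>_. std_normal_distribution)) = sets (PiM I (\<lambda>_. borel))"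
  by (intro sets_PiM_cong) auto

lemma measurable_restrict_ext_std_normal [measurable]:
  "(\<lambda>g i. if i < n then g i else (0::real)) \<in> borel_measurable (PiM {..<n::nat} (\<lambda>_. std_normal_distribution))"
  using measurable_restrict_ext[of n] by (simp add: measurable_cong_sets[OF sets_PiM_std_normal refl])

lemma measurable_fun_apply [measurable (raw)]:
  fixes f :: "'a \<Rightarrow> nat \<Rightarrow> real"
  shows "f \<in> borel_measurable M \<Longrightarrow> (\<lambda>x. f x i) \<in> borel_measurable M"
  by (rule measurable_product_then_coordinatewise)

lemma measurable_fun_scaleR [measurable (raw)]:
  fixes f :: "'a \<Rightarrow> nat \<Rightarrow> real"
  assumes [measurable]: "c \<in> borel_measurable M" "f \<in> borel_measurable M"
  shows "(\<lambda>x. c x *\<^sub>R f x) \<in> borel_measurable M"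
  by (rule measurable_coordinatewise_then_product) simp

lemma measurable_fun_uminus [measurable (raw)]:
  fixes f :: "'a \<Rightarrow> nat \<Rightarrow> real"
  assumes [measurable]: "f \<in> borel_measurable M"
  shows "(\<lambda>x. - f x) \<in> borel_measurable M"
  by (rule measurable_coordinatewise_then_product) (simp add: fun_Compl_def)

lemma measurable_einner [measurable (raw)]:
  assumes [measurable]: "f \<in> borel_measurable M" "g \<in> borel_measurable M"
  shows "(\<lambda>x. einner n (f x) (g x)) \<in> borel_measurable M"
  unfolding einner_def by measurable

lemma measurable_enorm [measurable (raw)]:
  assumes [measurable]: "f \<in> borel_measurable M"
  shows "(\<lambda>x. enorm n (f x)) \<in> borel_measurable M"
  unfolding L2_set_def by measurable

lemma sets_std_gaussian [measurable_cong, simp]: "sets (std_gaussian n) = sets borel"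
  by (simp add: std_gaussian_def)

lemma space_std_gaussian [simp]: "space (std_gaussian n) = UNIV"
  by (simp add: std_gaussian_def)

lemma prob_space_std_normal: "prob_space std_normal_distribution"
  by (rule prob_space_normal_density) simp

lemma prob_space_PiM_std_normal: "prob_space (PiM I (\<lambda>_. std_normal_distribution))"
  by (intro prob_space_PiM prob_space_std_normal)

lemma prob_space_std_gaussian [intro, simp]: "prob_space (std_gaussian n)"
  unfolding std_gaussian_def
  by (rule prob_space.prob_space_distr[OF prob_space_PiM_std_normal]) measurable

lemma distributed_distr_borel:
  "distributed M lborel Z f \<Longrightarrow> distr M borel Z = density lborel f"
  by (metis distr_cong distributed_distr_eq_density sets_lborel)

text \<open>Serves to recognize a standard Gaussian vector by its coordinates. Positivity of
  \<open>n\<close> keeps the index set nonempty, as the characterization of independence by a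
  product law demands.\<close>

lemma (in prob_space) std_gaussian_lawI:
  assumes "0 < n" and ind: "indep_vars (\<lambda>_. borel) Z {..<n}"
    and norm: "\<And>j. j < n \<Longrightarrow> distributed M lborel (Z j) std_normal_density"
  shows "distr M borel (\<lambda>w j. if j < n then Z j w else 0) = std_gaussian n"
proof -
  have [measurable]: "Z j \<in> borel_measurable M" if "j < n" for j
    using ind that by (auto simp: indep_vars_def2)
  have "(\<Pi>\<^sub>M i\<in>{..<n}. std_normal_distribution) = (\<Pi>\<^sub>M i\<in>{..<n}. distr M borel (Z i))"
    by (intro PiM_cong) (auto simp: distributed_distr_borel[OF norm])
  also have "\<dots> = distr M (\<Pi>\<^sub>M i\<in>{..<n}. borel) (\<lambda>w. \<lambda>i\<in>{..<n}. Z i w)"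
    using ind \<open>0 < n\<close> by (subst (asm) indep_vars_iff_distr_eq_PiM') auto
  finally have "std_gaussian n =
      distr (distr M (\<Pi>\<^sub>M i\<in>{..<n}. borel) (\<lambda>w. \<lambda>i\<in>{..<n}. Z i w)) borel (\<lambda>g i. if i < n then g i else 0)"
    by (simp add: std_gaussian_def)
  also have "\<dots> = distr M borel ((\<lambda>g i. if i < n then g i else 0) \<circ> (\<lambda>w. \<lambda>i\<in>{..<n}. Z i w))"
    by (intro distr_distr measurable_restrict_ext measurable_restrict) auto
  also have "(\<lambda>g i. if i < n then g i else 0) \<circ> (\<lambda>w. \<lambda>i\<in>{..<n}. Z i w) = (\<lambda>w j. if j < n then Z j w else 0)"
    by (auto simp: fun_eq_iff)
  finally show ?thesis ..
qed

section \<open>Coordinates and linear functionals of a Gaussian vector\<close>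

lemma distr_std_gaussian_component:
  assumes "i < n"
  shows "distr (std_gaussian n) borel (\<lambda>h. h i) = std_normal_distribution"
proof -
  have "distr (std_gaussian n) borel (\<lambda>h. h i) =
      distr (\<Pi>\<^sub>M i\<in>{..<n}. std_normal_distribution) borel ((\<lambda>h. h i) \<circ> (\<lambda>g i. if i < n then g i else 0))"
    unfolding std_gaussian_def by (intro distr_distr) measurable
  also have "\<dots> = distr (\<Pi>\<^sub>M i\<in>{..<n}. std_normal_distribution) std_normal_distribution (\<lambda>g. g i)"
    using assms by (intro distr_cong) auto
  also have "\<dots> = std_normal_distribution"
    using assms by (intro distr_PiM_component prob_space_std_normal) auto
  finally show ?thesis .
qed

lemma distributed_std_gaussian_component:
  "i < n \<Longrightarrow> distributed (std_gaussian n) lborel (\<lambda>h. h i) std_normal_density"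
  using distr_std_gaussian_component[of i n]
  by (simp add: distributed_def cong: distr_cong)

lemma indep_vars_std_gaussian:
  assumes "0 < n"
  shows "prob_space.indep_vars (std_gaussian n) (\<lambda>_. borel) (\<lambda>i h. h i) {..<n}"
proof -
  interpret prob_space "std_gaussian n" by simp
  let ?P = "\<Pi>\<^sub>M i\<in>{..<n}. std_normal_distribution"
  have "distr (std_gaussian n) (\<Pi>\<^sub>M i\<in>{..<n}. borel) (\<lambda>h. \<lambda>i\<in>{..<n}. h i) =
      distr ?P (\<Pi>\<^sub>M i\<in>{..<n}. borel) ((\<lambda>h. \<lambda>i\<in>{..<n}. h i) \<circ> (\<lambda>g i. if i < n then g i else 0))"
    unfolding std_gaussian_def by (intro distr_distr measurable_restrict) measurable
  also have "\<dots> = distr ?P ?P (\<lambda>x. x)"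
    by (intro distr_cong) (auto simp: sets_PiM_std_normal space_PiM PiE_def extensional_def fun_eq_iff)
  also have "\<dots> = ?P" by simp
  also have "\<dots> = (\<Pi>\<^sub>M i\<in>{..<n}. distr (std_gaussian n) borel (\<lambda>h. h i))"
    by (intro PiM_cong) (auto simp: distr_std_gaussian_component)
  finally show ?thesis
    using assms by (subst indep_vars_iff_distr_eq_PiM') auto
qed

lemma distributed_std_gaussian_einner:
  assumes "0 < enorm n \<theta>"
  shows "distributed (std_gaussian n) lborel (\<lambda>h. einner n \<theta> h) (normal_density 0 (enorm n \<theta>))"
proof -
  interpret prob_space "std_gaussian n" by simp
  \<comment> \<open>Zero weights are removed because the rule for sums of independent normal
    variables demands positive standard deviations.\<close>
  define J where "J = {i. i < n \<and> \<theta> i \<noteq> 0}"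
  have sumJ: "(\<Sum>i<n. f i * \<theta> i) = (\<Sum>i\<in>J. f i * \<theta> i)" for f
    by (intro sum.mono_neutral_right) (auto simp: J_def)
  have "J \<noteq> {}"
    using assms sumJ[of \<theta>] by (auto simp: enorm_eq_sqrt einner_def)
  then have "0 < n" by (auto simp: J_def)
  have "distributed (std_gaussian n) lborel (\<lambda>h. \<Sum>i\<in>J. \<theta> i * h i)
      (normal_density (\<Sum>i\<in>J. 0) (sqrt (\<Sum>i\<in>J. \<bar>\<theta> i\<bar>\<^sup>2)))"
  proof (rule sum_indep_normal)
    show "indep_vars (\<lambda>_. borel) (\<lambda>i h. \<theta> i * h i) J"
      by (rule indep_vars_compose2[OF indep_vars_subset[OF indep_vars_std_gaussian[OF \<open>0 < n\<close>]]])
        (auto simp: J_def)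
    fix i assume "i \<in> J"
    then show "0 < \<bar>\<theta> i\<bar>" by (simp add: J_def)
    show "distributed (std_gaussian n) lborel (\<lambda>h. \<theta> i * h i) (normal_density 0 \<bar>\<theta> i\<bar>)"
      using normal_density_affine[OF distributed_std_gaussian_component[of i n], of "\<theta> i" 0] \<open>i \<in> J\<close>
      by (simp add: J_def)
  qed (use \<open>J \<noteq> {}\<close> in \<open>auto simp: J_def\<close>)
  moreover have "(\<Sum>i\<in>J. \<theta> i * h i) = einner n \<theta> h" for h
    using sumJ[of h] by (simp add: einner_def mult.commute)
  moreover have "sqrt (\<Sum>i\<in>J. \<bar>\<theta> i\<bar>\<^sup>2) = enorm n \<theta>"
    using sumJ[of \<theta>] by (simp add: enorm_eq_sqrt einner_def power2_eq_square)
  ultimately show ?thesis by simp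
qed

lemma std_gaussian_symmetric:
  assumes "0 < n"
  shows "distr (std_gaussian n) borel uminus = std_gaussian n"
proof -
  interpret prob_space "std_gaussian n" by simp
  have "distr (std_gaussian n) borel uminus =
      distr (std_gaussian n) borel (\<lambda>h j. if j < n then - h j else 0)"
  proof -
    \<comment> \<open>Negation and truncated negation differ on general functions and agree on those
      vanishing from \<open>n\<close> on. Composing with \<open>?r\<close> restricts attention to
      the latter.\<close>
    let ?r = "\<lambda>g i. if i < n then g i else (0::real)" and ?P = "\<Pi>\<^sub>M i\<in>{..<n}. std_normal_distribution"
    have "distr (std_gaussian n) borel uminus = distr ?P borel (uminus \<circ> ?r)"
      unfolding std_gaussian_def by (intro distr_distr) measurable
    also have "uminus \<circ> ?r = (\<lambda>h j. if j < n then - h j else 0) \<circ> ?r"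
      by (auto simp: fun_eq_iff)
    also have "distr ?P borel \<dots> = distr (std_gaussian n) borel (\<lambda>h j. if j < n then - h j else 0)"
      unfolding std_gaussian_def by (intro distr_distr[symmetric]) measurable
    finally show ?thesis .
  qed
  also have "\<dots> = std_gaussian n"
  proof (rule std_gaussian_lawI[OF assms])
    show "indep_vars (\<lambda>_. borel) (\<lambda>j h. - h j) {..<n}"
      by (rule indep_vars_compose2[OF indep_vars_std_gaussian[OF assms]]) auto
    show "distributed (std_gaussian n) lborel (\<lambda>h. - h j) std_normal_density" if "j < n" for j
      using normal_density_affine[OF distributed_std_gaussian_component[OF that], of "-1" 0] by simp
  qed
  finally show ?thesis .
qed

text \<open>A weight vector of seminorm 0 gives the zero functional, which has no density. Otherwise
  these are the first two moments of a normal variable.\<close>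

lemma std_gaussian_einner_moments:
  shows integrable_std_gaussian_einner: "integrable (std_gaussian n) (\<lambda>h. einner n \<theta> h)" (is ?A)
    and integral_std_gaussian_einner: "(\<integral>h. einner n \<theta> h \<partial>std_gaussian n) = 0" (is ?B)
    and integrable_std_gaussian_einner_sq: "integrable (std_gaussian n) (\<lambda>h. (einner n \<theta> h)\<^sup>2)" (is ?C)
    and integral_std_gaussian_einner_sq:
      "(\<integral>h. (einner n \<theta> h)\<^sup>2 \<partial>std_gaussian n) = (enorm n \<theta>)\<^sup>2" (is ?D)
proof -
  have "?A \<and> ?B \<and> ?C \<and> ?D"
  proof (cases "enorm n \<theta> = 0")
    case True
    then have "einner n \<theta> h = 0" for h
      using abs_component_le_enorm[of _ n \<theta>] by (auto simp: einner_def)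
    then show ?thesis using True by simp
  next
    case False
    then have pos: "0 < enorm n \<theta>" by (simp add: less_le)
    note d = distributed_std_gaussian_einner[OF pos]
    note m1 = normal_moment_odd[OF pos, of 0 0] and m2 = normal_moment_even[OF pos, of 0 1]
    have ?A
      using distributed_integrable[OF d, of "\<lambda>x. x"] m1 by (auto simp: has_bochner_integral_iff)
    moreover have ?B
      using distributed_integral[OF d, of "\<lambda>x. x"] m1 by (auto simp: has_bochner_integral_iff)
    moreover have ?C
      using distributed_integrable[OF d, of "\<lambda>x. x\<^sup>2"] m2 by (auto simp: has_bochner_integral_iff)
    moreover have ?D
      using distributed_integral[OF d, of "\<lambda>x. x\<^sup>2"] m2 by (auto simp: has_bochner_integral_iff)
    ultimately show ?thesis by simp
  qed
  then show ?A ?B ?C ?D by auto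
qed

text \<open>The mean equals \<open>sqrt (2 / pi)\<close> times the norm; the factor is rounded down
  to 1/2.\<close>

lemma integral_std_gaussian_abs_einner:
  "enorm n \<theta> / 2 \<le> (\<integral>h. \<bar>einner n \<theta> h\<bar> \<partial>std_gaussian n)"
proof (cases "enorm n \<theta> = 0")
  case False
  then have pos: "0 < enorm n \<theta>" by (simp add: less_le)
  note d = distributed_std_gaussian_einner[OF pos]
  have m: "has_bochner_integral lborel (\<lambda>x. normal_density 0 (enorm n \<theta>) x * \<bar>x\<bar>) (enorm n \<theta> * sqrt (2 / pi))"
    using normal_moment_abs_odd[OF pos, of 0 0] by simp
  have "(1/2::real) \<le> sqrt (2 / pi)"
    using pi_less_4 by (intro real_le_rsqrt) (simp add: power2_eq_square field_simps)
  then have "enorm n \<theta> / 2 \<le> enorm n \<theta> * sqrt (2 / pi)"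
    using pos by (simp add: field_simps)
  also have "\<dots> = (\<integral>h. \<bar>einner n \<theta> h\<bar> \<partial>std_gaussian n)"
    using distributed_integral[OF d, of abs] m by (simp add: has_bochner_integral_iff)
  finally show ?thesis .
qed simp

lemma integrable_std_gaussian_enorm_sq: "integrable (std_gaussian n) (\<lambda>h. (enorm n h)\<^sup>2)"
proof -
  define u where "u i = (\<lambda>j::nat. if j = i then 1 else (0::real))" for i
  have e: "einner n (u i) h = h i" if "i < n" for i h
    using that by (simp add: einner_def u_def if_distrib[of "\<lambda>x. x * _"] cong: if_cong)
  have "(enorm n h)\<^sup>2 = (\<Sum>i<n. (einner n (u i) h)\<^sup>2)" for h
    unfolding enorm_sq by (simp add: e) (simp add: einner_def power2_eq_square)
  then show ?thesis
    by (simp add: integrable_std_gaussian_einner_sq)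
qed

text \<open>Since \<open>h\<close> and \<open>- h\<close> have the same law, the squared positive
  and negative parts contribute equally to the second moment.\<close>

lemma integral_std_gaussian_einner_pos_sq:
  assumes "0 < n"
  shows "(\<integral>h. (max 0 (einner n \<theta> h))\<^sup>2 \<partial>std_gaussian n) = (enorm n \<theta>)\<^sup>2 / 2"
    and "integrable (std_gaussian n) (\<lambda>h. (max 0 (einner n \<theta> h))\<^sup>2)"
proof -
  let ?f = "\<lambda>h. (max 0 (einner n \<theta> h))\<^sup>2"
  show int: "integrable (std_gaussian n) ?f"
    by (rule Bochner_Integration.integrable_bound[OF integrable_std_gaussian_einner_sq[of n \<theta>]])
      (auto simp: max_def)
  have "(\<integral>h. ?f h \<partial>std_gaussian n) = (\<integral>h. ?f h \<partial>distr (std_gaussian n) borel uminus)"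
    by (simp add: std_gaussian_symmetric[OF assms])
  also have "\<dots> = (\<integral>h. ?f (- h) \<partial>std_gaussian n)"
    by (rule integral_distr) measurable
  finally have eq: "(\<integral>h. ?f (- h) \<partial>std_gaussian n) = (\<integral>h. ?f h \<partial>std_gaussian n)" ..
  have int': "integrable (std_gaussian n) (\<lambda>h. ?f (- h))"
    by (rule Bochner_Integration.integrable_bound[OF integrable_std_gaussian_einner_sq[of n \<theta>]])
      (auto simp: max_def)
  have "(einner n \<theta> h)\<^sup>2 = ?f h + ?f (- h)" for h
    by (auto simp: max_def)
  then have "(enorm n \<theta>)\<^sup>2 = (\<integral>h. ?f h + ?f (- h) \<partial>std_gaussian n)"
    by (simp flip: integral_std_gaussian_einner_sq)
  also have "\<dots> = 2 * (\<integral>h. ?f h \<partial>std_gaussian n)"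
    using int int' eq by simp
  finally show "(\<integral>h. ?f h \<partial>std_gaussian n) = (enorm n \<theta>)\<^sup>2 / 2" by simp
qed

text \<open>In each column the combination is normal with standard deviation \<open>s\<close>, and
  different columns use disjoint sets of independent entries. Hence the combined row is a scaled
  standard Gaussian vector.\<close>

lemma (in prob_space) distr_gaussian_combination:
  fixes G :: "'i \<times> nat \<Rightarrow> 'a \<Rightarrow> real"
  assumes n: "0 < n" and I: "finite I"
    and ind: "indep_vars (\<lambda>_. borel) G (I \<times> {..<n})"
    and norm: "\<And>i j. i \<in> I \<Longrightarrow> j < n \<Longrightarrow> distributed M lborel (G (i, j)) std_normal_density"
    and s: "s = sqrt (\<Sum>i\<in>I. (c i)\<^sup>2)" "0 < s"
  shows "distr M borel (\<lambda>w j. if j < n then \<Sum>i\<in>I. c i * G (i, j) w else 0) =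
    distr (std_gaussian n) borel (\<lambda>h. s *\<^sub>R h)"
proof -
  define Z where "Z j w = (\<Sum>i\<in>I. c i * G (i, j) w) / s" for j w
  define J where "J = {i\<in>I. c i \<noteq> 0}"
  have J: "finite J" using I by (simp add: J_def)
  have sJ: "s = sqrt (\<Sum>i\<in>J. (c i)\<^sup>2)"
    unfolding s(1) J_def by (intro arg_cong[where f=sqrt] sum.mono_neutral_right) (use I in auto)
  then have "J \<noteq> {}" using s(2) by auto
  have ZJ: "Z j w = (\<Sum>i\<in>J. c i * G (i, j) w) / s" for j w
    unfolding Z_def J_def by (intro arg_cong[where f="\<lambda>x. x / s"] sum.mono_neutral_right) (use I in auto)
  have rv: "G (i, j) \<in> borel_measurable M" if "i \<in> I" "j < n" for i j
    using ind that by (auto simp: indep_vars_def2)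
  have indZ: "indep_vars (\<lambda>_. borel) Z {..<n}"
  proof -
    have "indep_vars (\<lambda>j. PiM (I \<times> {j}) (\<lambda>_. borel)) (\<lambda>j w. restrict (\<lambda>p. G p w) (I \<times> {j})) {..<n}"
      by (rule indep_vars_restrict[OF ind]) (auto simp: disjoint_family_on_def)
    then have "indep_vars (\<lambda>_. borel)
        (\<lambda>j w. (\<lambda>x. (\<Sum>i\<in>I. c i * x (i, j)) / s) (restrict (\<lambda>p. G p w) (I \<times> {j}))) {..<n}"
      by (rule indep_vars_compose2)
        (intro borel_measurable_divide borel_measurable_sum borel_measurable_times
          borel_measurable_const measurable_component_singleton; simp)
    then show ?thesis
      by (simp add: Z_def[abs_def] cong: sum.cong)
  qed
  have normZ: "distributed M lborel (Z j) std_normal_density" if j: "j < n" for j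
  proof -
    have "indep_vars (\<lambda>_. borel) (\<lambda>i w. c i * G (i, j) w) J"
    proof -
      have "indep_vars (\<lambda>i. PiM {(i, j)} (\<lambda>_. borel)) (\<lambda>i w. restrict (\<lambda>p. G p w) {(i, j)}) J"
        by (rule indep_vars_restrict[OF ind]) (use j in \<open>auto simp: disjoint_family_on_def J_def\<close>)
      then have "indep_vars (\<lambda>_. borel)
          (\<lambda>i w. (\<lambda>x. c i * x (i, j)) (restrict (\<lambda>p. G p w) {(i, j)})) J"
        by (rule indep_vars_compose2)
          (intro borel_measurable_times borel_measurable_const measurable_component_singleton; simp)
      then show ?thesis by simp
    qed
    then have "distributed M lborel (\<lambda>w. \<Sum>i\<in>J. c i * G (i, j) w)
        (normal_density (\<Sum>i\<in>J. 0) (sqrt (\<Sum>i\<in>J. \<bar>c i\<bar>\<^sup>2)))"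
    proof (rule sum_indep_normal[OF J \<open>J \<noteq> {}\<close>])
      fix i assume "i \<in> J"
      then show "0 < \<bar>c i\<bar>" "distributed M lborel (\<lambda>w. c i * G (i, j) w) (normal_density 0 \<bar>c i\<bar>)"
        using normal_density_affine[OF norm[of i j], of "c i" 0] j by (auto simp: J_def)
    qed
    then have d: "distributed M lborel (\<lambda>w. \<Sum>i\<in>J. c i * G (i, j) w) (normal_density 0 s)"
      by (simp add: sJ)
    show ?thesis
      using normal_density_affine[OF d s(2), of "1 / s" 0] s(2) by (simp add: ZJ[abs_def])
  qed
  have [measurable]: "Z j \<in> borel_measurable M" if "j < n" for j
    using indZ that by (auto simp: indep_vars_def2)
  have "distr (std_gaussian n) borel (\<lambda>h. s *\<^sub>R h) =
      distr (distr M borel (\<lambda>w j. if j < n then Z j w else 0)) borel (\<lambda>h. s *\<^sub>R h)"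
    by (simp add: std_gaussian_lawI[OF n indZ normZ])
  also have "\<dots> = distr M borel ((\<lambda>h. s *\<^sub>R h) \<circ> (\<lambda>w j. if j < n then Z j w else 0))"
    by (intro distr_distr) measurable
  also have "(\<lambda>h. s *\<^sub>R h) \<circ> (\<lambda>w j. if j < n then Z j w else 0) =
      (\<lambda>w j. if j < n then \<Sum>i\<in>I. c i * G (i, j) w else 0)"
    using s(2) by (auto simp: fun_eq_iff Z_def)
  finally show ?thesis ..
qed

text \<open>Disjoint blocks of independent entries are independent, and each row block is standard
  Gaussian.\<close>

lemma (in prob_space) indep_gaussian_rows:
  fixes G :: "'i \<times> nat \<Rightarrow> 'a \<Rightarrow> real"
  assumes n: "0 < n" and I: "finite I" "I \<noteq> {}"
    and ind: "indep_vars (\<lambda>_. borel) G (I \<times> {..<n})"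
    and norm: "\<And>i j. i \<in> I \<Longrightarrow> j < n \<Longrightarrow> distributed M lborel (G (i, j)) std_normal_density"
  shows "distr M (PiM I (\<lambda>_. borel)) (\<lambda>w. \<lambda>i\<in>I. \<lambda>j. if j < n then G (i, j) w else 0) =
    PiM I (\<lambda>_. std_gaussian n)"
proof -
  let ?R = "\<lambda>i w j. if j < n then G (i, j) w else (0::real)"
  have rv: "G (i, j) \<in> borel_measurable M" if "i \<in> I" "j < n" for i j
    using ind that by (auto simp: indep_vars_def2)
  have rvR: "?R i \<in> borel_measurable M" if "i \<in> I" for i
    using rv[OF that] by (rule measurable_finite_support_ext)
  have "indep_vars (\<lambda>i. PiM ({i} \<times> {..<n}) (\<lambda>_. borel)) (\<lambda>i w. restrict (\<lambda>p. G p w) ({i} \<times> {..<n})) I"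
    by (rule indep_vars_restrict[OF ind]) (auto simp: disjoint_family_on_def)
  then have "indep_vars (\<lambda>_. borel)
      (\<lambda>i w. (\<lambda>x j. if j < n then x (i, j) else (0::real)) (restrict (\<lambda>p. G p w) ({i} \<times> {..<n}))) I"
    by (rule indep_vars_compose2)
      (intro measurable_finite_support_ext measurable_component_singleton; simp)
  then have indR: "indep_vars (\<lambda>_. borel) ?R I"
    by (simp cong: if_cong)
  have "distr M borel (?R i) = std_gaussian n" if i: "i \<in> I" for i
  proof (rule std_gaussian_lawI[OF n])
    have "indep_vars (\<lambda>j. PiM {(i, j)} (\<lambda>_. borel)) (\<lambda>j w. restrict (\<lambda>p. G p w) {(i, j)}) {..<n}"
      by (rule indep_vars_restrict[OF ind]) (use i in \<open>auto simp: disjoint_family_on_def\<close>)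
    then have "indep_vars (\<lambda>_. borel) (\<lambda>j w. (\<lambda>x. x (i, j)) (restrict (\<lambda>p. G p w) {(i, j)})) {..<n}"
      by (rule indep_vars_compose2) (intro measurable_component_singleton; simp)
    then show "indep_vars (\<lambda>_. borel) (\<lambda>j. G (i, j)) {..<n}" by simp
  qed (use norm i in auto)
  then have "PiM I (\<lambda>_. std_gaussian n) = (\<Pi>\<^sub>M i\<in>I. distr M borel (?R i))"
    by (intro PiM_cong) auto
  also have "\<dots> = distr M (PiM I (\<lambda>_. borel)) (\<lambda>w. \<lambda>i\<in>I. ?R i w)"
    using indR I rvR by (subst (asm) indep_vars_iff_distr_eq_PiM') auto
  finally show ?thesis ..
qed

section \<open>A comparison inequality for Gaussian rows\<close>

text \<open>\<open>ennreal\<close> sends negative numbers to 0, so it acts as the positive part,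
  which is subadditive.\<close>

lemma ennreal_add_le: "ennreal (a + b) \<le> ennreal a + ennreal b"
proof -
  have "ennreal (a + b) \<le> ennreal (max 0 a + max 0 b)"
    by (intro ennreal_leI) auto
  also have "\<dots> = ennreal a + ennreal b"
    by (subst ennreal_plus) (auto simp: max_def ennreal_neg)
  finally show ?thesis .
qed

text \<open>This is Jensen's inequality for the positive part.\<close>

lemma ennreal_integral_le_nn_integral:
  assumes "integrable M f"
  shows "ennreal (\<integral>x. f x \<partial>M) \<le> (\<integral>\<^sup>+x. ennreal (f x) \<partial>M)"
proof -
  have "ennreal (\<integral>x. f x \<partial>M) \<le> ennreal (\<integral>x. max 0 (f x) \<partial>M)"
    using assms by (intro ennreal_leI integral_mono) auto
  also have "\<dots> = (\<integral>\<^sup>+x. ennreal (max 0 (f x)) \<partial>M)"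
    using assms by (intro nn_integral_eq_integral[symmetric]) auto
  also have "\<dots> = (\<integral>\<^sup>+x. ennreal (f x) \<partial>M)"
    by (intro nn_integral_cong) (simp add: max_def ennreal_neg)
  finally show ?thesis .
qed

lemma SUP_add_SUP_le_ennreal:
  fixes f :: "'a \<Rightarrow> ennreal" and g :: "'b \<Rightarrow> ennreal"
  assumes "I \<noteq> {}" "J \<noteq> {}" "\<And>i j. i \<in> I \<Longrightarrow> j \<in> J \<Longrightarrow> f i + g j \<le> c"
  shows "(SUP i\<in>I. f i) + (SUP j\<in>J. g j) \<le> c"
proof -
  have "f i + (SUP j\<in>J. g j) \<le> c" if "i \<in> I" for i
    using assms that by (subst ennreal_SUP_add_right) (auto intro: SUP_least)
  then show ?thesis
    using assms(1) by (subst add.commute, subst ennreal_SUP_add_right) (auto intro: SUP_least simp: add.commute)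
qed

text \<open>
  Writing the mean of \<open>\<bar>\<langle>g, v\<rangle>\<bar>\<close> as an integral over an independent copy \<open>g'\<close> and exchanging \<open>g\<close> with
  \<open>g'\<close>, one gets \<open>\<bar>\<langle>g', s\<rangle>\<bar> - \<bar>\<langle>g, s\<rangle>\<bar> + \<bar>\<langle>g, t\<rangle>\<bar> - \<bar>\<langle>g', t\<rangle>\<bar> \<le> \<bar>\<langle>g', s - t\<rangle>\<bar> + \<bar>\<langle>g, s - t\<rangle>\<bar>\<close>, where each absolute
  value on the right has a sign that splits it into a term in \<open>s\<close> and a term in \<open>t\<close>.
\<close>

lemma nn_integral_SUP_abs_einner_le:
  assumes n: "0 < n" and D: "countable D" "0 \<in> D" and A: "A 0 = 0"
  shows "(\<integral>\<^sup>+g. (SUP v\<in>D. ennreal (A v + (enorm n v / 2 - \<bar>einner n g v\<bar>))) \<partial>std_gaussian n)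
    \<le> (\<integral>\<^sup>+g. (SUP v\<in>D. ennreal (A v + 2 * einner n g v)) \<partial>std_gaussian n)"
proof -
  let ?\<gamma> = "std_gaussian n"
  interpret prob_space ?\<gamma> by simp
  interpret \<gamma>: pair_sigma_finite ?\<gamma> ?\<gamma> ..
  define H where "H g = (SUP v\<in>D. ennreal (A v + 2 * einner n g v))" for g
  \<comment> \<open>The lower bound \<open>enorm n v / 2\<close> for a mean absolute value is
    replaced by the value at an independent copy \<open>g'\<close>; integrating over
    \<open>g'\<close> restores a quantity at least as large.\<close>
  define P where "P g g' = (SUP v\<in>D. ennreal (A v + (\<bar>einner n g' v\<bar> - \<bar>einner n g v\<bar>)))" for g g'
  have [measurable]: "H \<in> borel_measurable borel"
    unfolding H_def[abs_def] using D by (intro borel_measurable_SUP) measurable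
  have [measurable]: "(\<lambda>(g, g'). P g g') \<in> borel_measurable (?\<gamma> \<Otimes>\<^sub>M ?\<gamma>)"
    unfolding P_def split_beta' using D by (intro borel_measurable_SUP) measurable
  have le_H: "ennreal (A v + 2 * einner n g v) \<le> H g" if "v \<in> D" for v g
    unfolding H_def using that by (rule SUP_upper)

  have two: "2 * ennreal x = ennreal (2 * x)" if "0 \<le> x" for x
    using ennreal_mult[of 2 x] that by simp
  \<comment> \<open>The sign of the inner product decides which of \<open>s\<close> and
    \<open>t\<close> is paired with \<open>g\<close> and which with \<open>- g\<close>; each summand
    is then bounded by one supremum.\<close>
  have split: "ennreal (A s + A t + 2 * \<bar>einner n g (s - t)\<bar>) \<le> H g + H (- g)"
    if "s \<in> D" "t \<in> D" for s t g
  proof (cases "0 \<le> einner n g (s - t)")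
    case True
    then have "A s + A t + 2 * \<bar>einner n g (s - t)\<bar> =
        (A s + 2 * einner n g s) + (A t + 2 * einner n (- g) t)"
      by (simp add: einner_diff_right)
    then show ?thesis
      using ennreal_add_le add_mono[OF le_H[OF that(1)] le_H[OF that(2)]] order.trans by metis
  next
    case False
    then have "A s + A t + 2 * \<bar>einner n g (s - t)\<bar> =
        (A t + 2 * einner n g t) + (A s + 2 * einner n (- g) s)"
      by (simp add: einner_diff_right)
    then show ?thesis
      using ennreal_add_le add_mono[OF le_H[OF that(2)] le_H[OF that(1)]] order.trans by metis
  qed
  have exchange: "2 * (P g g' + P g' g) \<le> (H g + H (- g)) + (H g' + H (- g'))" for g g'
  proof -
    have "2 * P g g' + 2 * P g' g \<le> (H g + H (- g)) + (H g' + H (- g'))"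
      unfolding P_def SUP_mult_left_ennreal
    proof (rule SUP_add_SUP_le_ennreal)
      fix s t assume st: "s \<in> D" "t \<in> D"
      let ?x = "\<lambda>s. A s + (\<bar>einner n g' s\<bar> - \<bar>einner n g s\<bar>)"
      let ?y = "\<lambda>t. A t + (\<bar>einner n g t\<bar> - \<bar>einner n g' t\<bar>)"
      \<comment> \<open>A negative value counts as 0 under \<open>ennreal\<close>, which is also the
        value at \<open>0 \<in> D\<close> because \<open>A 0 = 0\<close>. The replacement makes both
        values nonnegative, so that \<open>ennreal\<close> is additive on them.\<close>
      define s' where "s' = (if 0 \<le> ?x s then s else 0)"
      define t' where "t' = (if 0 \<le> ?y t then t else 0)"
      have D': "s' \<in> D" "t' \<in> D" and pos: "0 \<le> ?x s'" "0 \<le> ?y t'"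
        and x: "ennreal (?x s) \<le> ennreal (?x s')" and y: "ennreal (?y t) \<le> ennreal (?y t')"
        using st D(2) A by (auto simp: s'_def t'_def ennreal_neg)
      have "2 * ennreal (?x s) + 2 * ennreal (?y t) \<le> 2 * ennreal (?x s') + 2 * ennreal (?y t')"
        using x y by (intro add_mono mult_left_mono) auto
      also have "\<dots> = ennreal (2 * ?x s' + 2 * ?y t')"
        using pos by (simp only: two ennreal_plus mult_nonneg_nonneg zero_le_numeral)
      also have "\<dots> \<le> ennreal ((A s' + A t' + 2 * \<bar>einner n g (s' - t')\<bar>)
          + (A s' + A t' + 2 * \<bar>einner n g' (s' - t')\<bar>))"
      proof (intro ennreal_leI)
        have "\<bar>einner n g' s'\<bar> - \<bar>einner n g' t'\<bar> \<le> \<bar>einner n g' (s' - t')\<bar>"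
            "\<bar>einner n g t'\<bar> - \<bar>einner n g s'\<bar> \<le> \<bar>einner n g (s' - t')\<bar>"
          unfolding einner_diff_right by (rule abs_triangle_ineq2, rule abs_triangle_ineq2_sym)
        then show "2 * ?x s' + 2 * ?y t' \<le> (A s' + A t' + 2 * \<bar>einner n g (s' - t')\<bar>)
          + (A s' + A t' + 2 * \<bar>einner n g' (s' - t')\<bar>)"
          by argo
      qed
      also have "\<dots> \<le> ennreal (A s' + A t' + 2 * \<bar>einner n g (s' - t')\<bar>)
          + ennreal (A s' + A t' + 2 * \<bar>einner n g' (s' - t')\<bar>)"
        by (rule ennreal_add_le)
      also have "\<dots> \<le> (H g + H (- g)) + (H g' + H (- g'))"
        using D' by (intro add_mono split)
      finally show "2 * ennreal (?x s) + 2 * ennreal (?y t) \<le> (H g + H (- g)) + (H g' + H (- g'))" .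
    qed (use D in auto)
    then show ?thesis by (simp add: distrib_left)
  qed

  have "(SUP v\<in>D. ennreal (A v + (enorm n v / 2 - \<bar>einner n g v\<bar>))) \<le> (\<integral>\<^sup>+g'. P g g' \<partial>?\<gamma>)" for g
  proof (rule SUP_least)
    fix v assume v: "v \<in> D"
    have int: "integrable ?\<gamma> (\<lambda>g'. \<bar>einner n g' v\<bar>)"
      using integrable_abs[OF integrable_std_gaussian_einner[of n v]] by (simp add: einner_commute)
    have "ennreal (A v + (enorm n v / 2 - \<bar>einner n g v\<bar>)) \<le>
        ennreal (A v + ((\<integral>g'. \<bar>einner n g' v\<bar> \<partial>?\<gamma>) - \<bar>einner n g v\<bar>))"
      using integral_std_gaussian_abs_einner[of v n] by (intro ennreal_leI) (simp add: einner_commute)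
    also have "A v + ((\<integral>g'. \<bar>einner n g' v\<bar> \<partial>?\<gamma>) - \<bar>einner n g v\<bar>) =
        (\<integral>g'. A v + (\<bar>einner n g' v\<bar> - \<bar>einner n g v\<bar>) \<partial>?\<gamma>)"
      using int by (simp add: prob_space[simplified])
    also have "ennreal \<dots> \<le> (\<integral>\<^sup>+g'. ennreal (A v + (\<bar>einner n g' v\<bar> - \<bar>einner n g v\<bar>)) \<partial>?\<gamma>)"
      using int by (intro ennreal_integral_le_nn_integral) auto
    also have "\<dots> \<le> (\<integral>\<^sup>+g'. P g g' \<partial>?\<gamma>)"
      unfolding P_def using v by (intro nn_integral_mono SUP_upper)
    finally show "ennreal (A v + (enorm n v / 2 - \<bar>einner n g v\<bar>)) \<le> (\<integral>\<^sup>+g'. P g g' \<partial>?\<gamma>)" .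
  qed
  then have "(\<integral>\<^sup>+g. (SUP v\<in>D. ennreal (A v + (enorm n v / 2 - \<bar>einner n g v\<bar>))) \<partial>?\<gamma>)
      \<le> (\<integral>\<^sup>+g. \<integral>\<^sup>+g'. P g g' \<partial>?\<gamma> \<partial>?\<gamma>)"
    by (rule nn_integral_mono)
  also have "\<dots> \<le> (\<integral>\<^sup>+g. H g \<partial>?\<gamma>)"
  proof -
    have H_neg: "(\<integral>\<^sup>+g. H (- g) \<partial>?\<gamma>) = (\<integral>\<^sup>+g. H g \<partial>?\<gamma>)"
    proof -
      have "(\<integral>\<^sup>+g. H g \<partial>?\<gamma>) = (\<integral>\<^sup>+g. H g \<partial>distr ?\<gamma> borel uminus)"
        by (simp add: std_gaussian_symmetric[OF n])
      also have "\<dots> = (\<integral>\<^sup>+g. H (- g) \<partial>?\<gamma>)"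
        by (rule nn_integral_distr) measurable
      finally show ?thesis ..
    qed
    have swap: "(\<integral>\<^sup>+g. \<integral>\<^sup>+g'. P g' g \<partial>?\<gamma> \<partial>?\<gamma>) = (\<integral>\<^sup>+g. \<integral>\<^sup>+g'. P g g' \<partial>?\<gamma> \<partial>?\<gamma>)"
      by (rule \<gamma>.Fubini') measurable
    \<comment> \<open>Swapping \<open>g\<close> and \<open>g'\<close> doubles the integral of
      \<open>P\<close> and the factor in \<open>exchange\<close> doubles it again; by symmetry of
      the law the four terms in \<open>H\<close> have equal integrals, so the factors
      cancel.\<close>
    have "4 * (\<integral>\<^sup>+g. \<integral>\<^sup>+g'. P g g' \<partial>?\<gamma> \<partial>?\<gamma>) =
        2 * ((\<integral>\<^sup>+g. \<integral>\<^sup>+g'. P g g' \<partial>?\<gamma> \<partial>?\<gamma>) + (\<integral>\<^sup>+g. \<integral>\<^sup>+g'. P g' g \<partial>?\<gamma> \<partial>?\<gamma>))"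
      unfolding swap by (simp flip: mult_2 mult.assoc)
    also have "\<dots> = (\<integral>\<^sup>+g. \<integral>\<^sup>+g'. 2 * (P g g' + P g' g) \<partial>?\<gamma> \<partial>?\<gamma>)"
      by (simp add: nn_integral_add nn_integral_cmult)
    also have "\<dots> \<le> (\<integral>\<^sup>+g. \<integral>\<^sup>+g'. (H g + H (- g)) + (H g' + H (- g')) \<partial>?\<gamma> \<partial>?\<gamma>)"
      by (intro nn_integral_mono exchange)
    also have "\<dots> = 4 * (\<integral>\<^sup>+g. H g \<partial>?\<gamma>)"
      by (simp add: nn_integral_add H_neg emeasure_space_1[simplified])
        (simp flip: mult_2 mult.assoc add: add.assoc[symmetric])
    finally show ?thesis
      by (subst (asm) ennreal_mult_le_mult_iff) auto
  qed
  finally show ?thesis unfolding H_def .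
qed

text \<open>The rows are replaced one at a time. The remaining rows are frozen into the offset
  \<open>A\<close>, which keeps the value 0 at 0; this is why the induction runs over arbitrary
  offsets.\<close>

lemma nn_integral_PiM_SUP_abs_einner_le:
  assumes n: "0 < n" and D: "countable D" "0 \<in> D" and I: "finite I" and A: "A 0 = 0"
  shows "(\<integral>\<^sup>+x. (SUP v\<in>D. ennreal (A v + (\<Sum>i\<in>I. enorm n v / 2 - \<bar>einner n (x i) v\<bar>)))
      \<partial>PiM I (\<lambda>_. std_gaussian n))
    \<le> (\<integral>\<^sup>+x. (SUP v\<in>D. ennreal (A v + 2 * (\<Sum>i\<in>I. einner n (x i) v))) \<partial>PiM I (\<lambda>_. std_gaussian n))"
  using I A
proof (induction I arbitrary: A rule: finite_induct)
  case (insert i I)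
  let ?\<gamma> = "std_gaussian n"
  let ?P = "PiM I (\<lambda>_. ?\<gamma>)"
  let ?b = "\<lambda>y v. enorm n v / 2 - \<bar>einner n y v\<bar>"
  interpret product_sigma_finite "\<lambda>_. ?\<gamma>"
    by (simp add: product_sigma_finite_def prob_space_imp_sigma_finite)
  interpret P: prob_space ?P by (intro prob_space_PiM) simp
  interpret \<gamma>: prob_space ?\<gamma> by simp
  interpret P\<gamma>: pair_sigma_finite ?P ?\<gamma> ..
  have upd: "(\<Sum>k\<in>I. f ((x(i := y)) k)) = (\<Sum>k\<in>I. f (x k))"
    for f :: "(nat \<Rightarrow> real) \<Rightarrow> real" and x y
    using insert.hyps by (intro sum.cong) auto
  have sum_abs: "(\<Sum>k\<in>insert i I. ?b ((x(i := y)) k) v) = ?b y v + (\<Sum>k\<in>I. ?b (x k) v)" for x y v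
    using insert.hyps upd[of "\<lambda>z. ?b z v" x y] by simp
  have sum_lin: "(\<Sum>k\<in>insert i I. einner n ((x(i := y)) k) v) = einner n y v + (\<Sum>k\<in>I. einner n (x k) v)" for x y v
    using insert.hyps upd[of "\<lambda>z. einner n z v" x y] by simp
  have [measurable]: "(\<lambda>x. x k) \<in> borel_measurable (PiM J (\<lambda>_. ?\<gamma>))" if "k \<in> J" for k :: 'a and J
    using measurable_component_singleton[OF that, of "\<lambda>_. ?\<gamma>"] by (simp cong: measurable_cong_sets)
  have "(\<integral>\<^sup>+x. (SUP v\<in>D. ennreal (A v + (\<Sum>k\<in>insert i I. ?b (x k) v))) \<partial>PiM (insert i I) (\<lambda>_. ?\<gamma>))
      = (\<integral>\<^sup>+x. \<integral>\<^sup>+y. (SUP v\<in>D. ennreal (A v + (\<Sum>k\<in>insert i I. ?b ((x(i := y)) k) v))) \<partial>?\<gamma> \<partial>?P)"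
    using insert.hyps D by (intro product_nn_integral_insert borel_measurable_SUP) measurable
  also have "\<dots> = (\<integral>\<^sup>+x. \<integral>\<^sup>+y. (SUP v\<in>D. ennreal ((A v + (\<Sum>k\<in>I. ?b (x k) v)) + ?b y v)) \<partial>?\<gamma> \<partial>?P)"
    unfolding sum_abs by (simp only: add_ac)
  also have "\<dots> \<le> (\<integral>\<^sup>+x. \<integral>\<^sup>+y. (SUP v\<in>D. ennreal ((A v + (\<Sum>k\<in>I. ?b (x k) v)) + 2 * einner n y v)) \<partial>?\<gamma> \<partial>?P)"
    using insert.prems by (intro nn_integral_mono nn_integral_SUP_abs_einner_le[OF n D,
      where A="\<lambda>v. A v + (\<Sum>k\<in>I. ?b (x k) v)" for x])
      (simp only: einner_zero_right enorm_zero; simp)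
  \<comment> \<open>With the new row outermost, its linear term joins the offset and the induction
    hypothesis treats the other rows.\<close>
  also have "\<dots> = (\<integral>\<^sup>+y. \<integral>\<^sup>+x. (SUP v\<in>D. ennreal ((A v + (\<Sum>k\<in>I. ?b (x k) v)) + 2 * einner n y v)) \<partial>?P \<partial>?\<gamma>)"
    using D by (intro P\<gamma>.Fubini'[symmetric]) (simp only: split_beta', intro borel_measurable_SUP; measurable)
  also have "\<dots> = (\<integral>\<^sup>+y. \<integral>\<^sup>+x. (SUP v\<in>D. ennreal ((A v + 2 * einner n y v) + (\<Sum>k\<in>I. ?b (x k) v))) \<partial>?P \<partial>?\<gamma>)"
    by (simp only: add_ac)
  also have "\<dots> \<le> (\<integral>\<^sup>+y. \<integral>\<^sup>+x. (SUP v\<in>D. ennreal ((A v + 2 * einner n y v) + 2 * (\<Sum>k\<in>I. einner n (x k) v))) \<partial>?P \<partial>?\<gamma>)"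
    using insert.prems by (intro nn_integral_mono insert.IH[where A="\<lambda>v. A v + 2 * einner n y v" for y])
      (simp only: einner_zero_right; simp)
  also have "\<dots> = (\<integral>\<^sup>+y. \<integral>\<^sup>+x. (SUP v\<in>D. ennreal (A v + 2 * (\<Sum>k\<in>insert i I. einner n ((x(i := y)) k) v))) \<partial>?P \<partial>?\<gamma>)"
    unfolding sum_lin by (simp only: distrib_left add.assoc)
  also have "\<dots> = (\<integral>\<^sup>+x. (SUP v\<in>D. ennreal (A v + 2 * (\<Sum>k\<in>insert i I. einner n (x k) v))) \<partial>PiM (insert i I) (\<lambda>_. ?\<gamma>))"
    using insert.hyps D by (intro product_nn_integral_insert_rev[symmetric] borel_measurable_SUP) measurable
  finally show ?case .
qed simp

text \<open>Jointly in \<open>v\<close>, the weighted sum of row pairings is the pairing with a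
  single combined row, so the whole supremum has the same law as the one with
  \<open>s *\<^sub>R h\<close>.\<close>

lemma (in prob_space) nn_integral_SUP_gaussian_combination:
  fixes G :: "'i \<times> nat \<Rightarrow> 'a \<Rightarrow> real"
  assumes n: "0 < n" and I: "finite I"
    and ind: "indep_vars (\<lambda>_. borel) G (I \<times> {..<n})"
    and norm: "\<And>i j. i \<in> I \<Longrightarrow> j < n \<Longrightarrow> distributed M lborel (G (i, j)) std_normal_density"
    and s: "s = sqrt (\<Sum>i\<in>I. (c i)\<^sup>2)" "0 < s" and D: "countable D"
  shows "(\<integral>\<^sup>+w. (SUP v\<in>D. ennreal (A v + a * (\<Sum>i\<in>I. c i * (\<Sum>j<n. G (i, j) w * v j)))) \<partial>M) =
    (\<integral>\<^sup>+h. (SUP v\<in>D. ennreal (A v + a * s * einner n h v)) \<partial>std_gaussian n)"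
proof -
  let ?L = "\<lambda>w j. if j < n then \<Sum>i\<in>I. c i * G (i, j) w else (0::real)"
  let ?F = "\<lambda>h. (SUP v\<in>D. ennreal (A v + a * einner n h v))"
  have [measurable]: "?F \<in> borel_measurable borel"
    using D by (intro borel_measurable_SUP) measurable
  have rv [measurable]: "G (i, j) \<in> borel_measurable M" if "i \<in> I" "j < n" for i j
    using ind that by (auto simp: indep_vars_def2)
  have L: "?L \<in> borel_measurable M"
    by (intro measurable_finite_support_ext borel_measurable_sum borel_measurable_times rv) auto
  have "(\<Sum>i\<in>I. c i * (\<Sum>j<n. G (i, j) w * v j)) = einner n (?L w) v" for w v
    unfolding einner_def
    by (simp add: sum_distrib_left sum_distrib_right mult.assoc) (rule sum.swap)
  then have "(\<integral>\<^sup>+w. (SUP v\<in>D. ennreal (A v + a * (\<Sum>i\<in>I. c i * (\<Sum>j<n. G (i, j) w * v j)))) \<partial>M) =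
      (\<integral>\<^sup>+w. ?F (?L w) \<partial>M)"
    by simp
  also have "\<dots> = (\<integral>\<^sup>+h. ?F h \<partial>distr M borel ?L)"
    by (intro nn_integral_distr[symmetric] L) simp
  also have "\<dots> = (\<integral>\<^sup>+h. ?F h \<partial>distr (std_gaussian n) borel (\<lambda>h. s *\<^sub>R h))"
    by (simp add: distr_gaussian_combination[OF n I ind norm s])
  also have "\<dots> = (\<integral>\<^sup>+h. ?F (s *\<^sub>R h) \<partial>std_gaussian n)"
    by (rule nn_integral_distr) measurable
  finally show ?thesis by (simp add: mult.assoc)
qed

text \<open>Transfers the comparison to matrix entries. The sum of all row pairings has unit
  coefficients, which explains the scale \<open>sqrt (card I)\<close>.\<close>

lemma (in prob_space) nn_integral_SUP_gaussian_rows_le: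
  fixes G :: "'i \<times> nat \<Rightarrow> 'a \<Rightarrow> real"
  assumes n: "0 < n" and I: "finite I" "I \<noteq> {}"
    and ind: "indep_vars (\<lambda>_. borel) G (I \<times> {..<n})"
    and norm: "\<And>i j. i \<in> I \<Longrightarrow> j < n \<Longrightarrow> distributed M lborel (G (i, j)) std_normal_density"
    and D: "countable D" "0 \<in> D" and A: "A 0 = 0"
  shows "(\<integral>\<^sup>+w. (SUP v\<in>D. ennreal (A v + (\<Sum>i\<in>I. enorm n v / 2 - \<bar>\<Sum>j<n. G (i, j) w * v j\<bar>))) \<partial>M) \<le>
    (\<integral>\<^sup>+h. (SUP v\<in>D. ennreal (A v + 2 * sqrt (card I) * einner n h v)) \<partial>std_gaussian n)"
proof -
  let ?R = "\<lambda>w. \<lambda>i\<in>I. \<lambda>j. if j < n then G (i, j) w else (0::real)"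
  let ?F = "\<lambda>x. (SUP v\<in>D. ennreal (A v + (\<Sum>i\<in>I. enorm n v / 2 - \<bar>einner n (x i) v\<bar>)))"
  let ?F' = "\<lambda>x. (SUP v\<in>D. ennreal (A v + 2 * (\<Sum>i\<in>I. einner n (x i) v)))"
  let ?B = "PiM I (\<lambda>_. borel :: (nat \<Rightarrow> real) measure)"
  have rv: "G (i, j) \<in> borel_measurable M" if "i \<in> I" "j < n" for i j
    using ind that by (auto simp: indep_vars_def2)
  have R: "?R \<in> measurable M ?B"
    by (intro measurable_restrict measurable_finite_support_ext rv)
  have [measurable]: "?F \<in> borel_measurable ?B" "?F' \<in> borel_measurable ?B"
    using D by (auto intro!: borel_measurable_SUP) measurable
  have e: "einner n (\<lambda>j. if j < n then G (i, j) w else 0) v = (\<Sum>j<n. G (i, j) w * v j)" for w v i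
    by (simp add: einner_def)
  have law: "distr M ?B ?R = PiM I (\<lambda>_. std_gaussian n)"
    by (rule indep_gaussian_rows[OF n I ind norm])
  have "(\<integral>\<^sup>+w. (SUP v\<in>D. ennreal (A v + (\<Sum>i\<in>I. enorm n v / 2 - \<bar>\<Sum>j<n. G (i, j) w * v j\<bar>))) \<partial>M)
      = (\<integral>\<^sup>+w. ?F (?R w) \<partial>M)"
    by (simp add: e cong: sum.cong)
  also have "\<dots> = (\<integral>\<^sup>+x. ?F x \<partial>distr M ?B ?R)"
    by (intro nn_integral_distr[symmetric] R) simp
  also have "\<dots> \<le> (\<integral>\<^sup>+x. ?F' x \<partial>distr M ?B ?R)"
    unfolding law by (rule nn_integral_PiM_SUP_abs_einner_le[where A=A, OF n D I(1) A])
  also have "\<dots> = (\<integral>\<^sup>+w. ?F' (?R w) \<partial>M)"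
    by (intro nn_integral_distr R) simp
  also have "\<dots> = (\<integral>\<^sup>+w. (SUP v\<in>D. ennreal (A v + 2 * (\<Sum>i\<in>I. 1 * (\<Sum>j<n. G (i, j) w * v j)))) \<partial>M)"
    by (simp add: e cong: sum.cong)
  also have "\<dots> = (\<integral>\<^sup>+h. (SUP v\<in>D. ennreal (A v + 2 * sqrt (card I) * einner n h v)) \<partial>std_gaussian n)"
    using I by (intro nn_integral_SUP_gaussian_combination[OF n I(1) ind norm]) (auto simp: D card_gt_0_iff)
  finally show ?thesis .
qed

section \<open>A lower bound for the residual\<close>

context convex_instance
begin

lemma integrable_lrt: "integrable (std_gaussian n) (lrt n K \<mu>\<^sub>0 \<tau>)"
proof (rule Bochner_Integration.integrable_bound)
  show "integrable (std_gaussian n) (\<lambda>h. \<tau>\<^sup>2 * (enorm n h)\<^sup>2)"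
    by (intro integrable_mult_right integrable_std_gaussian_enorm_sq)
  show "AE h in std_gaussian n. norm (lrt n K \<mu>\<^sub>0 \<tau> h) \<le> norm (\<tau>\<^sup>2 * (enorm n h)\<^sup>2)"
    using lrt_nonneg lrt_le by (auto simp: abs_of_nonneg)
qed measurable

lemma integrable_err: "integrable (std_gaussian n) (err n K \<mu>\<^sub>0 \<tau>)"
proof (rule Bochner_Integration.integrable_bound[OF integrable_lrt])
  show "AE h in std_gaussian n. norm (err n K \<mu>\<^sub>0 \<tau> h) \<le> norm (lrt n K \<mu>\<^sub>0 \<tau> h)"
    using err_nonneg err_le_lrt lrt_nonneg by (auto simp: abs_of_nonneg)
qed measurable

lemma expected_lrt_nonneg: "0 \<le> (\<integral>h. lrt n K \<mu>\<^sub>0 \<tau> h \<partial>std_gaussian n)"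
  by (simp add: lrt_nonneg)

text \<open>Lowering the multiplier from \<open>2 * \<tau>\<close> to \<open>b\<close> is harmless:
  shrinking the penalty by the same ratio \<open>c \<le> 1\<close> only raises the expression, and
  \<open>c\<close> times a nonnegative \<open>lrt\<close> is at most \<open>lrt\<close>. This admits
  noise vectors whose norm is merely bounded.\<close>

lemma quadratic_le_lrt:
  assumes "\<mu> \<in> K" "0 \<le> b" "b \<le> 2 * \<tau>"
  shows "b * einner n h (\<mu> - \<mu>\<^sub>0) - (enorm n (\<mu> - \<mu>\<^sub>0))\<^sup>2 \<le> lrt n K \<mu>\<^sub>0 \<tau> h"
proof (cases "\<tau> = 0")
  case True
  then have "b = 0" using assms by simp
  then show ?thesis
    by (intro order.trans[OF _ lrt_nonneg]) simp
next
  case False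
  define c where "c = b / (2 * \<tau>)"
  have c: "0 \<le> c" "c \<le> 1" "b = c * (2 * \<tau>)" using assms False by (auto simp: c_def field_simps)
  let ?N = "(enorm n (\<mu> - \<mu>\<^sub>0))\<^sup>2"
  have "b * einner n h (\<mu> - \<mu>\<^sub>0) - ?N \<le> c * (2 * \<tau> * einner n h (\<mu> - \<mu>\<^sub>0) - ?N)"
    using mult_right_mono[OF c(2), of ?N] unfolding c(3) by (simp add: algebra_simps)
  also have "\<dots> \<le> c * lrt n K \<mu>\<^sub>0 \<tau> h"
    using assms c by (intro mult_left_mono lrt_ge)
  also have "\<dots> \<le> lrt n K \<mu>\<^sub>0 \<tau> h"
    using c lrt_nonneg[of \<tau> h] mult_right_mono[OF c(2), of "lrt n K \<mu>\<^sub>0 \<tau> h"] by simp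
  finally show ?thesis .
qed

lemma nn_integral_SUP_quadratic_le:
  assumes D: "\<And>v. v \<in> D \<Longrightarrow> v + \<mu>\<^sub>0 \<in> K" and b: "0 \<le> b" "b \<le> 2 * \<tau>" and c: "0 \<le> c"
  shows "(\<integral>\<^sup>+h. (SUP v\<in>D. ennreal (c * (b * einner n h v - (enorm n v)\<^sup>2))) \<partial>std_gaussian n)
    \<le> ennreal (c * (\<integral>h. lrt n K \<mu>\<^sub>0 \<tau> h \<partial>std_gaussian n))"
proof -
  have "(\<integral>\<^sup>+h. (SUP v\<in>D. ennreal (c * (b * einner n h v - (enorm n v)\<^sup>2))) \<partial>std_gaussian n)
      \<le> (\<integral>\<^sup>+h. ennreal (c * lrt n K \<mu>\<^sub>0 \<tau> h) \<partial>std_gaussian n)"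
  proof (intro nn_integral_mono SUP_least ennreal_leI mult_left_mono c)
    fix h v assume "v \<in> D"
    from quadratic_le_lrt[OF D[OF this] b, of h]
    show "b * einner n h v - (enorm n v)\<^sup>2 \<le> lrt n K \<mu>\<^sub>0 \<tau> h" by simp
  qed
  also have "\<dots> = ennreal (\<integral>h. c * lrt n K \<mu>\<^sub>0 \<tau> h \<partial>std_gaussian n)"
    using c by (intro nn_integral_eq_integral integrable_mult_right integrable_lrt) (simp add: lrt_nonneg)
  finally show ?thesis by simp
qed

end

text \<open>Markov's inequality for the positive part of a countable supremum.\<close>

lemma (in prob_space) prob_ex_gt_le:
  assumes D: "countable D" and f: "\<And>v. v \<in> D \<Longrightarrow> f v \<in> borel_measurable M"
    and le: "(\<integral>\<^sup>+w. (SUP v\<in>D. ennreal (f v w)) \<partial>M) \<le> ennreal C" and k: "0 < k" and C: "0 \<le> C"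
  shows "{w\<in>space M. \<exists>v\<in>D. k < f v w} \<in> events"
    and "prob {w\<in>space M. \<exists>v\<in>D. k < f v w} \<le> C / k"
proof -
  let ?B = "{w\<in>space M. \<exists>v\<in>D. k < f v w}"
  define u where "u w = (SUP v\<in>D. ennreal (f v w))" for w
  have "?B = (\<Union>v\<in>D. {w\<in>space M. k < f v w})" by auto
  also have "\<dots> \<in> events"
    using D f by (intro sets.countable_UN') auto
  finally show B: "?B \<in> events" .
  have [measurable]: "u \<in> borel_measurable M"
    unfolding u_def[abs_def] using D f by (intro borel_measurable_SUP) auto
  have "?B \<subseteq> {w\<in>space M. 1 \<le> ennreal (1 / k) * u w}"
  proof safe
    fix w v assume v: "v \<in> D" "k < f v w"
    have "1 = ennreal (1 / k) * ennreal k" using k by (simp flip: ennreal_mult)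
    also have "\<dots> \<le> ennreal (1 / k) * u w"
      unfolding u_def using v by (intro mult_left_mono order.trans[OF _ SUP_upper[of v]] ennreal_leI) auto
    finally show "1 \<le> ennreal (1 / k) * u w" .
  qed
  then have "emeasure M ?B \<le> emeasure M {w\<in>space M. 1 \<le> ennreal (1 / k) * u w}"
    by (intro emeasure_mono) measurable
  also have "\<dots> \<le> ennreal (1 / k) * (\<integral>\<^sup>+w. u w * indicator (space M) w \<partial>M)"
    by (intro nn_integral_Markov_inequality) auto
  also have "(\<integral>\<^sup>+w. u w * indicator (space M) w \<partial>M) = (\<integral>\<^sup>+w. u w \<partial>M)"
    by (intro nn_integral_cong) auto
  also have "ennreal (1 / k) * \<dots> \<le> ennreal (1 / k) * ennreal C"
    using le by (intro mult_left_mono) (auto simp: u_def)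
  also have "\<dots> = ennreal (C / k)"
    using k C by (simp flip: ennreal_mult)
  finally show "prob ?B \<le> C / k"
    using k C by (simp add: emeasure_eq_measure)
qed

text \<open>Independence makes the joint law a product measure, so by Fubini a bound that is uniform
  over frozen values of \<open>Y\<close> survives averaging.\<close>

lemma (in prob_space) prob_indep_le:
  assumes X: "X \<in> measurable M N" and Y: "Y \<in> measurable M N'"
    and ind: "indep_set (sets (vimage_algebra (space M) X N)) (sets (vimage_algebra (space M) Y N'))"
    and S: "S \<in> sets (N \<Otimes>\<^sub>M N')" and C: "0 \<le> C"
    and le: "\<And>y. y \<in> space N' \<Longrightarrow> prob {w\<in>space M. (X w, y) \<in> S} \<le> C"
  shows "prob {w\<in>space M. (X w, Y w) \<in> S} \<le> C"
proof -
  let ?P = "distr M N X" and ?P' = "distr M N' Y"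
  interpret P: prob_space ?P using X by (rule prob_space_distr)
  interpret P': prob_space ?P' using Y by (rule prob_space_distr)
  interpret PP: pair_sigma_finite ?P ?P' ..
  have XY: "(\<lambda>w. (X w, Y w)) \<in> measurable M (N \<Otimes>\<^sub>M N')"
    using X Y by measurable
  have law: "?P \<Otimes>\<^sub>M ?P' = distr M (N \<Otimes>\<^sub>M N') (\<lambda>w. (X w, Y w))"
  proof (rule pair_measure_eqI)
    fix A B assume "A \<in> sets ?P" "B \<in> sets ?P'"
    then have A: "A \<in> sets N" and B: "B \<in> sets N'" by auto
    have "prob ((X -` A \<inter> space M) \<inter> (Y -` B \<inter> space M)) = prob (X -` A \<inter> space M) * prob (Y -` B \<inter> space M)"
      using A B measurable_space[OF X] measurable_space[OF Y]
      by (intro indep_setD[OF ind]) (auto simp: sets_vimage_algebra2)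
    moreover have "(\<lambda>w. (X w, Y w)) -` (A \<times> B) \<inter> space M = (X -` A \<inter> space M) \<inter> (Y -` B \<inter> space M)"
      by auto
    ultimately show "emeasure ?P A * emeasure ?P' B = emeasure (distr M (N \<Otimes>\<^sub>M N') (\<lambda>w. (X w, Y w))) (A \<times> B)"
      using A B by (simp add: emeasure_distr X Y XY emeasure_eq_measure ennreal_mult)
  qed (auto intro: P.sigma_finite_measure P'.sigma_finite_measure simp: P.sigma_finite_measure_axioms P'.sigma_finite_measure_axioms)
  have "emeasure M {w\<in>space M. (X w, Y w) \<in> S} = emeasure (?P \<Otimes>\<^sub>M ?P') S"
    unfolding law using S by (subst emeasure_distr[OF XY]) (auto intro!: arg_cong[where f="emeasure M"])
  also have "\<dots> = (\<integral>\<^sup>+y. emeasure ?P ((\<lambda>x. (x, y)) -` S) \<partial>?P')"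
    using S by (intro PP.emeasure_pair_measure_alt2) (simp cong: sets_pair_measure_cong)
  also have "\<dots> \<le> (\<integral>\<^sup>+y. ennreal C \<partial>?P')"
  proof (rule nn_integral_mono)
    fix y assume "y \<in> space ?P'"
    then have y: "y \<in> space N'" by simp
    have "(\<lambda>x. (x, y)) -` S \<in> sets N"
      using S by (rule sets_Pair2)
    then have "emeasure ?P ((\<lambda>x. (x, y)) -` S) = emeasure M {w\<in>space M. (X w, y) \<in> S}"
      by (subst emeasure_distr[OF X]) (auto intro!: arg_cong[where f="emeasure M"])
    also have "\<dots> \<le> ennreal C"
      using le[OF y] by (simp add: emeasure_eq_measure ennreal_leI)
    finally show "emeasure ?P ((\<lambda>x. (x, y)) -` S) \<le> ennreal C" .
  qed
  also have "\<dots> = ennreal C"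
    using P'.emeasure_space_1 by simp
  finally show ?thesis
    using C by (simp add: emeasure_eq_measure)
qed

text \<open>
  For \<open>b v > t\<close> the hypotheses are used at the point of norm \<open>t\<close> on the segment from \<open>0\<close> to \<open>v\<close>, and
  the resulting bound is maximal for \<open>b v = 32 t\<close>.
\<close>

lemma star_shaped_quadratic_bound:
  fixes L s b :: "'v::real_vector \<Rightarrow> real"
  assumes v: "v \<in> V" and star: "\<And>c. 0 \<le> c \<Longrightarrow> c \<le> 1 \<Longrightarrow> c *\<^sub>R v \<in> V"
    and L: "\<And>c. 0 \<le> c \<Longrightarrow> L (c *\<^sub>R v) = c * L v" and s: "\<And>c. 0 \<le> c \<Longrightarrow> s (c *\<^sub>R v) = c * s v"
    and b: "\<And>c. 0 \<le> c \<Longrightarrow> b (c *\<^sub>R v) = c * b v"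
    and L_le: "\<And>u. u \<in> V \<Longrightarrow> L u \<le> (b u)\<^sup>2 + t\<^sup>2"
    and s_ge: "\<And>u. u \<in> V \<Longrightarrow> b u / 2 - ((b u)\<^sup>2 + t\<^sup>2) / \<sigma> \<le> s u"
    and b_nonneg: "0 \<le> b v" and t: "0 < t" "t \<le> \<sigma> / 8"
  shows "2 * L v - (s v)\<^sup>2 \<le> 64 * t\<^sup>2"
proof (cases "b v \<le> t")
  case True
  then have "(b v)\<^sup>2 \<le> t\<^sup>2" using b_nonneg by (intro power_mono)
  then have "2 * L v \<le> 4 * t\<^sup>2" using L_le[OF v] by simp
  then show ?thesis by (smt (verit) zero_le_power2)
next
  case False
  define c where "c = t / b v"
  define a where "a = b v / t"
  have c: "0 \<le> c" "c \<le> 1" and ca: "c * a = 1" and a: "0 < a" and cb: "c * b v = t"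
    using False t by (auto simp: c_def a_def field_simps)
  have ac: "a * (c * x) = x" for x
  proof -
    have "a * (c * x) = (c * a) * x" by (simp only: mult_ac)
    then show ?thesis by (simp add: ca)
  qed
  have "c * L v \<le> 2 * t\<^sup>2"
    using L_le[OF star[OF c]] by (simp add: L b c cb)
  then have "a * (c * L v) \<le> a * (2 * t\<^sup>2)" using a by (intro mult_left_mono) auto
  then have Lv: "L v \<le> 2 * a * t\<^sup>2" by (simp add: ac)
  \<comment> \<open>The condition \<open>t \<le> \<sigma> / 8\<close> limits the loss to half of the
    leading term \<open>t / 2\<close>, which leaves \<open>t / 4\<close>.\<close>
  have "2 * t\<^sup>2 / \<sigma> \<le> t / 4"
    using t by (simp add: field_simps power2_eq_square)
  then have "t / 4 \<le> c * s v"
    using s_ge[OF star[OF c]] by (simp add: s b c cb)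
  then have "a * (t / 4) \<le> a * (c * s v)" using a by (intro mult_left_mono) auto
  then have sv: "a * t / 4 \<le> s v" by (simp add: ac)
  then have "(a * t / 4)\<^sup>2 \<le> (s v)\<^sup>2" using a t by (intro power_mono) auto
  \<comment> \<open>The constant 64 is the maximum over \<open>a\<close> of
    \<open>4 * a - (a / 4)^2\<close>, exhibited by completing the square.\<close>
  moreover have "64 * t\<^sup>2 - (4 * a * t\<^sup>2 - (a * t / 4)\<^sup>2) = (8 * t - a * t / 4)\<^sup>2"
    by (simp add: power2_eq_square algebra_simps)
  moreover have "0 \<le> (8 * t - a * t / 4)\<^sup>2" by simp
  ultimately show ?thesis using Lv by argo
qed

context convex_instance
begin

definition "shifted = (\<lambda>\<mu>. \<mu> - \<mu>\<^sub>0) ` K"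

lemma zero_shifted: "0 \<in> shifted"
  using mu0 by (force simp: shifted_def)

lemma scale_shifted: "v \<in> shifted \<Longrightarrow> 0 \<le> c \<Longrightarrow> c \<le> 1 \<Longrightarrow> c *\<^sub>R v \<in> shifted"
  using segment_in[OF mu0] by (force simp: shifted_def)

text \<open>Suprema over a countable set stay measurable, and continuity recovers all of
  \<open>shifted\<close> afterwards. The point 0 is inserted because the row comparison requires
  it.\<close>

lemma ex_countable_dense_shifted:
  obtains D where "countable D" "0 \<in> D" "D \<subseteq> shifted" "shifted \<subseteq> closure D"
proof -
  obtain C where C: "countable C" "C \<subseteq> shifted" "shifted \<subseteq> closure C"
    using separable[of shifted] by blast
  have "closure C \<subseteq> closure (insert 0 C)" by (intro closure_mono) auto
  with C have "shifted \<subseteq> closure (insert 0 C)" by blast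
  then show ?thesis
    using C zero_shifted by (intro that[of "insert 0 C"]) auto
qed

end

text \<open>Cauchy-Schwarz against the constant vector. It leads from sums of absolute row pairings,
  which the comparison controls, to the sum of squares in the residual.\<close>

lemma sum_abs_sq_le:
  fixes f :: "nat \<Rightarrow> real"
  shows "(\<Sum>i<m. \<bar>f i\<bar>)\<^sup>2 \<le> real m * (\<Sum>i<m. (f i)\<^sup>2)"
proof -
  have "(\<Sum>i<m. \<bar>f i\<bar>) \<le> L2_set (\<lambda>_. 1) {..<m} * L2_set f {..<m}"
    using L2_set_mult_ineq[of "\<lambda>_. 1" f "{..<m}"] by simp
  then have "(\<Sum>i<m. \<bar>f i\<bar>)\<^sup>2 \<le> (L2_set (\<lambda>_. 1) {..<m} * L2_set f {..<m})\<^sup>2"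
    by (intro power_mono sum_nonneg) auto
  also have "\<dots> = real m * (\<Sum>i<m. (f i)\<^sup>2)"
    by (simp add: power_mult_distrib L2_set_def sum_nonneg)
  finally show ?thesis .
qed

section \<open>Uniform probability bounds in the linear model\<close>

locale linear_model = convex_instance n K \<mu>\<^sub>0 + prob_space M
  for n K \<mu>\<^sub>0 and M :: "'w measure" +
  fixes P :: "real measure" and m :: nat and X :: "'w \<Rightarrow> nat \<Rightarrow> nat \<Rightarrow> real" and \<xi> :: "'w \<Rightarrow> nat \<Rightarrow> real"
    and \<sigma> r :: real
  assumes n_pos: "0 < n" and m_pos: "0 < m" and sigma_pos: "0 < \<sigma>"
    and design: "design_and_noise P n m M X \<xi>"
begin

definition "G p w = (case p of (i, j) \<Rightarrow> sqrt n * X w i j)" for p :: "nat \<times> nat"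

definition "\<omega> = omega \<sigma> (real m / real n) r"

lemma design_facts:
  shows indep_X: "indep_vars (\<lambda>_. borel) (\<lambda>(i, j) w. X w i j) ({..<m} \<times> {..<n})"
    and normal_X: "\<And>i j. i < m \<Longrightarrow> j < n \<Longrightarrow> distributed M lborel (\<lambda>w. X w i j) (normal_density 0 (sqrt (1 / real n)))"
    and indep_xi: "indep_vars (\<lambda>_. borel) (\<lambda>i w. \<xi> w i) {..<m}"
    and indep_X_xi: "indep_set
      (sets (vimage_algebra (space M) (\<lambda>w. \<lambda>(i, j)\<in>{..<m} \<times> {..<n}. X w i j)
        (\<Pi>\<^sub>M p\<in>{..<m} \<times> {..<n}. borel)))
      (sets (vimage_algebra (space M) (\<lambda>w. \<lambda>i\<in>{..<m}. \<xi> w i) (\<Pi>\<^sub>M i\<in>{..<m}. borel)))"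
  using design by (auto simp: design_and_noise_def)

lemma measurable_X: "i < m \<Longrightarrow> j < n \<Longrightarrow> (\<lambda>w. X w i j) \<in> borel_measurable M"
  using indep_X by (auto simp: indep_vars_def2)

lemma measurable_xi: "i < m \<Longrightarrow> (\<lambda>w. \<xi> w i) \<in> borel_measurable M"
  using indep_xi by (auto simp: indep_vars_def2)

lemma indep_G: "indep_vars (\<lambda>_. borel) G ({..<m} \<times> {..<n})"
proof -
  have "indep_vars (\<lambda>_. borel) (\<lambda>p w. (\<lambda>x. sqrt n * x) ((\<lambda>(i, j) w. X w i j) p w)) ({..<m} \<times> {..<n})"
    by (rule indep_vars_compose2[OF indep_X]) simp
  moreover have "(\<lambda>p w. (\<lambda>x. sqrt n * x) ((\<lambda>(i, j) w. X w i j) p w)) = G"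
    by (auto simp: fun_eq_iff G_def)
  ultimately show ?thesis by simp
qed

lemma normal_G: "i \<in> {..<m} \<Longrightarrow> j < n \<Longrightarrow> distributed M lborel (G (i, j)) std_normal_density"
proof -
  assume "i \<in> {..<m}" "j < n"
  then have "distributed M lborel (\<lambda>w. 0 + sqrt n * X w i j)
      (normal_density (0 + sqrt n * 0) (\<bar>sqrt n\<bar> * sqrt (1 / real n)))"
    using n_pos by (intro normal_density_affine normal_X) auto
  moreover have "\<bar>sqrt n\<bar> * sqrt (1 / real n) = 1"
    using n_pos by (simp add: real_sqrt_divide)
  moreover have "G (i, j) = (\<lambda>w. sqrt n * X w i j)"
    by (simp add: fun_eq_iff G_def)
  ultimately show ?thesis by simp
qed

lemma measurable_G: "i < m \<Longrightarrow> j < n \<Longrightarrow> G (i, j) \<in> borel_measurable M"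
  using indep_G by (auto simp: indep_vars_def2)

lemma omega_eq: "\<omega> = sqrt (r\<^sup>2 + \<sigma>\<^sup>2) * sqrt n / sqrt m" and omega_pos: "0 < \<omega>"
proof -
  show "\<omega> = sqrt (r\<^sup>2 + \<sigma>\<^sup>2) * sqrt n / sqrt m"
    by (simp add: \<omega>_def omega_def real_sqrt_mult real_sqrt_divide)
  moreover have "0 < sqrt (r\<^sup>2 + \<sigma>\<^sup>2)"
    using sigma_pos by (simp add: add_nonneg_pos)
  ultimately show "0 < \<omega>" using n_pos m_pos by simp
qed

abbreviation "Q \<equiv> (\<integral>h. lrt n K \<mu>\<^sub>0 \<omega> h \<partial>std_gaussian n)"

text \<open>The row comparison with the quadratic penalty as offset bounds the mean supremum by
  \<open>Q\<close> up to scaling, and Markov's inequality converts this into a probability.\<close>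

lemma prob_rows_small_le:
  assumes D: "countable D" "0 \<in> D" "D \<subseteq> shifted" and k: "0 < k"
  defines "f \<equiv> \<lambda>v w. (\<omega> / sqrt m) * (\<Sum>i<m. enorm n v / 2 - \<bar>\<Sum>j<n. G (i, j) w * v j\<bar>) - (enorm n v)\<^sup>2"
  shows "{w\<in>space M. \<exists>v\<in>D. k < f v w} \<in> events"
    and "prob {w\<in>space M. \<exists>v\<in>D. k < f v w} \<le> Q / k"
proof -
  \<comment> \<open>Since \<open>a * sqrt m = \<omega>\<close>, dividing by \<open>a\<close> turns
    the multiplier \<open>2 * sqrt m\<close> of the comparison into the multiplier
    \<open>2 * \<omega>\<close> of \<open>lrt\<close>.\<close>
  define a where "a = \<omega> / sqrt m"
  have a: "0 < a" using omega_pos m_pos by (simp add: a_def)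
  let ?g = "\<lambda>v w. - (enorm n v)\<^sup>2 / a + (\<Sum>i<m. enorm n v / 2 - \<bar>\<Sum>j<n. G (i, j) w * v j\<bar>)"
  have eq: "k < f v w \<longleftrightarrow> k / a < ?g v w" for v w
    using a unfolding f_def a_def[symmetric] by (simp add: field_simps)
  have DK: "v + \<mu>\<^sub>0 \<in> K" if "v \<in> D" for v
    using D(3) that by (force simp: shifted_def)
  have "(\<integral>\<^sup>+w. (SUP v\<in>D. ennreal (?g v w)) \<partial>M) \<le>
      (\<integral>\<^sup>+h. (SUP v\<in>D. ennreal (- (enorm n v)\<^sup>2 / a + 2 * sqrt (card {..<m}) * einner n h v)) \<partial>std_gaussian n)"
    by (rule nn_integral_SUP_gaussian_rows_le[where A="\<lambda>v. - (enorm n v)\<^sup>2 / a", OF n_pos _ _ indep_G normal_G D(1,2)])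
      (use m_pos in \<open>auto simp only: enorm_zero finite_lessThan lessThan_empty_iff\<close>, simp)
  also have "\<dots> = (\<integral>\<^sup>+h. (SUP v\<in>D. ennreal (1 / a * (2 * \<omega> * einner n h v - (enorm n v)\<^sup>2))) \<partial>std_gaussian n)"
    using m_pos omega_pos by (simp add: a_def field_simps)
  also have "\<dots> \<le> ennreal (1 / a * Q)"
    using omega_pos a by (intro nn_integral_SUP_quadratic_le DK) auto
  finally have le: "(\<integral>\<^sup>+w. (SUP v\<in>D. ennreal (?g v w)) \<partial>M) \<le> ennreal (Q / a)" by simp
  have meas: "?g v \<in> borel_measurable M" for v
    by (intro borel_measurable_add borel_measurable_sum borel_measurable_diff borel_measurable_abs
        borel_measurable_times measurable_G borel_measurable_const) auto
  note ex = prob_ex_gt_le[OF D(1) meas le]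
  show "{w\<in>space M. \<exists>v\<in>D. k < f v w} \<in> events" "prob {w\<in>space M. \<exists>v\<in>D. k < f v w} \<le> Q / k"
    unfolding eq using ex[of "k / a"] a k expected_lrt_nonneg[of \<omega>] by (auto simp: field_simps)
qed

text \<open>For deterministic \<open>e\<close> the cross term is a Gaussian process of scale
  \<open>enorm m e\<close>, and the bound on this scale permits comparison with \<open>lrt\<close>.
  The degenerate scale 0 makes the event empty.\<close>

lemma prob_cross_term_le:
  assumes D: "countable D" "D \<subseteq> shifted" and k: "0 < k" and e: "a * enorm m e \<le> 2 * \<omega>" and a: "0 < a"
  shows "prob {w\<in>space M. \<exists>v\<in>D. k < a * (\<Sum>i<m. e i * (\<Sum>j<n. G (i, j) w * v j)) - (enorm n v)\<^sup>2} \<le> Q / k"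
proof (cases "enorm m e = 0")
  case True
  then have "e i = 0" if "i < m" for i
    using abs_component_le_enorm[OF that, of e] by simp
  then have empty: "{w\<in>space M. \<exists>v\<in>D. k < a * (\<Sum>i<m. e i * (\<Sum>j<n. G (i, j) w * v j)) - (enorm n v)\<^sup>2} = {}"
    using k by (auto simp: not_less intro: order.trans[of _ 0])
  show ?thesis unfolding empty using k expected_lrt_nonneg[of \<omega>] by simp
next
  case False
  let ?f = "\<lambda>v w. - (enorm n v)\<^sup>2 + a * (\<Sum>i<m. e i * (\<Sum>j<n. G (i, j) w * v j))"
  have DK: "v + \<mu>\<^sub>0 \<in> K" if "v \<in> D" for v
    using D(2) that by (force simp: shifted_def)
  have s: "enorm m e = sqrt (\<Sum>i<m. (e i)\<^sup>2)" "0 < enorm m e"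
    using False by (auto simp: L2_set_def less_le sum_nonneg)
  have "(\<integral>\<^sup>+w. (SUP v\<in>D. ennreal (?f v w)) \<partial>M) =
      (\<integral>\<^sup>+h. (SUP v\<in>D. ennreal (- (enorm n v)\<^sup>2 + a * enorm m e * einner n h v)) \<partial>std_gaussian n)"
    by (rule nn_integral_SUP_gaussian_combination[OF n_pos _ indep_G normal_G s D(1)]) auto
  also have "\<dots> = (\<integral>\<^sup>+h. (SUP v\<in>D. ennreal (1 * (a * enorm m e * einner n h v - (enorm n v)\<^sup>2))) \<partial>std_gaussian n)"
    by simp
  also have "\<dots> \<le> ennreal (1 * Q)"
    using e a s by (intro nn_integral_SUP_quadratic_le DK) auto
  finally have le: "(\<integral>\<^sup>+w. (SUP v\<in>D. ennreal (?f v w)) \<partial>M) \<le> ennreal Q" by simp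
  have meas: "?f v \<in> borel_measurable M" for v
    by (intro borel_measurable_add borel_measurable_sum
        borel_measurable_times measurable_G borel_measurable_const) auto
  show ?thesis
    using prob_ex_gt_le(2)[OF D(1) meas le k] expected_lrt_nonneg[of \<omega>] by (simp add: algebra_simps)
qed

lemma prob_noise_cross_term_le:
  assumes D: "countable D" "D \<subseteq> shifted" and k: "0 < k" and a: "0 < a"
  defines "B \<equiv> {w\<in>space M. a * enorm m (\<xi> w) \<le> 2 * \<omega> \<and>
    (\<exists>v\<in>D. k < a * (\<Sum>i<m. \<xi> w i * (\<Sum>j<n. G (i, j) w * v j)) - (enorm n v)\<^sup>2)}"
  shows "B \<in> events" and "prob B \<le> Q / k"
proof -
  let ?N = "\<Pi>\<^sub>M p\<in>{..<m} \<times> {..<n}. (borel :: real measure)" and ?N' = "\<Pi>\<^sub>M i\<in>{..<m}. (borel :: real measure)"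
  let ?X = "\<lambda>w. \<lambda>(i, j)\<in>{..<m} \<times> {..<n}. X w i j" and ?\<xi> = "\<lambda>w. \<lambda>i\<in>{..<m}. \<xi> w i"
  define F where "F x e v = a * (\<Sum>i<m. e i * (\<Sum>j<n. sqrt n * x (i, j) * v j)) - (enorm n v)\<^sup>2"
    for x :: "nat \<times> nat \<Rightarrow> real" and e v
  \<comment> \<open>The event is written as a measurable set of pairs of design and noise, so that
    the product law can be applied.\<close>
  define S where "S = {p \<in> space (?N \<Otimes>\<^sub>M ?N'). a * enorm m (snd p) \<le> 2 * \<omega> \<and>
    (\<exists>v\<in>D. k < F (fst p) (snd p) v)}"
  have comp: "(\<lambda>p. fst p q) \<in> borel_measurable (?N \<Otimes>\<^sub>M ?N')" if "q \<in> {..<m} \<times> {..<n}" for q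
    by (rule measurable_compose[OF measurable_fst measurable_component_singleton[OF that]])
  have comp': "(\<lambda>p. snd p i) \<in> borel_measurable (?N \<Otimes>\<^sub>M ?N')" if "i \<in> {..<m}" for i
    by (rule measurable_compose[OF measurable_snd measurable_component_singleton[OF that]])
  have [measurable]: "(\<lambda>p. F (fst p) (snd p) v) \<in> borel_measurable (?N \<Otimes>\<^sub>M ?N')" for v
    unfolding F_def by (intro borel_measurable_diff borel_measurable_times borel_measurable_sum
        borel_measurable_const comp comp') auto
  have [measurable]: "(\<lambda>p. enorm m (snd p)) \<in> borel_measurable (?N \<Otimes>\<^sub>M ?N')"
    unfolding L2_set_def by (intro measurable_compose[OF _ borel_measurable_sqrt] borel_measurable_sum borel_measurable_power comp')
  have S: "S \<in> sets (?N \<Otimes>\<^sub>M ?N')"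
    unfolding S_def using D(1) by measurable
  have X: "?X \<in> measurable M ?N" and \<xi>: "?\<xi> \<in> measurable M ?N'"
    by (auto intro!: measurable_restrict measurable_X measurable_xi simp: split_beta')
  have F_eq: "F (?X w) e v = a * (\<Sum>i<m. e i * (\<Sum>j<n. G (i, j) w * v j)) - (enorm n v)\<^sup>2" for w e v
    by (simp add: F_def G_def)
  have F_\<xi>: "F x (?\<xi> w) v = F x (\<xi> w) v" "enorm m (?\<xi> w) = enorm m (\<xi> w)" for x w v
    by (auto simp: F_def L2_set_def)
  have B: "B = {w\<in>space M. (?X w, ?\<xi> w) \<in> S}"
    using measurable_space[OF X] measurable_space[OF \<xi>]
    by (auto simp: B_def S_def F_eq F_\<xi> space_pair_measure simp del: restrict_apply)
  show "B \<in> events"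
    unfolding B using X \<xi> S by measurable
  show "prob B \<le> Q / k"
    unfolding B
  proof (rule prob_indep_le[OF X \<xi> indep_X_xi S])
    show "0 \<le> Q / k" using k expected_lrt_nonneg by simp
    fix e assume e: "e \<in> space ?N'"
    show "prob {w\<in>space M. (?X w, e) \<in> S} \<le> Q / k"
    proof (cases "a * enorm m e \<le> 2 * \<omega>")
      case True
      have "{w\<in>space M. (?X w, e) \<in> S} =
          {w\<in>space M. \<exists>v\<in>D. k < a * (\<Sum>i<m. e i * (\<Sum>j<n. G (i, j) w * v j)) - (enorm n v)\<^sup>2}"
        using measurable_space[OF X] e True
        by (auto simp: S_def F_eq space_pair_measure simp del: restrict_apply)
      then show ?thesis using prob_cross_term_le[OF D k True a] by simp
    next
      case False
      then have empty: "{w\<in>space M. (?X w, e) \<in> S} = {}" by (auto simp: S_def)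
      show ?thesis unfolding empty using k expected_lrt_nonneg[of \<omega>] by simp
    qed
  qed
qed

text \<open>Expanding the square about the true signal isolates the cross term and the quadratic
  term; the powers of \<open>sqrt n\<close> undo the rescaling from \<open>X\<close> to
  \<open>G\<close>.\<close>

lemma residual_eq:
  assumes "\<mu> \<in> K"
  defines "v \<equiv> \<mu> - \<mu>\<^sub>0"
  shows "residual n m (response n (X w) \<mu>\<^sub>0 (\<xi> w)) (X w) \<mu> =
    (enorm m (\<xi> w))\<^sup>2 / m - 2 * ((\<Sum>i<m. \<xi> w i * (\<Sum>j<n. G (i, j) w * v j)) / (m * sqrt n))
      + (\<Sum>i<m. (\<Sum>j<n. G (i, j) w * v j)\<^sup>2) / (m * n)"
proof -
  let ?g = "\<lambda>i. \<Sum>j<n. G (i, j) w * v j"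
  have "(response n (X w) \<mu>\<^sub>0 (\<xi> w) - mat_vec n (X w) \<mu>) i = \<xi> w i - ?g i / sqrt n" for i
  proof -
    have "?g i = sqrt n * (\<Sum>j<n. X w i j * v j)"
      by (simp add: G_def sum_distrib_left mult.assoc)
    then have "?g i / sqrt n = (\<Sum>j<n. X w i j * v j)" using n_pos by simp
    then show ?thesis
      by (simp add: response_def mat_vec_def v_def algebra_simps sum_subtractf)
  qed
  then have "(enorm m (response n (X w) \<mu>\<^sub>0 (\<xi> w) - mat_vec n (X w) \<mu>))\<^sup>2 = (\<Sum>i<m. (\<xi> w i - ?g i / sqrt n)\<^sup>2)"
    by (simp only: L2_set_def) (simp add: sum_nonneg)
  also have "\<dots> = (\<Sum>i<m. (\<xi> w i)\<^sup>2 - 2 * (\<xi> w i * ?g i) / sqrt n + (?g i)\<^sup>2 / n)"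
    by (intro sum.cong refl) (simp add: power2_diff power_divide)
  also have "\<dots> = (enorm m (\<xi> w))\<^sup>2 - 2 * (\<Sum>i<m. \<xi> w i * ?g i) / sqrt n + (\<Sum>i<m. (?g i)\<^sup>2) / n"
    by (simp add: sum.distrib sum_subtractf sum_divide_distrib sum_distrib_left L2_set_def sum_nonneg)
  finally show ?thesis
    unfolding residual_def by (simp add: add_divide_distrib diff_divide_distrib mult.commute)
qed

text \<open>Outside two events of probability at most \<open>Q / k\<close> each, the rows are not
  too small and the cross term is not too large, uniformly over \<open>shifted\<close>. The bound on
  star-shaped sets then limits how far any candidate can lower the residual.\<close>

lemma residual_lower_bound:
  fixes t :: real
  assumes t: "0 < t" "t \<le> \<sigma> / 8"
  shows "\<exists>B\<in>events. prob B \<le> 2 * Q / (n * t\<^sup>2) \<and>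
    (\<forall>w\<in>space M - B. \<forall>\<mu>\<in>K. (enorm m (\<xi> w))\<^sup>2 \<le> 4 * \<sigma>\<^sup>2 * m \<longrightarrow>
      (enorm m (\<xi> w))\<^sup>2 / m - 64 * t\<^sup>2 \<le> residual n m (response n (X w) \<mu>\<^sub>0 (\<xi> w)) (X w) \<mu>)"
proof -
  obtain D where D: "countable D" "0 \<in> D" "D \<subseteq> shifted" "shifted \<subseteq> closure D"
    by (rule ex_countable_dense_shifted)
  define k where "k = real n * t\<^sup>2"
  have k: "0 < k" using n_pos t by (simp add: k_def)
  \<comment> \<open>Chosen so that a noise norm of at most \<open>2 * \<sigma> * sqrt m\<close>
    gives exactly the condition \<open>a * enorm m (\<xi> w) \<le> 2 * \<omega>\<close>.\<close>
  define a where "a = \<omega> / (\<sigma> * sqrt m)"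
  have a: "0 < a" using omega_pos sigma_pos m_pos by (simp add: a_def)
  define f where "f w v = (\<omega> / sqrt m) * (\<Sum>i<m. enorm n v / 2 - \<bar>\<Sum>j<n. G (i, j) w * v j\<bar>) - (enorm n v)\<^sup>2"
    for w v
  define g where "g w v = a * (\<Sum>i<m. \<xi> w i * (\<Sum>j<n. G (i, j) w * v j)) - (enorm n v)\<^sup>2" for w v
  define B1 where "B1 = {w\<in>space M. \<exists>v\<in>D. k < f w v}"
  define B2 where "B2 = {w\<in>space M. a * enorm m (\<xi> w) \<le> 2 * \<omega> \<and> (\<exists>v\<in>D. k < g w v)}"
  have B1: "B1 \<in> events" "prob B1 \<le> Q / k"
    unfolding B1_def f_def using prob_rows_small_le[OF D(1-3) k] by auto
  have B2: "B2 \<in> events" "prob B2 \<le> Q / k"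
    unfolding B2_def g_def using prob_noise_cross_term_le[OF D(1,3) k a] by auto
  show ?thesis
  proof (intro bexI[of _ "B1 \<union> B2"] conjI ballI impI)
    show "B1 \<union> B2 \<in> events" using B1 B2 by auto
    have "prob (B1 \<union> B2) \<le> prob B1 + prob B2"
      using B1 B2 by (intro measure_Un_le)
    also have "\<dots> \<le> 2 * Q / (n * t\<^sup>2)"
      using add_mono[OF B1(2) B2(2)] by (simp add: k_def)
    finally show "prob (B1 \<union> B2) \<le> 2 * Q / (n * t\<^sup>2)" .
  next
    fix w \<mu> assume w: "w \<in> space M - (B1 \<union> B2)" and \<xi>: "(enorm m (\<xi> w))\<^sup>2 \<le> 4 * \<sigma>\<^sup>2 * m" and \<mu>: "\<mu> \<in> K"
    let ?g = "\<lambda>v i. \<Sum>j<n. G (i, j) w * v j"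
    have "enorm m (\<xi> w) \<le> sqrt (4 * \<sigma>\<^sup>2 * m)" using \<xi> by (rule real_le_rsqrt)
    then have "enorm m (\<xi> w) \<le> 2 * \<sigma> * sqrt m" using sigma_pos by (simp add: real_sqrt_mult)
    then have "a * enorm m (\<xi> w) \<le> a * (2 * \<sigma> * sqrt m)" using a by (intro mult_left_mono) auto
    also have "\<dots> = 2 * \<omega>" using sigma_pos m_pos by (simp add: a_def)
    finally have "f w v \<le> k" "g w v \<le> k" if "v \<in> D" for v
      using w that by (auto simp: B1_def B2_def not_less)
    \<comment> \<open>For a fixed outcome both functions are continuous in \<open>v\<close>, so the
      bounds pass from \<open>D\<close> to its closure.\<close>
    moreover have "closed {v. f w v \<le> k}" "closed {v. g w v \<le> k}"
      unfolding f_def g_def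
      by (intro closed_Collect_le continuous_intros continuous_on_product_coordinates; simp)+
    ultimately have "closure D \<subseteq> {v. f w v \<le> k}" "closure D \<subseteq> {v. g w v \<le> k}"
      by (intro closure_minimal; auto)+
    with D(4) have fk: "f w v \<le> k" and gk: "g w v \<le> k" if "v \<in> shifted" for v
      using that by auto

    define \<rho> where "\<rho> = sqrt (r\<^sup>2 + \<sigma>\<^sup>2)"
    have \<rho>: "\<sigma> \<le> \<rho>" "0 < \<rho>"
      using sigma_pos by (auto simp: \<rho>_def add_nonneg_pos intro: real_le_rsqrt)
    have om: "\<omega> = \<rho> * sqrt n / sqrt m" by (simp add: omega_eq \<rho>_def)
    \<comment> \<open>In this normalization the residual changes by \<open>- 2 * L v\<close> plus a
      quadratic term that is at least \<open>(s v)^2\<close>; \<open>b v\<close> is the norm on the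
      scale of \<open>r\<close>.\<close>
    define L where "L v = (\<Sum>i<m. \<xi> w i * ?g v i) / (m * sqrt n)" for v
    define s where "s v = (\<Sum>i<m. \<bar>?g v i\<bar>) / (m * sqrt n)" for v
    define b where "b v = enorm n v / sqrt n" for v
    have sq: "sqrt n * sqrt n = real n" "sqrt m * sqrt m = real m" by auto
    have b2: "(b v)\<^sup>2 = (enorm n v)\<^sup>2 / n" for v
      by (simp add: b_def power_divide)
    have hom: "?g (c *\<^sub>R v) i = c * ?g v i" for c v i
      by (simp add: sum_distrib_left mult_ac)
    have s_ge: "b v / 2 - ((b v)\<^sup>2 + t\<^sup>2) / \<sigma> \<le> s v" if v: "v \<in> shifted" for v
    proof -
      have S: "(\<Sum>i<m. enorm n v / 2 - \<bar>?g v i\<bar>) = m * sqrt n * (b v / 2 - s v)"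
      proof -
        have s: "m * sqrt n * s v = (\<Sum>i<m. \<bar>?g v i\<bar>)" and b: "sqrt n * b v = enorm n v"
          using n_pos m_pos by (auto simp: s_def b_def)
        have "(\<Sum>i<m. enorm n v / 2 - \<bar>?g v i\<bar>) = m * (enorm n v / 2) - (\<Sum>i<m. \<bar>?g v i\<bar>)"
          by (simp add: sum_subtractf)
        also have "\<dots> = m * (sqrt n * b v / 2) - m * sqrt n * s v"
          unfolding s b ..
        also have "\<dots> = m * sqrt n * (b v / 2 - s v)"
          by (simp add: right_diff_distrib)
        finally show ?thesis .
      qed
      have "(\<omega> / sqrt m) * (m * sqrt n * (b v / 2 - s v)) = n * (\<rho> * (b v / 2 - s v))"
        using m_pos by (simp add: om field_simps sq)
      then have "n * (\<rho> * (b v / 2 - s v)) - n * (b v)\<^sup>2 \<le> n * t\<^sup>2"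
        using fk[OF v] n_pos unfolding f_def S by (simp add: k_def b2)
      then have "n * (\<rho> * (b v / 2 - s v)) \<le> n * ((b v)\<^sup>2 + t\<^sup>2)"
        by (simp add: algebra_simps)
      then have "\<rho> * (b v / 2 - s v) \<le> (b v)\<^sup>2 + t\<^sup>2"
        using n_pos by simp
      then have "b v / 2 - s v \<le> ((b v)\<^sup>2 + t\<^sup>2) / \<rho>"
        using \<rho> by (simp add: field_simps)
      \<comment> \<open>As \<open>\<sigma> \<le> \<rho>\<close>, this frees the bound from
        \<open>r\<close>.\<close>
      also have "\<dots> \<le> ((b v)\<^sup>2 + t\<^sup>2) / \<sigma>"
        using \<rho> sigma_pos by (intro divide_left_mono) auto
      finally show ?thesis by simp
    qed
    have L_le: "L v \<le> (b v)\<^sup>2 + t\<^sup>2" if v: "v \<in> shifted" for v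
    proof -
      have S: "(\<Sum>i<m. \<xi> w i * ?g v i) = m * sqrt n * L v"
        using n_pos m_pos by (simp add: L_def)
      have "a * (m * sqrt n * L v) = n * (\<rho> / \<sigma> * L v)"
        using m_pos by (simp add: a_def om field_simps sq)
      then have "n * (\<rho> / \<sigma> * L v) - n * (b v)\<^sup>2 \<le> n * t\<^sup>2"
        using gk[OF v] n_pos unfolding g_def S by (simp add: k_def b2)
      then have "n * (\<rho> / \<sigma> * L v) \<le> n * ((b v)\<^sup>2 + t\<^sup>2)"
        by (simp add: algebra_simps)
      then have le: "\<rho> / \<sigma> * L v \<le> (b v)\<^sup>2 + t\<^sup>2"
        by (rule mult_left_le_imp_le) (use n_pos in simp)
      show ?thesis
      \<comment> \<open>The factor \<open>\<rho> / \<sigma> \<ge> 1\<close> may be dropped only for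
        nonnegative \<open>L v\<close>; for negative values the bound is trivial.\<close>
      proof (cases "0 \<le> L v")
        case True
        have "1 * L v \<le> \<rho> / \<sigma> * L v"
          using \<rho> sigma_pos True by (intro mult_right_mono) auto
        then show ?thesis using le by simp
      next
        case False
        then show ?thesis by (smt (verit) zero_le_power2)
      qed
    qed
    have "\<mu> - \<mu>\<^sub>0 \<in> shifted" using \<mu> by (auto simp: shifted_def)
    then have main: "2 * L (\<mu> - \<mu>\<^sub>0) - (s (\<mu> - \<mu>\<^sub>0))\<^sup>2 \<le> 64 * t\<^sup>2"
    proof (rule star_shaped_quadratic_bound[where b = b and \<sigma> = \<sigma> and V = shifted])
      fix c :: real assume c: "0 \<le> c"
      show "L (c *\<^sub>R (\<mu> - \<mu>\<^sub>0)) = c * L (\<mu> - \<mu>\<^sub>0)"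
        unfolding L_def hom by (simp add: sum_distrib_left mult_ac)
      show "s (c *\<^sub>R (\<mu> - \<mu>\<^sub>0)) = c * s (\<mu> - \<mu>\<^sub>0)"
        unfolding s_def hom using c by (simp add: abs_mult flip: sum_distrib_left)
      show "b (c *\<^sub>R (\<mu> - \<mu>\<^sub>0)) = c * b (\<mu> - \<mu>\<^sub>0)"
        using c by (simp add: b_def)
      show "c *\<^sub>R (\<mu> - \<mu>\<^sub>0) \<in> shifted" if "c \<le> 1"
        using scale_shifted[OF \<open>\<mu> - \<mu>\<^sub>0 \<in> shifted\<close> c that] .
    qed (use L_le s_ge t in \<open>auto simp: b_def\<close>)
    have "(s (\<mu> - \<mu>\<^sub>0))\<^sup>2 \<le> (\<Sum>i<m. (?g (\<mu> - \<mu>\<^sub>0) i)\<^sup>2) / (m * n)"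
    proof -
      have "(s (\<mu> - \<mu>\<^sub>0))\<^sup>2 = (\<Sum>i<m. \<bar>?g (\<mu> - \<mu>\<^sub>0) i\<bar>)\<^sup>2 / (m * m * n)"
        by (simp add: s_def power_divide power_mult_distrib power2_eq_square[of "real m"])
      also have "\<dots> \<le> (m * (\<Sum>i<m. (?g (\<mu> - \<mu>\<^sub>0) i)\<^sup>2)) / (m * m * n)"
        by (intro divide_right_mono sum_abs_sq_le) auto
      finally show ?thesis using m_pos by simp
    qed
    then show "(enorm m (\<xi> w))\<^sup>2 / m - 64 * t\<^sup>2 \<le> residual n m (response n (X w) \<mu>\<^sub>0 (\<xi> w)) (X w) \<mu>"
      using main unfolding residual_eq[OF \<mu>] L_def by argo
  qed
qed

end

section \<open>The weak law of large numbers\<close>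

text \<open>With only a finite mean of \<open>f\<close> at hand, the summands are truncated at
  \<open>B\<close>: Hoeffding's inequality controls the bounded part and Markov's inequality the
  remainder.\<close>

lemma (in prob_space) prob_mean_deviation_le:
  fixes Z :: "nat \<Rightarrow> 'a \<Rightarrow> real"
  assumes ind: "indep_vars (\<lambda>_. borel) Z {..<m}" and law: "\<And>i. i < m \<Longrightarrow> distr M borel (Z i) = P"
    and m: "0 < m" and f [measurable]: "f \<in> borel_measurable borel" and f_nonneg: "\<And>x. 0 \<le> f x"
    and int: "integrable P f" and B: "0 < B" and e: "0 < e"
    and tail: "(\<integral>x. (if f x \<le> B then 0 else f x) \<partial>P) < e / 3"
  shows "prob {w\<in>space M. e < \<bar>(\<Sum>i<m. f (Z i w)) / m - (\<integral>x. f x \<partial>P)\<bar>} \<le>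
    2 * exp (- 2 * m * (e / 3)\<^sup>2 / B\<^sup>2) + (\<integral>x. (if f x \<le> B then 0 else f x) \<partial>P) / (e / 3)"
proof -
  define y where "y x = (if f x \<le> B then f x else 0)" for x
  define u where "u x = (if f x \<le> B then 0 else f x)" for x
  have [measurable]: "y \<in> borel_measurable borel" "u \<in> borel_measurable borel"
    unfolding y_def[abs_def] u_def[abs_def] by measurable
  have sets_P: "sets P = sets borel"
    using law[OF m] by (metis sets_distr)
  note [measurable_cong] = sets_P
  have rv [measurable]: "Z i \<in> borel_measurable M" if "i < m" for i
    using ind that by (auto simp: indep_vars_def2)
  have [measurable]: "y \<in> borel_measurable P" "u \<in> borel_measurable P"
    by (simp_all add: measurable_cong_sets[OF sets_P refl])
  have int_y: "integrable P y"
    by (rule Bochner_Integration.integrable_bound[OF int]) (auto simp: y_def f_nonneg)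
  have int_u: "integrable P u"
    by (rule Bochner_Integration.integrable_bound[OF int]) (auto simp: u_def f_nonneg)
  have fyu: "f x = y x + u x" for x by (simp add: y_def u_def)
  have expect: "expectation (\<lambda>w. g (Z i w)) = (\<integral>x. g x \<partial>P)" "integrable P g \<Longrightarrow> integrable M (\<lambda>w. g (Z i w))"
    if "i < m" and [measurable]: "g \<in> borel_measurable borel" for i and g :: "real \<Rightarrow> real"
    unfolding law[OF that(1), symmetric] using that by (simp_all add: integral_distr integrable_distr_eq rv)
  let ?A = "{w\<in>space M. e / 3 \<le> \<bar>(\<Sum>i<m. y (Z i w)) / m - (\<integral>x. y x \<partial>P)\<bar>}"
  let ?C = "{w\<in>space M. e / 3 \<le> (\<Sum>i<m. u (Z i w)) / m}"
  have meas: "(\<lambda>w. \<Sum>i<m. g (Z i w)) \<in> borel_measurable M"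
    if [measurable]: "g \<in> borel_measurable borel" for g :: "real \<Rightarrow> real"
    by (intro borel_measurable_sum measurable_compose[OF rv that]) auto
  have A: "prob ?A \<le> 2 * exp (- 2 * m * (e / 3)\<^sup>2 / B\<^sup>2)"
  proof -
    interpret iid: Hoeffding_ineq_iid M "{..<m}" "\<lambda>i w. y (Z i w)" "\<lambda>w. y (Z 0 w)" 0 B "\<integral>x. y x \<partial>P"
    proof unfold_locales
      show "indep_vars (\<lambda>_. borel) (\<lambda>i w. y (Z i w)) {..<m}"
        by (rule indep_vars_compose2[OF ind]) measurable
      have law_y: "distr M borel (\<lambda>w. y (Z i w)) = distr P borel y" if "i < m" for i
        using that unfolding law[OF that, symmetric] by (subst distr_distr) (auto simp: comp_def)
      show "distr M borel (\<lambda>w. y (Z i w)) = distr M borel (\<lambda>w. y (Z 0 w))" if "i \<in> {..<m}" for i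
        using that m law_y by simp
      show "random_variable borel (\<lambda>w. y (Z 0 w))"
        using m by measurable
      show "AE w in M. y (Z 0 w) \<in> {0..B}"
        using B f_nonneg by (auto simp: y_def)
      show "(\<integral>x. y x \<partial>P) \<equiv> expectation (\<lambda>w. y (Z 0 w))"
        using m by (simp add: expect)
    qed auto
    show ?thesis
      using iid.Hoeffding_ineq_abs_ge'[of "e / 3"] e B m by (simp add: lessThan_empty_iff)
  qed
  have C: "prob ?C \<le> (\<integral>x. u x \<partial>P) / (e / 3)"
  proof -
    have int: "integrable M (\<lambda>w. (\<Sum>i<m. u (Z i w)) / m)"
      using int_u by (intro integrable_divide Bochner_Integration.integrable_sum expect) auto
    have "(\<integral>w. (\<Sum>i<m. u (Z i w)) / m \<partial>M) = (\<Sum>i<m. (\<integral>x. u x \<partial>P)) / m"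
      using int_u by (simp add: expect Bochner_Integration.integral_sum)
    also have "\<dots> = (\<integral>x. u x \<partial>P)" using m by simp
    finally show ?thesis
      using integral_Markov_inequality_measure[OF int sets.empty_sets, of "e / 3"] e
      by (auto simp: u_def f_nonneg sum_nonneg)
  qed
  have "{w\<in>space M. e < \<bar>(\<Sum>i<m. f (Z i w)) / m - (\<integral>x. f x \<partial>P)\<bar>} \<subseteq> ?A \<union> ?C"
  proof
    fix w assume w: "w \<in> {w\<in>space M. e < \<bar>(\<Sum>i<m. f (Z i w)) / m - (\<integral>x. f x \<partial>P)\<bar>}"
    \<comment> \<open>The empirical and the true mean of the remainder both lie between 0 and
      \<open>e / 3\<close>, so they differ by less than \<open>e / 3\<close> and the bounded part
      must deviate.\<close>
    have arith: "e / 3 \<le> \<bar>a - c\<bar>"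
      if "e < \<bar>(a + b) - (c + d)\<bar>" "0 \<le> b" "b < e / 3" "0 \<le> d" "d < e / 3" for a b c d
      using that by linarith
    have "(\<integral>x. f x \<partial>P) = (\<integral>x. y x \<partial>P) + (\<integral>x. u x \<partial>P)"
      unfolding fyu by (rule Bochner_Integration.integral_add[OF int_y int_u])
    moreover have "(\<Sum>i<m. f (Z i w)) / m = (\<Sum>i<m. y (Z i w)) / m + (\<Sum>i<m. u (Z i w)) / m"
      unfolding fyu by (simp add: sum.distrib add_divide_distrib)
    moreover have "0 \<le> (\<Sum>i<m. u (Z i w)) / m" "0 \<le> (\<integral>x. u x \<partial>P)"
      by (auto simp: u_def f_nonneg sum_nonneg intro!: divide_nonneg_nonneg sum_nonneg integral_nonneg)
    moreover have "(\<integral>x. u x \<partial>P) < e / 3" using tail by (simp add: u_def)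
    moreover have "e < \<bar>(\<Sum>i<m. f (Z i w)) / m - (\<integral>x. f x \<partial>P)\<bar>" using w by simp
    ultimately have "e / 3 \<le> \<bar>(\<Sum>i<m. y (Z i w)) / m - (\<integral>x. y x \<partial>P)\<bar>"
      if "(\<Sum>i<m. u (Z i w)) / m < e / 3"
      using that by (intro arith[of _ "(\<Sum>i<m. u (Z i w)) / m" _ "\<integral>x. u x \<partial>P"]) (simp_all only:)
    then show "w \<in> ?A \<union> ?C"
      using w by (cases "(\<Sum>i<m. u (Z i w)) / m < e / 3") auto
  qed
  then have "prob {w\<in>space M. e < \<bar>(\<Sum>i<m. f (Z i w)) / m - (\<integral>x. f x \<partial>P)\<bar>} \<le> prob (?A \<union> ?C)"
    using meas by (intro finite_measure_mono) measurable
  also have "\<dots> \<le> prob ?A + prob ?C"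
    using meas by (intro measure_Un_le) measurable
  also have "\<dots> \<le> 2 * exp (- 2 * m * (e / 3)\<^sup>2 / B\<^sup>2) + (\<integral>x. u x \<partial>P) / (e / 3)"
    using A C by (rule add_mono)
  finally show ?thesis by (simp add: u_def)
qed

text \<open>Dominated convergence with dominating function \<open>f\<close>; at each point the tail
  is eventually 0.\<close>

lemma tendsto_integral_tail:
  fixes f :: "'a \<Rightarrow> real"
  assumes "integrable P f" "\<And>x. 0 \<le> f x"
  shows "(\<lambda>k. \<integral>x. (if f x \<le> real k then 0 else f x) \<partial>P) \<longlonglongrightarrow> 0"
proof -
  have [measurable]: "f \<in> borel_measurable P" using assms by auto
  have "(\<lambda>k. \<integral>x. (if f x \<le> real k then 0 else f x) \<partial>P) \<longlonglongrightarrow> (\<integral>x. 0 \<partial>P)"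
  proof (rule integral_dominated_convergence[where w=f])
    show "AE x in P. (\<lambda>k. if f x \<le> real k then 0 else f x) \<longlonglongrightarrow> 0"
    proof (rule AE_I2)
      fix x
      obtain k where "f x \<le> real k" using real_arch_simple by blast
      then have "eventually (\<lambda>k. (if f x \<le> real k then 0 else f x) = 0) sequentially"
        by (auto intro!: eventually_sequentiallyI[of k])
      then show "(\<lambda>k. if f x \<le> real k then 0 else f x) \<longlonglongrightarrow> 0"
        by (rule tendsto_eventually)
    qed
  qed (use assms in auto)
  then show ?thesis by simp
qed

text \<open>The probability spaces vary with \<open>n\<close>, but the law \<open>P\<close> does
  not. Hence the truncation level can be fixed before \<open>m n\<close> grows.\<close>

lemma weak_law_of_large_numbers_array:
  fixes Z :: "nat \<Rightarrow> 'w \<Rightarrow> nat \<Rightarrow> real"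
  assumes "\<forall>\<^sub>F n in sequentially. prob_space (M n)"
    and "\<forall>\<^sub>F n in sequentially. prob_space.indep_vars (M n) (\<lambda>_. borel) (\<lambda>i w. Z n w i) {..<m n}"
    and "\<forall>\<^sub>F n in sequentially. \<forall>i<m n. distr (M n) borel (\<lambda>w. Z n w i) = P"
    and m: "filterlim m at_top sequentially"
    and f: "f \<in> borel_measurable borel" "\<And>x. 0 \<le> f x" "integrable P f"
  shows "tendsto_in_prob M (\<lambda>n w. (\<Sum>i<m n. f (Z n w i)) / m n) (\<integral>x. f x \<partial>P)"
  unfolding tendsto_in_prob_def
proof (intro allI impI)
  fix e :: real assume e: "0 < e"
  let ?d = "\<lambda>k::nat. \<integral>x. (if f x \<le> real k then 0 else f x) \<partial>P"
  let ?p = "\<lambda>n. measure (M n) {w\<in>space (M n). e < \<bar>(\<Sum>i<m n. f (Z n w i)) / m n - (\<integral>x. f x \<partial>P)\<bar>}"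
  show "?p \<longlonglongrightarrow> 0"
  proof (rule tendstoI)
    fix \<eta> :: real assume \<eta>: "0 < \<eta>"
    \<comment> \<open>The first entry is the tail condition of the deviation bound; the second keeps
      the Markov term below \<open>\<eta> / 2\<close>.\<close>
    have "0 < min (e / 3) (\<eta> / 2 * (e / 3))" using e \<eta> by simp
    from order_tendstoD(2)[OF tendsto_integral_tail[OF f(3,2)] this]
    have "\<forall>\<^sub>F k in sequentially. ?d k < min (e / 3) (\<eta> / 2 * (e / 3)) \<and> 0 < k"
      by (intro eventually_conj eventually_gt_at_top)
    then obtain k where k: "?d k < e / 3" "?d k < \<eta> / 2 * (e / 3)" "0 < k"
      by (auto dest: eventually_happens)
    have "filterlim (\<lambda>n. real (m n)) at_top sequentially"
      by (rule filterlim_compose[OF filterlim_real_sequentially m])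
    then have "((\<lambda>n. exp (- (2 * (e / 3)\<^sup>2 / (real k)\<^sup>2 * real (m n)))) \<longlongrightarrow> 0) sequentially"
      using e k by (intro filterlim_compose[OF exp_at_bot] filterlim_uminus_at_bot_at_top[THEN filterlim_compose]
          filterlim_tendsto_pos_mult_at_top[OF tendsto_const]) auto
    from order_tendstoD(2)[OF this, of "\<eta> / 4"]
    have "\<forall>\<^sub>F n in sequentially. exp (- (2 * (e / 3)\<^sup>2 / (real k)\<^sup>2 * real (m n))) < \<eta> / 4"
      using \<eta> by simp
    moreover have "\<forall>\<^sub>F n in sequentially. 0 < m n"
      using m[unfolded filterlim_at_top, rule_format, of 1] by eventually_elim simp
    ultimately show "\<forall>\<^sub>F n in sequentially. dist (?p n) 0 < \<eta>"
      using assms(1-3)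
    proof eventually_elim
      case (elim n)
      then interpret prob_space "M n" by simp
      have "?p n \<le> 2 * exp (- 2 * real (m n) * (e / 3)\<^sup>2 / (real k)\<^sup>2) + ?d k / (e / 3)"
        using elim f e k by (intro prob_mean_deviation_le) auto
      moreover have "- 2 * real (m n) * (e / 3)\<^sup>2 / (real k)\<^sup>2 = - (2 * (e / 3)\<^sup>2 / (real k)\<^sup>2 * real (m n))"
        by simp
      moreover have "?d k / (e / 3) < \<eta> / 2"
        using k e by (simp add: field_simps)
      ultimately have "?p n < 2 * (\<eta> / 4) + \<eta> / 2"
        using elim by (simp only:)
      then show ?case by simp
    qed
  qed
qed

section \<open>Bounds on the gap\<close>

context convex_instance
begin

text \<open>Restricting the supremum defining \<open>lrt\<close> to the ray and optimizing leaves
  the squared positive part of a Gaussian functional, which has half of the full second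
  moment.\<close>

lemma expected_lrt_ge_ray:
  assumes n: "0 < n" and \<tau>: "0 \<le> \<tau>" and e: "0 < enorm n e" and ray: "\<And>c. 0 \<le> c \<Longrightarrow> \<mu>\<^sub>0 + c *\<^sub>R e \<in> K"
  shows "\<tau>\<^sup>2 / 2 \<le> (\<integral>h. lrt n K \<mu>\<^sub>0 \<tau> h \<partial>std_gaussian n)"
proof -
  let ?f = "\<lambda>h. \<tau>\<^sup>2 / (enorm n e)\<^sup>2 * (max 0 (einner n e h))\<^sup>2"
  have le: "?f h \<le> lrt n K \<mu>\<^sub>0 \<tau> h" for h
  proof -
    define p where "p = max 0 (einner n e h)"
    have p: "0 \<le> p" "p * einner n e h = p\<^sup>2" by (auto simp: p_def max_def power2_eq_square)
    \<comment> \<open>This is the maximizer over \<open>c \<ge> 0\<close> of the quadratic along the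
      ray.\<close>
    define c where "c = \<tau> * p / (enorm n e)\<^sup>2"
    have "0 \<le> c" using \<tau> p by (simp add: c_def)
    have "?f h = 2 * \<tau> * (c * einner n e h) - c\<^sup>2 * (enorm n e)\<^sup>2"
    proof -
      have "c * einner n e h = \<tau> * p\<^sup>2 / (enorm n e)\<^sup>2"
        unfolding c_def p(2)[symmetric] by simp
      moreover have "c\<^sup>2 * (enorm n e)\<^sup>2 = \<tau>\<^sup>2 * p\<^sup>2 / (enorm n e)\<^sup>2"
        using e by (simp add: c_def field_simps power2_eq_square)
      ultimately show ?thesis by (simp add: p_def[symmetric] power2_eq_square[of \<tau>])
    qed
    also have "\<dots> \<le> lrt n K \<mu>\<^sub>0 \<tau> h"
      using lrt_ge[OF ray[OF \<open>0 \<le> c\<close>], of \<tau> h] by (simp add: einner_commute power_mult_distrib)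
    finally show ?thesis .
  qed
  have "\<tau>\<^sup>2 / 2 = \<tau>\<^sup>2 / (enorm n e)\<^sup>2 * ((enorm n e)\<^sup>2 / 2)"
    using e by simp
  also have "\<dots> = (\<integral>h. ?f h \<partial>std_gaussian n)"
    by (simp only: integral_mult_right_zero integral_std_gaussian_einner_pos_sq(1)[OF n])
  also have "\<dots> \<le> (\<integral>h. lrt n K \<mu>\<^sub>0 \<tau> h \<partial>std_gaussian n)"
    using integral_std_gaussian_einner_pos_sq[OF n, of e]
    by (intro integral_mono integrable_lrt le integrable_mult_right) auto
  finally show ?thesis .
qed

lemma ex_direction_if_expected_err_pos:
  assumes "0 < (\<integral>h. err n K \<mu>\<^sub>0 \<tau> h \<partial>std_gaussian n)"
  obtains \<mu> where "\<mu> \<in> K" "0 < enorm n (\<mu> - \<mu>\<^sub>0)"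
proof -
  have "\<exists>h. err n K \<mu>\<^sub>0 \<tau> h \<noteq> 0"
  proof (rule ccontr)
    assume "\<not> ?thesis"
    then have "err n K \<mu>\<^sub>0 \<tau> = (\<lambda>_. 0)" by auto
    then show False using assms by simp
  qed
  then obtain h where "err n K \<mu>\<^sub>0 \<tau> h \<noteq> 0" ..
  then show ?thesis
    using mu_seq_in[of \<tau> h] by (intro that[of "mu_seq n K \<mu>\<^sub>0 \<tau> h"]) (auto simp: err_def less_le)
qed

text \<open>The tangent cone contains the ray through \<open>\<mu> - \<mu>\<^sub>0\<close>. The
  bound keeps quotients by the statistical dimension meaningful and makes \<open>m\<close> diverge
  when the ratio does.\<close>

lemma stat_dim_tangent_cone_ge:
  assumes n: "0 < n" and \<mu>: "\<mu> \<in> K" "0 < enorm n (\<mu> - \<mu>\<^sub>0)"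
  shows "1 / 2 \<le> stat_dim n T"
proof -
  interpret T: closed_convex_cone n T by (rule tangent_cone_closed_convex_cone)
  have "1\<^sup>2 / 2 \<le> (\<integral>h. lrt n T 0 1 h \<partial>std_gaussian n)"
    using T.scale_in[OF diff_in_tangent_cone[OF \<mu>(1)]]
    by (intro T.at_zero.expected_lrt_ge_ray[OF n _ \<mu>(2)]) auto
  then show ?thesis by (simp add: T.stat_dim_eq)
qed

lemma expected_lrt_le_stat_dim:
  assumes "0 \<le> \<tau>"
  shows "(\<integral>h. lrt n K \<mu>\<^sub>0 \<tau> h \<partial>std_gaussian n) \<le> \<tau>\<^sup>2 * stat_dim n T"
proof -
  interpret T: closed_convex_cone n T by (rule tangent_cone_closed_convex_cone)
  have "(\<integral>h. lrt n K \<mu>\<^sub>0 \<tau> h \<partial>std_gaussian n) \<le> (\<integral>h. lrt n T 0 \<tau> h \<partial>std_gaussian n)"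
    by (intro integral_mono integrable_lrt T.at_zero.integrable_lrt lrt_le_tangent_cone)
  also have "\<dots> = (\<integral>h. \<tau>\<^sup>2 * lrt n T 0 1 h \<partial>std_gaussian n)"
    using assms by (simp add: T.lrt_zero)
  finally show ?thesis by (simp add: T.stat_dim_eq)
qed

end

section \<open>Cones and their lineality space\<close>

locale convex_cone_instance = closed_convex_cone n K + convex_instance n K \<mu>\<^sub>0 for n K \<mu>\<^sub>0
begin

lemma lineality_space_eq: "lineality_space K = {x \<in> K. - x \<in> K}"
  using convex cone nonempty by (rule lineality_space_convex_cone)

text \<open>The residual of the projection is orthogonal to the projection and, pairing
  nonpositively with both \<nu> and \<open>- \<nu>\<close>, also to \<nu>. Only
  \<open>\<mu>\<^sub>0 - \<nu>\<close> survives in the pairing.\<close>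

lemma lrt_minus_err_lineality:
  assumes "\<nu> \<in> lineality_space K"
  shows "lrt n K \<mu>\<^sub>0 \<tau> h - err n K \<mu>\<^sub>0 \<tau> h =
    2 * einner n (mu_seq n K \<mu>\<^sub>0 \<tau> h - \<mu>\<^sub>0) (\<mu>\<^sub>0 - \<nu>) - 2 * \<tau> * einner n (\<mu>\<^sub>0 - \<nu>) h"
proof -
  let ?y = "\<mu>\<^sub>0 + \<tau> *\<^sub>R h"
  let ?p = "metric_proj n K ?y"
  have "einner n (?y - ?p) \<nu> \<le> 0" "einner n (?y - ?p) (- \<nu>) \<le> 0"
    using assms by (auto simp: lineality_space_eq intro: proj_polar simp del: einner_minus_right)
  then have "einner n (?y - ?p) \<nu> = 0" by simp
  moreover have "einner n (?y - ?p) ?p = 0" by (rule proj_orthogonal)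
  ultimately have "einner n (?y - ?p) (?p - \<mu>\<^sub>0) = - einner n (?y - ?p) (\<mu>\<^sub>0 - \<nu>)"
    by (simp only: einner_diff_right)
  also have "\<dots> = einner n (?p - \<mu>\<^sub>0) (\<mu>\<^sub>0 - \<nu>) - \<tau> * einner n (\<mu>\<^sub>0 - \<nu>) h"
  proof -
    have "?y - ?p = \<tau> *\<^sub>R h - (?p - \<mu>\<^sub>0)" by (simp add: fun_eq_iff)
    then show ?thesis
      by (simp only: einner_diff_left[of n "\<tau> *\<^sub>R h"] einner_scaleR_left einner_commute[of n h])
  qed
  finally show ?thesis
    using lrt_minus_err[of \<tau> h] by (simp add: mu_seq_def)
qed

text \<open>The Gaussian term has mean 0. The other one is split by
  \<open>2 * b * d \<le> s * b^2 + d^2 / s\<close>, which involves \<open>err\<close> only through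
  its mean; optimizing \<open>s\<close> produces the square root.\<close>

lemma expected_lrt_minus_err_le:
  assumes \<nu>: "\<nu> \<in> lineality_space K"
  shows "(\<integral>h. lrt n K \<mu>\<^sub>0 \<tau> h \<partial>std_gaussian n) - (\<integral>h. err n K \<mu>\<^sub>0 \<tau> h \<partial>std_gaussian n)
    \<le> 2 * sqrt (\<integral>h. err n K \<mu>\<^sub>0 \<tau> h \<partial>std_gaussian n) * enorm n (\<mu>\<^sub>0 - \<nu>)"
proof -
  interpret prob_space "std_gaussian n" by simp
  define d where "d = enorm n (\<mu>\<^sub>0 - \<nu>)"
  define E where "E = (\<integral>h. err n K \<mu>\<^sub>0 \<tau> h \<partial>std_gaussian n)"
  have d: "0 \<le> d" and E: "0 \<le> E" by (auto simp: d_def E_def err_nonneg)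
  have "(\<integral>h. lrt n K \<mu>\<^sub>0 \<tau> h \<partial>std_gaussian n) - E \<le> s * E + d\<^sup>2 / s" if s: "0 < s" for s
  proof -
    have "(\<integral>h. lrt n K \<mu>\<^sub>0 \<tau> h - err n K \<mu>\<^sub>0 \<tau> h \<partial>std_gaussian n) \<le>
        (\<integral>h. s * err n K \<mu>\<^sub>0 \<tau> h + d\<^sup>2 / s - 2 * \<tau> * einner n (\<mu>\<^sub>0 - \<nu>) h \<partial>std_gaussian n)"
    proof (intro integral_mono)
      fix h
      define b where "b = enorm n (mu_seq n K \<mu>\<^sub>0 \<tau> h - \<mu>\<^sub>0)"
      have "2 * einner n (mu_seq n K \<mu>\<^sub>0 \<tau> h - \<mu>\<^sub>0) (\<mu>\<^sub>0 - \<nu>) \<le> 2 * (b * d)"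
        using einner_le_enorm[of n "mu_seq n K \<mu>\<^sub>0 \<tau> h - \<mu>\<^sub>0" "\<mu>\<^sub>0 - \<nu>"] by (simp add: b_def d_def)
      also have "\<dots> \<le> s * b\<^sup>2 + d\<^sup>2 / s"
      proof -
        have "0 \<le> (s * b - d)\<^sup>2 / s" using s by simp
        also have "\<dots> = s * b\<^sup>2 + d\<^sup>2 / s - 2 * (b * d)"
          using s by (simp add: power2_eq_square field_simps)
        finally show ?thesis by simp
      qed
      finally show "lrt n K \<mu>\<^sub>0 \<tau> h - err n K \<mu>\<^sub>0 \<tau> h \<le>
          s * err n K \<mu>\<^sub>0 \<tau> h + d\<^sup>2 / s - 2 * \<tau> * einner n (\<mu>\<^sub>0 - \<nu>) h"
        unfolding lrt_minus_err_lineality[OF \<nu>] by (simp add: err_def b_def)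
    qed (intro Bochner_Integration.integrable_diff Bochner_Integration.integrable_add integrable_mult_right
        integrable_lrt integrable_err integrable_std_gaussian_einner integrable_const)+
    also have "\<dots> = s * E + d\<^sup>2 / s"
      by (simp add: E_def integrable_err integrable_std_gaussian_einner integral_std_gaussian_einner
          prob_space[simplified])
    finally show ?thesis by (simp add: E_def integrable_lrt integrable_err)
  qed
  note le = this
  show ?thesis
  proof (cases "E = 0 \<or> d = 0")
    case False
    then have pos: "0 < sqrt E" "0 < d" using d E by auto
    have "d / sqrt E * E + d\<^sup>2 / (d / sqrt E) = 2 * sqrt E * d"
      using pos E by (simp add: field_simps power2_eq_square)
    then show ?thesis
      using le[of "d / sqrt E"] pos by (simp add: d_def E_def)
  next
    \<comment> \<open>The optimal weight \<open>d / sqrt E\<close> is not positive here, so the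
      bound 0 is approached by weights depending on \<epsilon>.\<close>
    case True
    show ?thesis
    proof (rule field_le_epsilon)
      fix \<epsilon> :: real assume \<epsilon>: "0 < \<epsilon>"
      have "(\<integral>h. lrt n K \<mu>\<^sub>0 \<tau> h \<partial>std_gaussian n) - E \<le> \<epsilon>"
      proof (cases "E = 0")
        case True
        \<comment> \<open>The summand 1 keeps the weight positive even if
          \<open>d = 0\<close>.\<close>
        have "d\<^sup>2 / ((d\<^sup>2 + 1) / \<epsilon>) \<le> \<epsilon>"
          using \<epsilon> by (simp add: pos_divide_le_eq add_nonneg_pos)
        then show ?thesis
          using le[of "(d\<^sup>2 + 1) / \<epsilon>"] \<epsilon> True by (simp add: add_nonneg_pos)
      next
        case False
        then have "d = 0" "0 < E" using True E by auto
        then show ?thesis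
          using le[of "\<epsilon> / E"] \<epsilon> by simp
      qed
      then show "(\<integral>h. lrt n K \<mu>\<^sub>0 \<tau> h \<partial>std_gaussian n) - (\<integral>h. err n K \<mu>\<^sub>0 \<tau> h \<partial>std_gaussian n)
          \<le> 2 * sqrt (\<integral>h. err n K \<mu>\<^sub>0 \<tau> h \<partial>std_gaussian n) * enorm n (\<mu>\<^sub>0 - \<nu>) + \<epsilon>"
        using True by (auto simp: E_def d_def)
    qed
  qed
qed

end

section \<open>Consequences of the fixed point equation\<close>

locale fixed_point_instance = convex_instance n K \<mu>\<^sub>0 for n K \<mu>\<^sub>0 +
  fixes m :: nat and \<sigma> r :: real
  assumes n_pos: "0 < n" and sigma_pos: "0 < \<sigma>" and fixed_point: "fixed_point_sol \<sigma> n m K \<mu>\<^sub>0 r"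
begin

abbreviation "w \<equiv> omega \<sigma> (real m / real n) r"

lemma r_pos: "0 < r" and expected_err: "(\<integral>h. err n K \<mu>\<^sub>0 w h \<partial>std_gaussian n) = n * r\<^sup>2"
  using fixed_point n_pos by (auto simp: fixed_point_sol_def field_simps)

text \<open>For \<open>m = 0\<close> the noise level \<open>w\<close> is \<open>0\<close>, since division by zero yields \<open>0\<close>.\<close>

lemma m_pos: "0 < m"
proof (rule ccontr)
  assume "\<not> 0 < m"
  then have "w = 0" by (simp add: omega_def)
  have "err n K \<mu>\<^sub>0 w h \<le> 0" for h
    using err_le_lrt[of w h] lrt_le[of w h] \<open>w = 0\<close> by simp
  then have "err n K \<mu>\<^sub>0 w = (\<lambda>_. 0)" using err_nonneg by (auto simp: fun_eq_iff antisym)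
  then show False using expected_err r_pos n_pos by simp
qed

lemma w_nonneg: "0 \<le> w" and w_sq: "w\<^sup>2 = n * (r\<^sup>2 + \<sigma>\<^sup>2) / m"
  by (auto simp: omega_def)

text \<open>The equation contributes \<open>n * r^2\<close> as the mean of \<open>err\<close>, and
  the gap contributes the rest. If \<open>r\<close> and the gap vanish, the mean of
  \<open>lrt\<close> is therefore \<open>o(n)\<close>.\<close>

lemma expected_lrt: "(\<integral>h. lrt n K \<mu>\<^sub>0 w h \<partial>std_gaussian n) = n * (r\<^sup>2 + 2 * \<sigma>\<^sup>2 * gap \<sigma> n m K \<mu>\<^sub>0 r)"
  using n_pos sigma_pos by (simp add: gap_def Let_def expected_err field_simps)

lemma gap_nonneg: "0 \<le> gap \<sigma> n m K \<mu>\<^sub>0 r"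
proof -
  have "(\<integral>h. err n K \<mu>\<^sub>0 w h \<partial>std_gaussian n) \<le> (\<integral>h. lrt n K \<mu>\<^sub>0 w h \<partial>std_gaussian n)"
    by (intro integral_mono integrable_err integrable_lrt err_le_lrt)
  then show ?thesis by (simp add: gap_def Let_def)
qed

lemma stat_dim_ge: "1 / 2 \<le> stat_dim n T"
proof -
  have "0 < (\<integral>h. err n K \<mu>\<^sub>0 w h \<partial>std_gaussian n)"
    using expected_err r_pos n_pos by simp
  then show ?thesis
    using ex_direction_if_expected_err_pos stat_dim_tangent_cone_ge n_pos by metis
qed

lemma gap_stat_dim:
  "r\<^sup>2 + 2 * \<sigma>\<^sup>2 * gap \<sigma> n m K \<mu>\<^sub>0 r \<le> (r\<^sup>2 + \<sigma>\<^sup>2) * (stat_dim n T / m)"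
proof -
  have "n * (r\<^sup>2 + 2 * \<sigma>\<^sup>2 * gap \<sigma> n m K \<mu>\<^sub>0 r) \<le> w\<^sup>2 * stat_dim n T"
    using expected_lrt_le_stat_dim[OF w_nonneg] expected_lrt by simp
  also have "\<dots> = n * ((r\<^sup>2 + \<sigma>\<^sup>2) * (stat_dim n T / m))"
    by (simp add: w_sq)
  finally show ?thesis by (rule mult_left_le_imp_le) (use n_pos in simp)
qed

text \<open>For a ratio \<open>q \<le> 1\<close> the term \<open>r^2 * q\<close> on the right of
  \<open>gap_stat_dim\<close> is absorbed by \<open>r^2\<close> on the left.\<close>

lemma gap_le_stat_dim:
  assumes "stat_dim n T \<le> m"
  shows "gap \<sigma> n m K \<mu>\<^sub>0 r \<le> stat_dim n T / (2 * m)"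
proof -
  define q where "q = stat_dim n T / m"
  have q: "q \<le> 1" using assms m_pos by (simp add: q_def)
  have "r\<^sup>2 * q \<le> r\<^sup>2 * 1" using q by (intro mult_left_mono) auto
  then have "\<sigma>\<^sup>2 * (2 * gap \<sigma> n m K \<mu>\<^sub>0 r) \<le> \<sigma>\<^sup>2 * q"
    using gap_stat_dim by (simp add: q_def algebra_simps)
  then have "2 * gap \<sigma> n m K \<mu>\<^sub>0 r \<le> q"
    by (rule mult_left_le_imp_le) (use sigma_pos in simp)
  then show ?thesis by (simp add: q_def)
qed

text \<open>For a ratio of at most 1/2 half of \<open>r^2\<close> remains after absorption, and the
  gap term is dropped as nonnegative.\<close>

lemma r_sq_le_stat_dim:
  assumes "2 * stat_dim n T \<le> m"
  shows "r\<^sup>2 \<le> 2 * \<sigma>\<^sup>2 * (stat_dim n T / m)"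
proof -
  define q where "q = stat_dim n T / m"
  have q: "q \<le> 1 / 2" using assms m_pos by (simp add: q_def field_simps)
  have "r\<^sup>2 * q \<le> r\<^sup>2 * (1 / 2)" using q by (intro mult_left_mono) auto
  moreover have "r\<^sup>2 \<le> r\<^sup>2 * q + \<sigma>\<^sup>2 * q"
    using gap_stat_dim mult_nonneg_nonneg[OF zero_le_power2[of \<sigma>] gap_nonneg]
    by (simp add: q_def algebra_simps)
  ultimately show ?thesis by (simp add: q_def[symmetric])
qed

end

locale fixed_point_cone_instance = fixed_point_instance + convex_cone_instance
begin

text \<open>At the fixed point the root of the mean error is \<open>sqrt n * r\<close>, so the bound
  is linear in the distance to each \<nu> and passes to the infimum.\<close>

lemma gap_le_lineality:
  "gap \<sigma> n m K \<mu>\<^sub>0 r \<le> 1 / \<sigma>\<^sup>2 * (r * ((INF \<nu>\<in>lineality_space K. enorm n (\<mu>\<^sub>0 - \<nu>)) / sqrt n))"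
proof -
  let ?g = "gap \<sigma> n m K \<mu>\<^sub>0 r"
  have "\<sigma>\<^sup>2 * ?g * sqrt n / r \<le> enorm n (\<mu>\<^sub>0 - \<nu>)" if "\<nu> \<in> lineality_space K" for \<nu>
  proof -
    have "n * (2 * \<sigma>\<^sup>2 * ?g) \<le> 2 * (sqrt n * r) * enorm n (\<mu>\<^sub>0 - \<nu>)"
      using expected_lrt_minus_err_le[OF that, of w] r_pos
      by (simp add: expected_err expected_lrt real_sqrt_mult algebra_simps)
    then have "sqrt n * (sqrt n * (\<sigma>\<^sup>2 * ?g)) \<le> sqrt n * (r * enorm n (\<mu>\<^sub>0 - \<nu>))"
      by (simp add: mult.assoc[symmetric])
    then have "sqrt n * (\<sigma>\<^sup>2 * ?g) \<le> r * enorm n (\<mu>\<^sub>0 - \<nu>)"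
      by (rule mult_left_le_imp_le) (use n_pos in simp)
    then show ?thesis using r_pos by (simp add: field_simps)
  qed
  moreover have "lineality_space K \<noteq> {}"
    using zero_in by (auto simp: lineality_space_eq intro!: exI[of _ 0])
  ultimately have "\<sigma>\<^sup>2 * ?g * sqrt n / r \<le> (INF \<nu>\<in>lineality_space K. enorm n (\<mu>\<^sub>0 - \<nu>))"
    by (intro cINF_greatest)
  then show ?thesis
    using r_pos sigma_pos n_pos by (simp add: field_simps)
qed

text \<open>A nontrivial cone contains a ray starting at \<open>\<mu>\<^sub>0\<close>, so the mean
  of \<open>lrt\<close> is at least \<open>w^2 / 2\<close>. When \<open>r\<close> and the gap
  vanish, this forces \<open>m\<close> to diverge.\<close>

lemma inverse_m_le: "\<sigma>\<^sup>2 / (2 * m) \<le> r\<^sup>2 + 2 * \<sigma>\<^sup>2 * gap \<sigma> n m K \<mu>\<^sub>0 r"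
proof -
  have "0 < (\<integral>h. err n K \<mu>\<^sub>0 w h \<partial>std_gaussian n)"
    using expected_err r_pos n_pos by simp
  then obtain \<mu> where \<mu>: "\<mu> \<in> K" "0 < enorm n (\<mu> - \<mu>\<^sub>0)"
    using ex_direction_if_expected_err_pos by metis
  have "\<exists>e\<in>K. 0 < enorm n e"
  proof (rule ccontr)
    assume "\<not> ?thesis"
    then have "enorm n \<mu> = 0" "enorm n \<mu>\<^sub>0 = 0" using \<mu> mu0 by (auto simp: less_le)
    then have "\<mu> i = 0" "\<mu>\<^sub>0 i = 0" if "i < n" for i
      using abs_component_le_enorm[OF that] by (metis abs_le_zero_iff)+
    then have "enorm n (\<mu> - \<mu>\<^sub>0) = 0" by (simp add: L2_set_def)
    then show False using \<mu> by simp
  qed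
  then obtain e where e: "e \<in> K" "0 < enorm n e" by blast
  have "w\<^sup>2 / 2 \<le> n * (r\<^sup>2 + 2 * \<sigma>\<^sup>2 * gap \<sigma> n m K \<mu>\<^sub>0 r)"
    using expected_lrt_ge_ray[OF n_pos w_nonneg e(2)] add_in[OF mu0 scale_in[OF e(1)]] expected_lrt by simp
  moreover have "n * (\<sigma>\<^sup>2 / (2 * m)) \<le> w\<^sup>2 / 2"
    unfolding w_sq using m_pos by (simp add: field_simps)
  ultimately have "n * (\<sigma>\<^sup>2 / (2 * m)) \<le> n * (r\<^sup>2 + 2 * \<sigma>\<^sup>2 * gap \<sigma> n m K \<mu>\<^sub>0 r)" by linarith
  then show ?thesis by (rule mult_left_le_imp_le) (use n_pos in simp)
qed

end

section \<open>Asymptotics\<close>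

lemma residual_nonneg: "0 \<le> residual n m y A \<mu>"
  by (simp add: residual_def)

lemma residual_true_signal: "residual n m (response n A \<mu>\<^sub>0 e) A \<mu>\<^sub>0 = (enorm m e)\<^sup>2 / m"
  by (simp add: residual_def response_def)

text \<open>Near minimality compared with \<open>\<mu>\<^sub>0\<close> bounds the residual above and
  \<open>residual_lower_bound\<close> bounds it below, both by the mean squared noise up to small
  errors; the weak law of large numbers gives its limit.\<close>

lemma residual_tendsto_in_prob:
  fixes \<sigma> :: real and P :: "real measure"
    and m :: "nat \<Rightarrow> nat" and K :: "nat \<Rightarrow> (nat \<Rightarrow> real) set" and \<mu>\<^sub>0 :: "nat \<Rightarrow> nat \<Rightarrow> real"
    and r :: "nat \<Rightarrow> real" and M :: "nat \<Rightarrow> 'w measure"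
    and X :: "nat \<Rightarrow> 'w \<Rightarrow> nat \<Rightarrow> nat \<Rightarrow> real" and \<xi> Y :: "nat \<Rightarrow> 'w \<Rightarrow> nat \<Rightarrow> real"
  assumes sigma: "0 < \<sigma>"
    and K: "\<And>n. n \<ge> 1 \<Longrightarrow> closedin (Euclidean_space n) (K n) \<and> convex (K n) \<and> \<mu>\<^sub>0 n \<in> K n"
    and fixed: "\<forall>\<^sub>F n in sequentially. fixed_point_sol \<sigma> n (m n) (K n) (\<mu>\<^sub>0 n) (r n)"
    and P: "integrable P (\<lambda>x. x\<^sup>2)" "(\<integral>x. x\<^sup>2 \<partial>P) = \<sigma>\<^sup>2"
    and model: "\<And>n. n \<ge> 1 \<Longrightarrow> design_and_noise P n (m n) (M n) (X n) (\<xi> n)"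
    and Y: "\<And>n w. n \<ge> 1 \<Longrightarrow> w \<in> space (M n) \<Longrightarrow> Y n w = response n (X n w) (\<mu>\<^sub>0 n) (\<xi> n w)"
    and m: "filterlim m at_top sequentially"
    and r: "r \<longlonglongrightarrow> 0"
    and gap: "(\<lambda>n. gap \<sigma> n (m n) (K n) (\<mu>\<^sub>0 n) (r n)) \<longlonglongrightarrow> 0"
    and near: "near_minimizers m K r M Y X \<mu>h"
  shows "tendsto_in_prob M (\<lambda>n w. residual n (m n) (Y n w) (X n w) (\<mu>h n w)) (\<sigma>\<^sup>2)"
  unfolding tendsto_in_prob_def
proof (intro allI impI)
  fix e :: real assume e: "0 < e"
  obtain \<epsilon> where \<mu>h: "\<And>n. 1 \<le> n \<Longrightarrow> AE w in M n. \<mu>h n w \<in> K n"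
    and \<epsilon>_meas: "\<And>n. 1 \<le> n \<Longrightarrow> \<epsilon> n \<in> borel_measurable (M n)"
    and \<epsilon>: "small_o_prob M \<epsilon> (\<lambda>n. (r n)\<^sup>2)"
    and \<mu>h_le: "\<And>n. 1 \<le> n \<Longrightarrow> AE w in M n. residual n (m n) (Y n w) (X n w) (\<mu>h n w)
      \<le> (INF \<mu>\<in>K n. residual n (m n) (Y n w) (X n w) \<mu>) + \<epsilon> n w"
    using near unfolding near_minimizers_def by blast
  \<comment> \<open>The number 192 is \<open>3 * 64\<close>, so the loss \<open>64 * t^2\<close> is
    at most \<open>e / 3\<close>; the other entry is the range in which the lower bound
    holds.\<close>
  define t where "t = min (\<sigma> / 8) (sqrt (e / 192))"
  have t: "0 < t" "t \<le> \<sigma> / 8" using sigma e by (auto simp: t_def)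
  have "t\<^sup>2 \<le> (sqrt (e / 192))\<^sup>2" using t by (intro power_mono) (auto simp: t_def)
  then have t_sq: "64 * t\<^sup>2 \<le> e / 3" using e by simp
  define W where "W n w = (\<Sum>i<m n. (\<xi> n w i)\<^sup>2) / m n" for n w
  have W: "(enorm (m n) (\<xi> n w))\<^sup>2 / m n = W n w" for n w
    by (simp add: W_def L2_set_def sum_nonneg)
  have W_prob: "tendsto_in_prob M W (\<sigma>\<^sup>2)"
  proof -
    have "tendsto_in_prob M (\<lambda>n w. (\<Sum>i<m n. (\<xi> n w i)\<^sup>2) / m n) (\<integral>x. x\<^sup>2 \<partial>P)"
      by (rule weak_law_of_large_numbers_array[where f="\<lambda>x. x\<^sup>2"])
        (use model P(1) m in \<open>auto simp: design_and_noise_def intro!: eventually_sequentiallyI[of 1]\<close>)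
    then show ?thesis by (simp add: P(2) W_def[abs_def])
  qed
  define q where "q n = (r n)\<^sup>2 + 2 * \<sigma>\<^sup>2 * gap \<sigma> n (m n) (K n) (\<mu>\<^sub>0 n) (r n)" for n
  have q: "q \<longlonglongrightarrow> 0"
    unfolding q_def[abs_def] using tendsto_add[OF tendsto_power[OF r, of 2] tendsto_mult_left[OF gap, of "2 * \<sigma>\<^sup>2"]]
    by simp
  let ?bad = "\<lambda>n. {w\<in>space (M n). e < \<bar>residual n (m n) (Y n w) (X n w) (\<mu>h n w) - \<sigma>\<^sup>2\<bar>}"
  let ?A1 = "\<lambda>n. {w\<in>space (M n). e / 3 < \<bar>W n w - \<sigma>\<^sup>2\<bar>}"
  \<comment> \<open>Outside this event the mean squared noise is at most
    \<open>4 * \<sigma>^2\<close>, the condition of the lower bound.\<close>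
  let ?A2 = "\<lambda>n. {w\<in>space (M n). 3 * \<sigma>\<^sup>2 < \<bar>W n w - \<sigma>\<^sup>2\<bar>}"
  \<comment> \<open>The slack is controlled relative to \<open>(r n)^2\<close>, which is eventually
    below 1, so outside this event the slack itself is at most \<open>e / 3\<close>.\<close>
  let ?A3 = "\<lambda>n. {w\<in>space (M n). e / 3 < \<bar>\<epsilon> n w / (r n)\<^sup>2 - 0\<bar>}"
  let ?u = "\<lambda>n. measure (M n) (?A1 n) + measure (M n) (?A2 n) + measure (M n) (?A3 n) + 2 * q n / t\<^sup>2"
  have W_tail: "(\<lambda>n. measure (M n) {w\<in>space (M n). x < \<bar>W n w - \<sigma>\<^sup>2\<bar>}) \<longlonglongrightarrow> 0" if "0 < x" for x
    using W_prob that unfolding tendsto_in_prob_def by blast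
  have \<epsilon>_tail: "(\<lambda>n. measure (M n) {w\<in>space (M n). x < \<bar>\<epsilon> n w / (r n)\<^sup>2 - 0\<bar>}) \<longlonglongrightarrow> 0" if "0 < x" for x
    using \<epsilon> that unfolding small_o_prob_def tendsto_in_prob_def by blast
  have "(\<lambda>n. measure (M n) (?A1 n)) \<longlonglongrightarrow> 0" "(\<lambda>n. measure (M n) (?A2 n)) \<longlonglongrightarrow> 0"
      "(\<lambda>n. measure (M n) (?A3 n)) \<longlonglongrightarrow> 0"
    by (intro W_tail \<epsilon>_tail; use e sigma in simp)+
  moreover have "(\<lambda>n. 2 * q n / t\<^sup>2) \<longlonglongrightarrow> 0"
    using tendsto_divide[OF tendsto_mult_left[OF q, of 2] tendsto_const[of "t\<^sup>2"]] t by simp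
  ultimately have "?u \<longlonglongrightarrow> 0 + 0 + 0 + 0"
    by (intro tendsto_add)
  then have u: "?u \<longlonglongrightarrow> 0" by (simp only: add_0_left)
  have "\<forall>\<^sub>F n in sequentially. (r n)\<^sup>2 < 1"
    using order_tendstoD(2)[OF tendsto_power[OF r, of 2], of 1] by simp
  then have "\<forall>\<^sub>F n in sequentially. measure (M n) (?bad n) \<le> ?u n"
    using fixed eventually_ge_at_top[of 1]
  proof eventually_elim
    case (elim n)
    interpret fp: fixed_point_instance n "K n" "\<mu>\<^sub>0 n" "m n" \<sigma> "r n"
      using elim K sigma by unfold_locales auto
    interpret prob_space "M n"
      using model elim by (simp add: design_and_noise_def)
    interpret lm: linear_model n "K n" "\<mu>\<^sub>0 n" "M n" P "m n" "X n" "\<xi> n" \<sigma> "r n"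
      using fp.n_pos fp.m_pos sigma model elim by unfold_locales auto
    \<comment> \<open>The fixed point equation identifies the mean of \<open>lrt\<close> with
      \<open>n * q n\<close>, so the exceptional probability tends to 0 with
      \<open>q\<close>.\<close>
    have Q: "2 * lm.Q / (n * t\<^sup>2) = 2 * q n / t\<^sup>2"
      using fp.expected_lrt fp.n_pos by (simp add: lm.\<omega>_def q_def)
    obtain B where B: "B \<in> events" "prob B \<le> 2 * q n / t\<^sup>2"
      and lower: "\<And>w \<mu>. \<lbrakk>w \<in> space (M n) - B; \<mu> \<in> K n; (enorm (m n) (\<xi> n w))\<^sup>2 \<le> 4 * \<sigma>\<^sup>2 * m n\<rbrakk> \<Longrightarrow>
        W n w - 64 * t\<^sup>2 \<le> residual n (m n) (response n (X n w) (\<mu>\<^sub>0 n) (\<xi> n w)) (X n w) \<mu>"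
      using lm.residual_lower_bound[OF t] unfolding Q W by blast
    obtain N where N: "N \<in> null_sets (M n)"
      and N_sub: "{w\<in>space (M n). \<not> (\<mu>h n w \<in> K n \<and> residual n (m n) (Y n w) (X n w) (\<mu>h n w)
        \<le> (INF \<mu>\<in>K n. residual n (m n) (Y n w) (X n w) \<mu>) + \<epsilon> n w)} \<subseteq> N"
      using AE_conjI[OF \<mu>h[of n] \<mu>h_le[of n]] elim by (auto simp: eventually_ae_filter)
    have "W n \<in> borel_measurable (M n)"
      unfolding W_def[abs_def]
      by (intro borel_measurable_divide borel_measurable_sum borel_measurable_power lm.measurable_xi) auto
    then have A: "?A1 n \<in> events" "?A2 n \<in> events" "?A3 n \<in> events"
      using \<epsilon>_meas[of n] elim by (auto intro!: borel_measurable_less borel_measurable_abs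
          borel_measurable_diff borel_measurable_divide)
    have "?bad n \<subseteq> ?A1 n \<union> ?A2 n \<union> ?A3 n \<union> B \<union> N"
    proof (rule subsetI, rule ccontr)
      fix w assume bad: "w \<in> ?bad n" and "w \<notin> ?A1 n \<union> ?A2 n \<union> ?A3 n \<union> B \<union> N"
      then have w: "w \<in> space (M n)" and W1: "\<bar>W n w - \<sigma>\<^sup>2\<bar> \<le> e / 3" and W2: "\<bar>W n w - \<sigma>\<^sup>2\<bar> \<le> 3 * \<sigma>\<^sup>2"
        and \<epsilon>1: "\<bar>\<epsilon> n w / (r n)\<^sup>2\<bar> \<le> e / 3" and "w \<notin> B" "w \<notin> N"
        by auto
      let ?R = "residual n (m n) (Y n w) (X n w)"
      have Yw: "Y n w = response n (X n w) (\<mu>\<^sub>0 n) (\<xi> n w)"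
        using Y w elim by simp
      from \<open>w \<notin> N\<close> N_sub w have in_K: "\<mu>h n w \<in> K n"
        and near_w: "?R (\<mu>h n w) \<le> (INF \<mu>\<in>K n. ?R \<mu>) + \<epsilon> n w"
        by auto
      have "(enorm (m n) (\<xi> n w))\<^sup>2 / m n \<le> 4 * \<sigma>\<^sup>2"
        using W2 unfolding W by linarith
      then have "(enorm (m n) (\<xi> n w))\<^sup>2 \<le> 4 * \<sigma>\<^sup>2 * m n"
        using fp.m_pos by (simp add: pos_divide_le_eq)
      then have "W n w - 64 * t\<^sup>2 \<le> ?R (\<mu>h n w)"
        using lower[of w "\<mu>h n w"] w \<open>w \<notin> B\<close> in_K by (simp add: Yw)
      moreover have "(INF \<mu>\<in>K n. ?R \<mu>) \<le> ?R (\<mu>\<^sub>0 n)"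
        by (intro cINF_lower bdd_belowI2[of _ 0] residual_nonneg fp.mu0)
      moreover have "?R (\<mu>\<^sub>0 n) = W n w"
        by (simp only: Yw residual_true_signal W)
      moreover have "\<epsilon> n w \<le> e / 3"
      proof -
        have "\<epsilon> n w = \<epsilon> n w / (r n)\<^sup>2 * (r n)\<^sup>2" using fp.r_pos by simp
        also have "\<dots> \<le> e / 3 * 1"
          using abs_le_D1[OF \<epsilon>1] elim e by (intro mult_mono) auto
        finally show ?thesis by simp
      qed
      ultimately have "\<bar>?R (\<mu>h n w) - \<sigma>\<^sup>2\<bar> \<le> e"
        using near_w W1 t_sq by linarith
      then show False using bad by simp
    qed
    then have "measure (M n) (?bad n) \<le> prob (?A1 n \<union> ?A2 n \<union> ?A3 n \<union> B \<union> N)"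
      by (intro finite_measure_mono sets.Un A B(1) null_setsD2[OF N])
    also have "\<dots> \<le> prob (?A1 n \<union> ?A2 n \<union> ?A3 n \<union> B) + prob N"
      by (intro measure_Un_le sets.Un A B(1) null_setsD2[OF N])
    also have "prob N = 0"
      using N by (simp add: null_sets_def measure_def)
    also have "prob (?A1 n \<union> ?A2 n \<union> ?A3 n \<union> B) \<le> prob (?A1 n \<union> ?A2 n \<union> ?A3 n) + prob B"
      by (intro measure_Un_le sets.Un A B(1))
    also have "prob (?A1 n \<union> ?A2 n \<union> ?A3 n) \<le> prob (?A1 n \<union> ?A2 n) + prob (?A3 n)"
      by (intro measure_Un_le sets.Un A)
    also have "prob (?A1 n \<union> ?A2 n) \<le> prob (?A1 n) + prob (?A2 n)"
      by (intro measure_Un_le sets.Un A)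
    finally show ?case using B(2) by linarith
  qed
  then show "(\<lambda>n. measure (M n) (?bad n)) \<longlonglongrightarrow> 0"
    by (intro real_tendsto_sandwich[OF _ _ tendsto_const u]) auto
qed

lemma filterlim_nat_at_top_if_inverse_tendsto_zero:
  fixes m :: "nat \<Rightarrow> nat"
  assumes "(\<lambda>n. c / m n) \<longlonglongrightarrow> 0" "0 < c" "\<forall>\<^sub>F n in sequentially. 0 < m n"
  shows "filterlim m at_top sequentially"
  unfolding filterlim_at_top
proof
  fix Z :: nat
  have "0 < c / (Z + 1)" using assms by simp
  from order_tendstoD(2)[OF assms(1) this] assms(3)
  show "\<forall>\<^sub>F n in sequentially. Z \<le> m n"
  proof eventually_elim
    case (elim n)
    then have "real Z + 1 > m n \<longrightarrow> False \<or> True" by simp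
    have "c * (real Z + 1) < c * m n"
      using elim assms(2) by (simp add: field_simps)
    then have "real Z + 1 < m n" using assms(2) by simp
    then show ?case by linarith
  qed
qed

theorem proposition2p4:
  fixes \<sigma> :: real and D :: "real measure"
    and m :: "nat \<Rightarrow> nat" and K :: "nat \<Rightarrow> (nat \<Rightarrow> real) set" and \<mu>\<^sub>0 :: "nat \<Rightarrow> nat \<Rightarrow> real"
    and r :: "nat \<Rightarrow> real"
    and M :: "nat \<Rightarrow> 'w measure"
    and X :: "nat \<Rightarrow> 'w \<Rightarrow> nat \<Rightarrow> nat \<Rightarrow> real" and \<xi> Y :: "nat \<Rightarrow> 'w \<Rightarrow> nat \<Rightarrow> real"
  assumes sigma: "0 < \<sigma>"
    and K: "\<And>n. n \<ge> 1 \<Longrightarrow> closedin (Euclidean_space n) (K n) \<and> convex (K n) \<and> \<mu>\<^sub>0 n \<in> K n"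
    and r: "\<forall>\<^sub>F n in sequentially. stat_dim n (K n) < real (m n) \<and>
              fixed_point_sol \<sigma> n (m n) (K n) (\<mu>\<^sub>0 n) (r n)"
    and D: "real_distribution D" "integrable D (\<lambda>x. x\<^sup>2)" "(\<integral>x. x \<partial>D) = 0" "(\<integral>x. x\<^sup>2 \<partial>D) = \<sigma>\<^sup>2"
    and model: "\<And>n. n \<ge> 1 \<Longrightarrow> design_and_noise D n (m n) (M n) (X n) (\<xi> n)"
    and Y: "\<And>n w. n \<ge> 1 \<Longrightarrow> w \<in> space (M n) \<Longrightarrow> Y n w = response n (X n w) (\<mu>\<^sub>0 n) (\<xi> n w)"
  shows
    "(liminf (\<lambda>n. ereal (real (m n)) / ereal (stat_dim n (tangent_cone n (K n) (\<mu>\<^sub>0 n)))) > 1 \<longrightarrow>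
        limsup (\<lambda>n. ereal (gap \<sigma> n (m n) (K n) (\<mu>\<^sub>0 n) (r n))) < 1)
     \<and>
     ((\<lambda>n. ereal (real (m n)) / ereal (stat_dim n (tangent_cone n (K n) (\<mu>\<^sub>0 n)))) \<longlonglongrightarrow> \<infinity> \<longrightarrow>
        (\<lambda>n. gap \<sigma> n (m n) (K n) (\<mu>\<^sub>0 n) (r n)) \<longlonglongrightarrow> 0 \<and>
        (\<forall>\<mu>h. near_minimizers m K r M Y X \<mu>h \<longrightarrow>
           tendsto_in_prob M (\<lambda>n w. residual n (m n) (Y n w) (X n w) (\<mu>h n w)) (\<sigma>\<^sup>2)))
     \<and>
     ((\<forall>n\<ge>1. cone (K n)) \<longrightarrow>
        (ereal (1 / \<sigma>\<^sup>2) *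
           limsup (\<lambda>n. ereal (r n *
             ((INF \<nu>\<in>lineality_space (K n). enorm n (\<mu>\<^sub>0 n - \<nu>)) / sqrt (real n)))) < 1 \<longrightarrow>
         limsup (\<lambda>n. ereal (gap \<sigma> n (m n) (K n) (\<mu>\<^sub>0 n) (r n))) < 1)
        \<and>
        (r \<longlonglongrightarrow> 0 \<and>
         (\<lambda>n. (INF \<nu>\<in>lineality_space (K n). enorm n (\<mu>\<^sub>0 n - \<nu>)) / sqrt (real n)) \<in> O(\<lambda>_. 1) \<longrightarrow>
           (\<lambda>n. gap \<sigma> n (m n) (K n) (\<mu>\<^sub>0 n) (r n)) \<longlonglongrightarrow> 0 \<and>
           (\<forall>\<mu>h. near_minimizers m K r M Y X \<mu>h \<longrightarrow>
              tendsto_in_prob M (\<lambda>n w. residual n (m n) (Y n w) (X n w) (\<mu>h n w)) (\<sigma>\<^sup>2))))"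
proof -
  define g where "g n = gap \<sigma> n (m n) (K n) (\<mu>\<^sub>0 n) (r n)" for n
  define \<delta> where "\<delta> n = stat_dim n (tangent_cone n (K n) (\<mu>\<^sub>0 n))" for n
  define d where "d n = (INF \<nu>\<in>lineality_space (K n). enorm n (\<mu>\<^sub>0 n - \<nu>)) / sqrt (real n)" for n
  have fixed: "\<forall>\<^sub>F n in sequentially. fixed_point_sol \<sigma> n (m n) (K n) (\<mu>\<^sub>0 n) (r n)"
    using r by eventually_elim simp
  have inst: "\<forall>\<^sub>F n in sequentially. 1 \<le> n \<and> fixed_point_instance n (K n) (\<mu>\<^sub>0 n) (m n) \<sigma> (r n)"
    using fixed eventually_ge_at_top[of 1]
  proof eventually_elim
    case (elim n)
    then show ?case using K sigma by (auto intro!: fixed_point_instance.intro convex_instance.intro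
        closed_convex.intro convex_instance_axioms.intro fixed_point_instance_axioms.intro)
  qed
  \<comment> \<open>Positivity of \<open>\<delta> n\<close> turns the extended quotients into real
    ones; the value 1/2 is used again to make \<open>m\<close> diverge.\<close>
  have basic: "\<forall>\<^sub>F n in sequentially. 0 < m n \<and> 0 < r n \<and> 0 \<le> g n \<and> 1 / 2 \<le> \<delta> n"
    using inst
  proof eventually_elim
    case (elim n)
    then interpret fixed_point_instance n "K n" "\<mu>\<^sub>0 n" "m n" \<sigma> "r n" by simp
    show ?case using m_pos r_pos gap_nonneg stat_dim_ge by (simp add: g_def \<delta>_def)
  qed
  have residual: "\<forall>\<mu>h. near_minimizers m K r M Y X \<mu>h \<longrightarrow>
      tendsto_in_prob M (\<lambda>n w. residual n (m n) (Y n w) (X n w) (\<mu>h n w)) (\<sigma>\<^sup>2)"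
    if "filterlim m at_top sequentially" "r \<longlonglongrightarrow> 0" "g \<longlonglongrightarrow> 0"
    using residual_tendsto_in_prob[OF sigma K fixed D(2,4) model Y that(1,2)] that(3)
    by (simp add: g_def[abs_def])
  have gap_\<delta>: "\<forall>\<^sub>F n in sequentially. \<delta> n \<le> m n \<longrightarrow> g n \<le> \<delta> n / (2 * m n)"
    using inst
  proof eventually_elim
    case (elim n)
    then interpret fixed_point_instance n "K n" "\<mu>\<^sub>0 n" "m n" \<sigma> "r n" by simp
    show ?case using gap_le_stat_dim by (simp add: g_def \<delta>_def)
  qed

  have c1: "limsup (\<lambda>n. ereal (g n)) < 1" if "liminf (\<lambda>n. ereal (real (m n)) / ereal (\<delta> n)) > 1"
  proof -
    \<comment> \<open>The factor 2 in the denominator of \<open>gap_\<delta>\<close> leaves room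
      below 1, so the limit superior stays strictly below it.\<close>
    have "\<forall>\<^sub>F n in sequentially. ereal (g n) \<le> ereal (1 / 2)"
      using less_LiminfD[OF that] basic gap_\<delta>
    proof eventually_elim
      case (elim n)
      then have "1 < ereal (m n / \<delta> n)" by simp
      then have "\<delta> n < m n" using elim by (simp add: field_simps)
      then have "g n \<le> \<delta> n / (2 * m n)" "\<delta> n / (2 * m n) \<le> 1 / 2" using elim by (auto simp: field_simps)
      then show ?case by simp
    qed
    then have "limsup (\<lambda>n. ereal (g n)) \<le> ereal (1 / 2)" by (rule Limsup_bounded)
    also have "\<dots> < 1" by simp
    finally show ?thesis .
  qed
  have c2: "g \<longlonglongrightarrow> 0 \<and> (\<forall>\<mu>h. near_minimizers m K r M Y X \<mu>h \<longrightarrow>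
      tendsto_in_prob M (\<lambda>n w. residual n (m n) (Y n w) (X n w) (\<mu>h n w)) (\<sigma>\<^sup>2))"
    if lim: "(\<lambda>n. ereal (real (m n)) / ereal (\<delta> n)) \<longlonglongrightarrow> \<infinity>"
  proof -
    have big: "\<forall>\<^sub>F n in sequentially. Z < m n / \<delta> n" for Z :: real
    proof -
      have "\<forall>\<^sub>F n in sequentially. ereal Z < ereal (real (m n)) / ereal (\<delta> n)"
        using lim by (simp only: tendsto_PInfty)
      then show ?thesis
        using basic by eventually_elim simp
    qed
    have ratio: "(\<lambda>n. \<delta> n / m n) \<longlonglongrightarrow> 0"
    proof -
      have "filterlim (\<lambda>n. m n / \<delta> n) at_top sequentially"
        using big by (simp add: filterlim_at_top_dense)
      then have "(\<lambda>n. inverse (m n / \<delta> n)) \<longlonglongrightarrow> 0"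
        by (rule tendsto_inverse_0_at_top)
      then show ?thesis by (simp add: inverse_eq_divide)
    qed
    have g: "g \<longlonglongrightarrow> 0"
    proof (rule real_tendsto_sandwich[OF _ _ tendsto_const])
      show "\<forall>\<^sub>F n in sequentially. 0 \<le> g n" using basic by eventually_elim simp
      show "\<forall>\<^sub>F n in sequentially. g n \<le> (\<delta> n / m n) / 2"
        using gap_\<delta> big[of 1] basic by eventually_elim (auto simp: field_simps)
      show "(\<lambda>n. (\<delta> n / m n) / 2) \<longlonglongrightarrow> 0"
        using tendsto_divide[OF ratio tendsto_const[of 2]] by simp
    qed
    have r_sq: "(\<lambda>n. (r n)\<^sup>2) \<longlonglongrightarrow> 0"
    proof (rule real_tendsto_sandwich[OF _ _ tendsto_const])
      show "\<forall>\<^sub>F n in sequentially. (r n)\<^sup>2 \<le> 2 * \<sigma>\<^sup>2 * (\<delta> n / m n)"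
        using inst basic big[of 2]
      proof eventually_elim
        case (elim n)
        then interpret fixed_point_instance n "K n" "\<mu>\<^sub>0 n" "m n" \<sigma> "r n" by simp
        have "2 * \<delta> n \<le> m n" using elim by (simp add: field_simps)
        then show ?case using r_sq_le_stat_dim by (simp add: \<delta>_def)
      qed
      show "(\<lambda>n. 2 * \<sigma>\<^sup>2 * (\<delta> n / m n)) \<longlonglongrightarrow> 0"
        using tendsto_mult_left[OF ratio, of "2 * \<sigma>\<^sup>2"] by simp
    qed auto
    have "r \<longlonglongrightarrow> 0"
    proof (rule Lim_transform_eventually)
      show "(\<lambda>n. sqrt ((r n)\<^sup>2)) \<longlonglongrightarrow> 0"
        using tendsto_real_sqrt[OF r_sq] by simp
      show "\<forall>\<^sub>F n in sequentially. sqrt ((r n)\<^sup>2) = r n"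
        using basic by eventually_elim simp
    qed
    moreover have "filterlim m at_top sequentially"
      unfolding filterlim_at_top
    proof
      fix Z :: nat
      show "\<forall>\<^sub>F n in sequentially. Z \<le> m n"
        \<comment> \<open>Since \<open>\<delta> n \<ge> 1 / 2\<close>, a ratio above
          \<open>2 * Z\<close> gives \<open>m n > Z\<close>.\<close>
        using big[of "2 * real Z"] basic
      proof eventually_elim
        case (elim n)
        then have "2 * real Z * \<delta> n < m n" by (simp add: field_simps)
        moreover have "2 * real Z * (1 / 2) \<le> 2 * real Z * \<delta> n"
          using elim by (intro mult_left_mono) auto
        ultimately show ?case by simp
      qed
    qed
    ultimately show ?thesis using g residual by simp
  qed
  have c3: "limsup (\<lambda>n. ereal (g n)) < 1"
    if cones: "\<forall>n\<ge>1. cone (K n)" and lim: "ereal (1 / \<sigma>\<^sup>2) * limsup (\<lambda>n. ereal (r n * d n)) < 1"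
  proof -
    have "\<forall>\<^sub>F n in sequentially. ereal (g n) \<le> ereal (1 / \<sigma>\<^sup>2) * ereal (r n * d n)"
      using inst
    proof eventually_elim
      case (elim n)
      then interpret fixed_point_instance n "K n" "\<mu>\<^sub>0 n" "m n" \<sigma> "r n" by simp
      interpret fixed_point_cone_instance n "K n" "\<mu>\<^sub>0 n" "m n" \<sigma> "r n"
        using cones elim by unfold_locales auto
      show ?case using gap_le_lineality by (simp add: g_def d_def)
    qed
    then have "limsup (\<lambda>n. ereal (g n)) \<le> limsup (\<lambda>n. ereal (1 / \<sigma>\<^sup>2) * ereal (r n * d n))"
      by (rule Limsup_mono)
    also have "\<dots> = ereal (1 / \<sigma>\<^sup>2) * limsup (\<lambda>n. ereal (r n * d n))"
      by (rule limsup_ereal_mult_left) auto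
    finally show ?thesis using lim by (rule order.strict_trans1)
  qed
  have c4: "g \<longlonglongrightarrow> 0 \<and> (\<forall>\<mu>h. near_minimizers m K r M Y X \<mu>h \<longrightarrow>
      tendsto_in_prob M (\<lambda>n w. residual n (m n) (Y n w) (X n w) (\<mu>h n w)) (\<sigma>\<^sup>2))"
    if cones: "\<forall>n\<ge>1. cone (K n)" and rd: "r \<longlonglongrightarrow> 0 \<and> d \<in> O(\<lambda>_. 1)"
  proof -
    have r0: "r \<longlonglongrightarrow> 0" and d: "d \<in> O(\<lambda>_. 1)" using rd by auto
    have cone_bounds: "\<forall>\<^sub>F n in sequentially. g n \<le> 1 / \<sigma>\<^sup>2 * (r n * d n) \<and>
        \<sigma>\<^sup>2 / 2 / m n \<le> (r n)\<^sup>2 + 2 * \<sigma>\<^sup>2 * g n"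
      using inst
    proof eventually_elim
      case (elim n)
      then interpret fixed_point_instance n "K n" "\<mu>\<^sub>0 n" "m n" \<sigma> "r n" by simp
      interpret fixed_point_cone_instance n "K n" "\<mu>\<^sub>0 n" "m n" \<sigma> "r n"
        using cones elim by unfold_locales auto
      show ?case using gap_le_lineality inverse_m_le by (simp add: g_def d_def)
    qed
    have "(\<lambda>n. r n * d n) \<longlonglongrightarrow> 0"
    proof -
      obtain C where C: "\<forall>\<^sub>F n in sequentially. norm (d n) \<le> C * norm (1::real)"
        using d by (auto elim!: landau_o.bigE)
      have "(\<lambda>n. \<bar>r n\<bar> * C) \<longlonglongrightarrow> 0"
        using tendsto_mult_right[OF tendsto_rabs[OF r0], of C] by simp
      moreover have "\<forall>\<^sub>F n in sequentially. norm (r n * d n) \<le> \<bar>r n\<bar> * C"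
        using C by eventually_elim (simp add: abs_mult mult_left_mono)
      ultimately show ?thesis by (rule Lim_null_comparison[rotated])
    qed
    then have bound: "(\<lambda>n. 1 / \<sigma>\<^sup>2 * (r n * d n)) \<longlonglongrightarrow> 0"
      by (rule tendsto_mult_right_zero)
    have g: "g \<longlonglongrightarrow> 0"
    proof (rule real_tendsto_sandwich[OF _ _ tendsto_const bound])
      show "\<forall>\<^sub>F n in sequentially. 0 \<le> g n" using basic by eventually_elim simp
      show "\<forall>\<^sub>F n in sequentially. g n \<le> 1 / \<sigma>\<^sup>2 * (r n * d n)"
        using cone_bounds by eventually_elim simp
    qed
    \<comment> \<open>The ray bound for cones squeezes the inverse of \<open>m n\<close> to 0, which
      supplies the divergence of \<open>m\<close> required by the weak law.\<close>
    have "(\<lambda>n. \<sigma>\<^sup>2 / 2 / m n) \<longlonglongrightarrow> 0"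
    proof (rule real_tendsto_sandwich[OF _ _ tendsto_const])
      show "\<forall>\<^sub>F n in sequentially. \<sigma>\<^sup>2 / 2 / m n \<le> (r n)\<^sup>2 + 2 * \<sigma>\<^sup>2 * g n"
        using cone_bounds by eventually_elim simp
      show "(\<lambda>n. (r n)\<^sup>2 + 2 * \<sigma>\<^sup>2 * g n) \<longlonglongrightarrow> 0"
        using tendsto_add[OF tendsto_power[OF r0, of 2] tendsto_mult_left[OF g, of "2 * \<sigma>\<^sup>2"]] by simp
    qed auto
    then have "filterlim m at_top sequentially"
      by (rule filterlim_nat_at_top_if_inverse_tendsto_zero) (use sigma basic in \<open>auto elim: eventually_mono\<close>)
    then show ?thesis using g residual r0 by simp
  qed
  show ?thesis
    unfolding g_def[symmetric] \<delta>_def[symmetric] d_def[symmetric]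
    by (intro conjI impI; rule c1 c2[THEN conjunct1] c2[THEN conjunct2] c3
        c4[THEN conjunct1] c4[THEN conjunct2]; assumption)
qed

end
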